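(* Let $Q$ be a finite acyclic quiver with an admissible automorphism $\iota$ and let $F$ be the induced Frobenius functor on $\mathcal{D}(Q)$. Every stability condition in $\mathrm{FStab}\,\mathcal{D}(Q)$ is of Gepner type $(F,0)$. Conversely, any Gepner type stability condition of $\mathcal{D}(Q)$ with auto-equivalence $F$ (that is, of Gepner type $(F,s)$ for some $s\in\mathbb{C}$) belongs to $\mathrm{FStab}\,\mathcal{D}(Q)$.
   Context: Let $q$ be a prime power, $\mathbf{k}=\overline{\mathbb{F}_q}$, and $\varsigma\colon\mathbf{k}\to\mathbf{k}$, $x\mapsto x^q$. An automorphism $\iota$ of $Q$ is admissible if no arrow joins two vertices in the same $\iota$-orbit. On the path algebra $\mathbf{k}Q$ let $F(\sum_s k_sp_s)=\sum_s\varsigma(k_s)\iota(p_s)$. $\mathcal{D}(Q)$ is the bounded derived category of finite dimensional $\mathbf{k}Q$-modules, and $F$ also denotes the auto-equivalence of $\mathcal{D}(Q)$ induced by $F$ (twisting modules along the ring automorphism $F$, so that the simples satisfy $F(S_i)=S_{\iota(i)}$). Every object $M$ has finite $F$-period (minimal $m\ge1$ with $F^m(M)=M$). $\mathrm{Stab}\,\mathcal{D}$ is the space of Bridgeland stability conditions on $\mathcal{D}$, written either $(\mathcal{H},Z)$ (heart of a bounded t-structure and stability function) or $(Z,\mathcal{P})$ (central charge and slicing). $(\mathcal{H},Z)\in\mathrm{Stab}\,\mathcal{D}(Q)$ is $F$-stable if $F(\mathcal{H})=\mathcal{H}$ and $Z(F(M))=Z(M)$ for all $M$; $\mathrm{FStab}\,\mathcal{D}(Q)$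 is the subspace of $F$-stable stability conditions. For $s\in\mathbb{C}$, $s\cdot(Z,\mathcal{P})=(Z\cdot e^{-\mathbf{i}\pi s},\mathcal{P}_{\mathrm{Re}(s)})$ with $\mathcal{P}_x(\phi)=\mathcal{P}(\phi+x)$. For $\Phi\in\mathrm{Aut}\,\mathcal{D}$, $\Phi(Z,\mathcal{P})=(Z\circ\Phi^{-1},\Phi\circ\mathcal{P})$. A stability condition $\sigma$ is of Gepner type $(\Phi,s)$ if $\Phi(\sigma)=s\cdot\sigma$. *)

theory Defs
  imports
    Complex_Main
    "HOL-Library.Function_Algebras"
    "HOL-Combinatorics.Permutations"
    "HOL-Combinatorics.Orbits"
    "HOL-Algebra.Algebraic_Closure_Type"
    "Graph_Theory.Arc_Walk"
begin

no_notation var (\<open>X\<index>\<close>)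

section \<open>Quivers and their automorphisms\<close>

text \<open>
  A quiver is a directed multigraph, possibly with loops: a \<^typ>\<open>('v, 'e) pre_digraph\<close>, finite if
  \<^term>\<open>fin_digraph Q\<close>.  An automorphism is a pair of permutations of the vertices and of the arrows;
  \<open>permutes\<close> extends them by the identity outside the quiver.
\<close>

definition acyclic_quiver :: "('v, 'e) pre_digraph \<Rightarrow> bool" where
  "acyclic_quiver Q \<longleftrightarrow> \<not> (\<exists>p. pre_digraph.cycle Q p)"

definition quiver_automorphism ::
    "('v, 'e) pre_digraph \<Rightarrow> ('v \<Rightarrow> 'v) \<Rightarrow> ('e \<Rightarrow> 'e) \<Rightarrow> bool" where
  "quiver_automorphism Q \<iota>\<^sub>v \<iota>\<^sub>e \<longleftrightarrow>
     \<iota>\<^sub>v permutes verts Q \<and> \<iota>\<^sub>e permutes arcs Q \<and>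
     (\<forall>e\<in>arcs Q. tail Q (\<iota>\<^sub>e e) = \<iota>\<^sub>v (tail Q e) \<and> head Q (\<iota>\<^sub>e e) = \<iota>\<^sub>v (head Q e))"

definition admissible_automorphism ::
    "('v, 'e) pre_digraph \<Rightarrow> ('v \<Rightarrow> 'v) \<Rightarrow> ('e \<Rightarrow> 'e) \<Rightarrow> bool" where
  "admissible_automorphism Q \<iota>\<^sub>v \<iota>\<^sub>e \<longleftrightarrow>
     quiver_automorphism Q \<iota>\<^sub>v \<iota>\<^sub>e \<and> (\<forall>e\<in>arcs Q. head Q e \<notin> orbit \<iota>\<^sub>v (tail Q e))"

section \<open>The path algebra\<close>

text \<open>
  A path is its source together with its list of arrows, in the order in which they are traversed, so
  that \<open>(u, [])\<close> is the trivial path at \<open>u\<close>.  An element of the path algebra is the family of its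
  coefficients.  Addition is pointwise.  The product \<open>s * t\<close> of two paths is \<open>t\<close> followed by \<open>s\<close>, so
  that left modules are the (covariant) representations of the quiver.
\<close>

type_synonym ('v, 'e) path = "'v \<times> 'e list"
type_synonym ('v, 'e, 'k) pathfun = "('v, 'e) path \<Rightarrow> 'k"

definition paths :: "('v, 'e) pre_digraph \<Rightarrow> ('v, 'e) path set" where
  "paths Q = {(u, p). \<exists>v. pre_digraph.awalk Q u p v}"

definition path_end :: "('v, 'e) pre_digraph \<Rightarrow> ('v, 'e) path \<Rightarrow> 'v" where
  "path_end Q = (\<lambda>(u, p). last (pre_digraph.awalk_verts Q u p))"

definition path_algebra :: "('v, 'e) pre_digraph \<Rightarrow> ('v, 'e, 'k::field) pathfun set" where
  "path_algebra Q = {a. finite {s. a s \<noteq> 0} \<and> {s. a s \<noteq> 0} \<subseteq> paths Q}"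

definition path_mult ::
    "('v, 'e) pre_digraph \<Rightarrow> ('v, 'e, 'k::field) pathfun \<Rightarrow> ('v, 'e, 'k) pathfun
      \<Rightarrow> ('v, 'e, 'k) pathfun" where
  "path_mult Q a b =
     (\<lambda>(u, p). \<Sum>i\<le>length p. a (path_end Q (u, take i p), drop i p) * b (u, take i p))"

definition path_one :: "('v, 'e) pre_digraph \<Rightarrow> ('v, 'e, 'k::field) pathfun" where
  "path_one Q = (\<lambda>(u, p). if u \<in> verts Q \<and> p = [] then 1 else 0)"

definition path_scalar :: "('v, 'e) pre_digraph \<Rightarrow> 'k::field \<Rightarrow> ('v, 'e, 'k) pathfun" where
  "path_scalar Q c = (\<lambda>s. c * path_one Q s)"

text \<open>
  The ground field is \<^typ>\<open>'f alg_closure\<close> for a finite field \<^typ>\<open>'f\<close> with \<open>q\<close> elements.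
  The coefficient of \<open>s\<close> in \<open>\<Sum>\<^sub>t \<varsigma>(k\<^sub>t) \<iota>(t)\<close> is \<open>\<varsigma>\<close> of the coefficient at \<open>\<iota>\<^sup>-\<^sup>1(s)\<close>.
\<close>

definition frob_alg ::
    "('v \<Rightarrow> 'v) \<Rightarrow> ('e \<Rightarrow> 'e) \<Rightarrow> ('v, 'e, 'f::{field,finite} alg_closure) pathfun
      \<Rightarrow> ('v, 'e, 'f alg_closure) pathfun" where
  "frob_alg \<iota>\<^sub>v \<iota>\<^sub>e a = 
     (\<lambda>(u, p). (a (inv_into UNIV \<iota>\<^sub>v u, map (inv_into UNIV \<iota>\<^sub>e) p)) ^ card (UNIV :: 'f set))"

section \<open>Finite dimensional modules\<close>

text \<open>
  A module is a subgroup of the additive group \<open>k\<^sup>\<nat>\<close> with an action of the path algebra.  Only the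
  additive group of \<open>k\<^sup>\<nat>\<close> is used: scalars act through the path algebra, which need not be pointwise
  multiplication (and for a twisted module it is not).  Since \<open>k\<^sup>\<nat>\<close> contains every \<open>k\<^sup>n\<close>, every
  finite dimensional module is isomorphic to one of this form.
  The values of an action or of a homomorphism outside the carriers are irrelevant.
\<close>

record ('v, 'e, 'k) kqmod =
  mcar :: "(nat \<Rightarrow> 'k) set"
  mact :: "('v, 'e, 'k) pathfun \<Rightarrow> (nat \<Rightarrow> 'k) \<Rightarrow> (nat \<Rightarrow> 'k)"

definition fd_module :: "('v, 'e) pre_digraph \<Rightarrow> ('v, 'e, 'k::field) kqmod \<Rightarrow> bool" where
  "fd_module Q M \<longleftrightarrow>
     0 \<in> mcar M \<and> (\<forall>x\<in>mcar M. \<forall>y\<in>mcar M. x + y \<in> mcar M) \<and> (\<forall>x\<in>mcar M. - x \<in> mcar M) \<and>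
     (\<forall>a\<in>path_algebra Q. \<forall>x\<in>mcar M. mact M a x \<in> mcar M) \<and>
     (\<forall>a\<in>path_algebra Q. \<forall>x\<in>mcar M. \<forall>y\<in>mcar M. mact M a (x + y) = mact M a x + mact M a y) \<and>
     (\<forall>a\<in>path_algebra Q. \<forall>b\<in>path_algebra Q. \<forall>x\<in>mcar M.
        mact M (a + b) x = mact M a x + mact M b x \<and>
        mact M (path_mult Q a b) x = mact M a (mact M b x)) \<and>
     (\<forall>x\<in>mcar M. mact M (path_one Q) x = x) \<and>
     (\<exists>B. finite B \<and> B \<subseteq> mcar M \<and>
        (\<forall>x\<in>mcar M. \<exists>c. x = (\<Sum>b\<in>B. mact M (path_scalar Q (c b)) b)))"

definition module_hom ::
    "('v, 'e) pre_digraph \<Rightarrow> ('v, 'e, 'k::field) kqmod \<Rightarrow> ('v, 'e, 'k) kqmod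
      \<Rightarrow> ((nat \<Rightarrow> 'k) \<Rightarrow> (nat \<Rightarrow> 'k)) \<Rightarrow> bool" where
  "module_hom Q M N f \<longleftrightarrow>
     (\<forall>x\<in>mcar M. f x \<in> mcar N) \<and>
     (\<forall>x\<in>mcar M. \<forall>y\<in>mcar M. f (x + y) = f x + f y) \<and>
     (\<forall>a\<in>path_algebra Q. \<forall>x\<in>mcar M. f (mact M a x) = mact N a (f x))"

text \<open>
  The twist of \<open>M\<close> along a bijection \<open>\<phi>\<close>: \<open>\<phi>(a)\<close> acts on the twist as \<open>a\<close> does on \<open>M\<close>.  In
  particular, for \<open>\<phi> = frob_alg \<iota>\<^sub>v \<iota>\<^sub>e\<close>, the twist of the simple module at \<open>i\<close> is the one at
  \<open>\<iota>\<^sub>v i\<close>.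
\<close>

definition twist_module ::
    "(('v, 'e, 'k) pathfun \<Rightarrow> ('v, 'e, 'k) pathfun) \<Rightarrow> ('v, 'e, 'k::field) kqmod
      \<Rightarrow> ('v, 'e, 'k) kqmod" where
  "twist_module \<phi> M = \<lparr>mcar = mcar M, mact = (\<lambda>a. mact M (inv_into UNIV \<phi> a))\<rparr>"

text \<open>Direct sums are formed by interleaving sequences.\<close>

definition join :: "(nat \<Rightarrow> 'k) \<Rightarrow> (nat \<Rightarrow> 'k) \<Rightarrow> (nat \<Rightarrow> 'k)" where
  "join x y = (\<lambda>n. if even n then x (n div 2) else y (n div 2))"

definition evens :: "(nat \<Rightarrow> 'k) \<Rightarrow> (nat \<Rightarrow> 'k)" where
  "evens z = (\<lambda>n. z (2 * n))"

definition odds :: "(nat \<Rightarrow> 'k) \<Rightarrow> (nat \<Rightarrow> 'k)" where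
  "odds z = (\<lambda>n. z (2 * n + 1))"

definition sum_module ::
    "('v, 'e, 'k::field) kqmod \<Rightarrow> ('v, 'e, 'k) kqmod \<Rightarrow> ('v, 'e, 'k) kqmod" where
  "sum_module M N =
     \<lparr>mcar = {join x y |x y. x \<in> mcar M \<and> y \<in> mcar N},
      mact = (\<lambda>a z. join (mact M a (evens z)) (mact N a (odds z)))\<rparr>"

section \<open>Bounded complexes\<close>

text \<open>Complexes are graded cohomologically: \<open>cdf C n\<close> maps \<open>cob C n\<close> to \<open>cob C (n + 1)\<close>.\<close>

record ('v, 'e, 'k) cpx =
  cob :: "int \<Rightarrow> ('v, 'e, 'k) kqmod"
  cdf :: "int \<Rightarrow> (nat \<Rightarrow> 'k) \<Rightarrow> (nat \<Rightarrow> 'k)"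

type_synonym 'k gmap = "int \<Rightarrow> (nat \<Rightarrow> 'k) \<Rightarrow> (nat \<Rightarrow> 'k)"

definition bounded_complex :: "('v, 'e) pre_digraph \<Rightarrow> ('v, 'e, 'k::field) cpx \<Rightarrow> bool" where
  "bounded_complex Q C \<longleftrightarrow>
     (\<forall>n. fd_module Q (cob C n)) \<and>
     (\<forall>n. module_hom Q (cob C n) (cob C (n + 1)) (cdf C n)) \<and>
     (\<forall>n. \<forall>x\<in>mcar (cob C n). cdf C (n + 1) (cdf C n x) = 0) \<and>
     (\<exists>b. \<forall>n. \<bar>n\<bar> > b \<longrightarrow> mcar (cob C n) = {0})"

definition chain_map ::
    "('v, 'e) pre_digraph \<Rightarrow> ('v, 'e, 'k::field) cpx \<Rightarrow> ('v, 'e, 'k) cpx \<Rightarrow> 'k gmap \<Rightarrow> bool" where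
  "chain_map Q C D f \<longleftrightarrow>
     (\<forall>n. module_hom Q (cob C n) (cob D n) (f n)) \<and>
     (\<forall>n. \<forall>x\<in>mcar (cob C n). f (n + 1) (cdf C n x) = cdf D n (f n x))"

definition gid :: "'k gmap" where
  "gid = (\<lambda>n x. x)"

definition gcomp :: "'k gmap \<Rightarrow> 'k gmap \<Rightarrow> 'k gmap" where
  "gcomp g f = (\<lambda>n x. g n (f n x))"

definition homotopic ::
    "('v, 'e) pre_digraph \<Rightarrow> ('v, 'e, 'k::field) cpx \<Rightarrow> ('v, 'e, 'k) cpx
      \<Rightarrow> 'k gmap \<Rightarrow> 'k gmap \<Rightarrow> bool" where
  "homotopic Q C D f g \<longleftrightarrow>
     (\<exists>h. (\<forall>n. module_hom Q (cob C n) (cob D (n - 1)) (h n)) \<and>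
          (\<forall>n. \<forall>x\<in>mcar (cob C n). f n x - g n x = cdf D (n - 1) (h n x) + h (n + 1) (cdf C n x)))"

definition cocycles :: "('v, 'e, 'k::field) cpx \<Rightarrow> int \<Rightarrow> (nat \<Rightarrow> 'k) set" where
  "cocycles C n = {x \<in> mcar (cob C n). cdf C n x = 0}"

definition coboundaries :: "('v, 'e, 'k::field) cpx \<Rightarrow> int \<Rightarrow> (nat \<Rightarrow> 'k) set" where
  "coboundaries C n = cdf C (n - 1) ` mcar (cob C (n - 1))"

text \<open>The last two conditions say that the induced maps on cohomology are injective and surjective.\<close>

definition quasi_iso ::
    "('v, 'e) pre_digraph \<Rightarrow> ('v, 'e, 'k::field) cpx \<Rightarrow> ('v, 'e, 'k) cpx \<Rightarrow> 'k gmap \<Rightarrow> bool" where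
  "quasi_iso Q C D f \<longleftrightarrow>
     chain_map Q C D f \<and>
     (\<forall>n. \<forall>x\<in>cocycles C n. f n x \<in> coboundaries D n \<longrightarrow> x \<in> coboundaries C n) \<and>
     (\<forall>n. \<forall>y\<in>cocycles D n. \<exists>x\<in>cocycles C n. y - f n x \<in> coboundaries D n)"

definition shift_cpx :: "('v, 'e, 'k::field) cpx \<Rightarrow> ('v, 'e, 'k) cpx" where
  "shift_cpx C = \<lparr>cob = (\<lambda>n. cob C (n + 1)), cdf = (\<lambda>n x. - cdf C (n + 1) x)\<rparr>"

definition shift_gmap :: "'k gmap \<Rightarrow> 'k gmap" where
  "shift_gmap f = (\<lambda>n. f (n + 1))"

definition twist_cpx ::
    "(('v, 'e, 'k) pathfun \<Rightarrow> ('v, 'e, 'k) pathfun) \<Rightarrow> ('v, 'e, 'k::field) cpx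
      \<Rightarrow> ('v, 'e, 'k) cpx" where
  "twist_cpx \<phi> C = \<lparr>cob = (\<lambda>n. twist_module \<phi> (cob C n)), cdf = cdf C\<rparr>"

definition cone ::
    "('v, 'e, 'k::field) cpx \<Rightarrow> ('v, 'e, 'k) cpx \<Rightarrow> 'k gmap \<Rightarrow> ('v, 'e, 'k) cpx" where
  "cone C D f =
     \<lparr>cob = (\<lambda>n. sum_module (cob C (n + 1)) (cob D n)),
      cdf = (\<lambda>n z. join (- cdf C (n + 1) (evens z)) (f (n + 1) (evens z) + cdf D n (odds z)))\<rparr>"

definition cone_in :: "('k::field) gmap" where
  "cone_in = (\<lambda>n y. join 0 y)"

definition cone_out :: "('k::field) gmap" where
  "cone_out = (\<lambda>n z. evens z)"

section \<open>Triangulated categories: data\<close>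

text \<open>
  \<open>Cmp T X Y Z g f\<close> is the composite of \<open>f : X \<rightarrow> Y\<close> and \<open>g : Y \<rightarrow> Z\<close>; \<open>Sh\<close> and \<open>ShM\<close> are the
  shift \<open>[1]\<close> on objects and morphisms; \<open>(X, Y, Z, f, g, h) \<in> Tri T\<close> says that
  \<open>X \<rightarrow> Y \<rightarrow> Z \<rightarrow> X[1]\<close> is a distinguished triangle.
\<close>

record ('o, 'm) tricat =
  Ob :: "'o set"
  Hom :: "'o \<Rightarrow> 'o \<Rightarrow> 'm set"
  Idn :: "'o \<Rightarrow> 'm"
  Cmp :: "'o \<Rightarrow> 'o \<Rightarrow> 'o \<Rightarrow> 'm \<Rightarrow> 'm \<Rightarrow> 'm"
  Sh :: "'o \<Rightarrow> 'o"
  ShM :: "'o \<Rightarrow> 'o \<Rightarrow> 'm \<Rightarrow> 'm"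
  Tri :: "('o \<times> 'o \<times> 'o \<times> 'm \<times> 'm \<times> 'm) set"

record ('o, 'm) endofunctor =
  fob :: "'o \<Rightarrow> 'o"
  fmor :: "'o \<Rightarrow> 'o \<Rightarrow> 'm \<Rightarrow> 'm"

definition is_iso :: "('o, 'm) tricat \<Rightarrow> 'o \<Rightarrow> 'o \<Rightarrow> 'm \<Rightarrow> bool" where
  "is_iso T X Y f \<longleftrightarrow> f \<in> Hom T X Y \<and>
     (\<exists>g\<in>Hom T Y X. Cmp T X Y X g f = Idn T X \<and> Cmp T Y X Y f g = Idn T Y)"

definition iso_obj :: "('o, 'm) tricat \<Rightarrow> 'o \<Rightarrow> 'o \<Rightarrow> bool" where
  "iso_obj T X Y \<longleftrightarrow> (\<exists>f. is_iso T X Y f)"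

text \<open>The categories of interest are additive, so that \<open>Hom(X, Y) = 0\<close> iff it has just one element.\<close>

definition hom_zero :: "('o, 'm) tricat \<Rightarrow> 'o \<Rightarrow> 'o \<Rightarrow> bool" where
  "hom_zero T X Y \<longleftrightarrow> (\<exists>f. Hom T X Y = {f})"

definition zero_obj :: "('o, 'm) tricat \<Rightarrow> 'o \<Rightarrow> bool" where
  "zero_obj T X \<longleftrightarrow> X \<in> Ob T \<and> (\<forall>Y\<in>Ob T. hom_zero T X Y \<and> hom_zero T Y X)"

definition direct_sum :: "('o, 'm) tricat \<Rightarrow> 'o \<Rightarrow> 'o \<Rightarrow> 'o \<Rightarrow> bool" where
  "direct_sum T A B S \<longleftrightarrow> S \<in> Ob T \<and>
     (\<exists>i\<in>Hom T A S. \<exists>j\<in>Hom T B S. \<forall>X\<in>Ob T. \<forall>f\<in>Hom T A X. \<forall>g\<in>Hom T B X.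
        \<exists>!h. h \<in> Hom T S X \<and> Cmp T A S X h i = f \<and> Cmp T B S X h j = g)"

text \<open>Full additive subcategories, closed under isomorphism, given by their objects.\<close>

definition additive_subcat :: "('o, 'm) tricat \<Rightarrow> 'o set \<Rightarrow> bool" where
  "additive_subcat T P \<longleftrightarrow> P \<subseteq> Ob T \<and>
     (\<forall>X\<in>P. \<forall>Y\<in>Ob T. iso_obj T X Y \<longrightarrow> Y \<in> P) \<and>
     (\<forall>X. zero_obj T X \<longrightarrow> X \<in> P) \<and>
     (\<forall>A\<in>P. \<forall>B\<in>P. \<forall>S. direct_sum T A B S \<longrightarrow> S \<in> P)"

definition ess_image :: "('o, 'm) tricat \<Rightarrow> ('o \<Rightarrow> 'o) \<Rightarrow> 'o set \<Rightarrow> 'o set" where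
  "ess_image T \<phi> P = {X \<in> Ob T. \<exists>Y\<in>P. iso_obj T (\<phi> Y) X}"

definition is_functor :: "('o, 'm) tricat \<Rightarrow> ('o, 'm) endofunctor \<Rightarrow> bool" where
  "is_functor T \<Phi> \<longleftrightarrow>
     (\<forall>X\<in>Ob T. fob \<Phi> X \<in> Ob T \<and> fmor \<Phi> X X (Idn T X) = Idn T (fob \<Phi> X)) \<and>
     (\<forall>X\<in>Ob T. \<forall>Y\<in>Ob T. \<forall>f\<in>Hom T X Y. fmor \<Phi> X Y f \<in> Hom T (fob \<Phi> X) (fob \<Phi> Y)) \<and>
     (\<forall>X\<in>Ob T. \<forall>Y\<in>Ob T. \<forall>Z\<in>Ob T. \<forall>f\<in>Hom T X Y. \<forall>g\<in>Hom T Y Z.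
        fmor \<Phi> X Z (Cmp T X Y Z g f) =
        Cmp T (fob \<Phi> X) (fob \<Phi> Y) (fob \<Phi> Z) (fmor \<Phi> Y Z g) (fmor \<Phi> X Y f))"

text \<open>
  Triangulated functors: \<open>\<eta>\<close> is the natural isomorphism \<open>\<Phi>(X[1]) \<rightarrow> \<Phi>(X)[1]\<close>.
\<close>

definition is_triangulated :: "('o, 'm) tricat \<Rightarrow> ('o, 'm) endofunctor \<Rightarrow> bool" where
  "is_triangulated T \<Phi> \<longleftrightarrow>
     (\<exists>\<eta>. (\<forall>X\<in>Ob T. is_iso T (fob \<Phi> (Sh T X)) (Sh T (fob \<Phi> X)) (\<eta> X)) \<and>
          (\<forall>X\<in>Ob T. \<forall>Y\<in>Ob T. \<forall>f\<in>Hom T X Y.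
             Cmp T (fob \<Phi> (Sh T X)) (fob \<Phi> (Sh T Y)) (Sh T (fob \<Phi> Y))
               (\<eta> Y) (fmor \<Phi> (Sh T X) (Sh T Y) (ShM T X Y f)) =
             Cmp T (fob \<Phi> (Sh T X)) (Sh T (fob \<Phi> X)) (Sh T (fob \<Phi> Y))
               (ShM T (fob \<Phi> X) (fob \<Phi> Y) (fmor \<Phi> X Y f)) (\<eta> X)) \<and>
          (\<forall>X Y Z f g h. (X, Y, Z, f, g, h) \<in> Tri T \<longrightarrow>
             (fob \<Phi> X, fob \<Phi> Y, fob \<Phi> Z, fmor \<Phi> X Y f, fmor \<Phi> Y Z g,
              Cmp T (fob \<Phi> Z) (fob \<Phi> (Sh T X)) (Sh T (fob \<Phi> X)) (\<eta> X) (fmor \<Phi> Z (Sh T X) h))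
             \<in> Tri T))"

definition auto_equivalence :: "('o, 'm) tricat \<Rightarrow> ('o, 'm) endofunctor \<Rightarrow> bool" where
  "auto_equivalence T \<Phi> \<longleftrightarrow>
     is_functor T \<Phi> \<and>
     (\<forall>X\<in>Ob T. \<forall>Y\<in>Ob T. bij_betw (fmor \<Phi> X Y) (Hom T X Y) (Hom T (fob \<Phi> X) (fob \<Phi> Y))) \<and>
     (\<forall>Y\<in>Ob T. \<exists>X\<in>Ob T. iso_obj T (fob \<Phi> X) Y) \<and>
     is_triangulated T \<Phi>"

section \<open>Stability conditions\<close>

text \<open>
  A central charge is a group homomorphism from the Grothendieck group, that is, a function of the
  objects which is additive on distinguished triangles.  Its value outside \<^term>\<open>Ob T\<close> is fixed to
  be \<open>0\<close>, to make the equality of central charges the equality of functions.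
\<close>

type_synonym 'o stab_data = "('o \<Rightarrow> complex) \<times> (real \<Rightarrow> 'o set)"

definition central_charge :: "('o, 'm) tricat \<Rightarrow> ('o \<Rightarrow> complex) \<Rightarrow> bool" where
  "central_charge T Z \<longleftrightarrow>
     (\<forall>X Y W f g h. (X, Y, W, f, g, h) \<in> Tri T \<longrightarrow> Z Y = Z X + Z W) \<and>
     (\<forall>X. X \<notin> Ob T \<longrightarrow> Z X = 0)"

text \<open>
  \<open>hn_filtration T P E n \<phi>\<close>: there are triangles \<open>E\<^sub>i \<rightarrow> E\<^sub>i\<^sub>+\<^sub>1 \<rightarrow> A\<^sub>i \<rightarrow> E\<^sub>i[1]\<close>, \<open>i < n\<close>, with
  \<open>E\<^sub>0 = 0\<close>, \<open>E\<^sub>n = E\<close> and \<open>0 \<noteq> A\<^sub>i \<in> P(\<phi>\<^sub>i)\<close>, where \<open>\<phi>\<^sub>0 > \<phi>\<^sub>1 > \<dots> > \<phi>\<^sub>n\<^sub>-\<^sub>1\<close>.  For \<open>E = 0\<close> one has \<open>n = 0\<close>.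
\<close>

definition hn_filtration ::
    "('o, 'm) tricat \<Rightarrow> (real \<Rightarrow> 'o set) \<Rightarrow> 'o \<Rightarrow> nat \<Rightarrow> (nat \<Rightarrow> real) \<Rightarrow> bool" where
  "hn_filtration T P E n \<phi> \<longleftrightarrow>
     (\<forall>i j. i < j \<and> j < n \<longrightarrow> \<phi> i > \<phi> j) \<and>
     (\<exists>G A. zero_obj T (G 0) \<and> G n = E \<and>
        (\<forall>i<n. A i \<in> P (\<phi> i) \<and> \<not> zero_obj T (A i) \<and>
           (\<exists>f g h. (G i, G (Suc i), A i, f, g, h) \<in> Tri T)))"

definition slicing :: "('o, 'm) tricat \<Rightarrow> (real \<Rightarrow> 'o set) \<Rightarrow> bool" where
  "slicing T P \<longleftrightarrow>
     (\<forall>\<phi>. additive_subcat T (P \<phi>)) \<and>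
     (\<forall>\<phi>. P (\<phi> + 1) = ess_image T (Sh T) (P \<phi>)) \<and>
     (\<forall>\<phi> \<psi>. \<phi> > \<psi> \<longrightarrow> (\<forall>A\<in>P \<phi>. \<forall>B\<in>P \<psi>. hom_zero T A B)) \<and>
     (\<forall>E\<in>Ob T. \<exists>n \<phi>. hn_filtration T P E n \<phi>)"

text \<open>
  Bridgeland stability conditions.  No local finiteness or support property is imposed.
\<close>

definition Stab :: "('o, 'm) tricat \<Rightarrow> 'o stab_data set" where
  "Stab T = {(Z, P). central_charge T Z \<and> slicing T P \<and>
     (\<forall>\<phi>. \<forall>E\<in>P \<phi>. \<not> zero_obj T E \<longrightarrow> (\<exists>m>0. Z E = of_real m * exp (\<i> * of_real (pi * \<phi>))))}"

text \<open>
  The heart \<open>P((0,1])\<close>: the objects all of whose Harder--Narasimhan factors have phase in \<open>(0,1]\<close>.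
  The pair of the heart and the central charge is the other presentation of a stability condition.
\<close>

definition heart :: "('o, 'm) tricat \<Rightarrow> (real \<Rightarrow> 'o set) \<Rightarrow> 'o set" where
  "heart T P = {E \<in> Ob T. \<exists>n \<phi>. hn_filtration T P E n \<phi> \<and> (\<forall>i<n. 0 < \<phi> i \<and> \<phi> i \<le> 1)}"

definition FStab :: "('o, 'm) tricat \<Rightarrow> ('o, 'm) endofunctor \<Rightarrow> 'o stab_data set" where
  "FStab T F = {(Z, P). (Z, P) \<in> Stab T \<and>
     ess_image T (fob F) (heart T P) = heart T P \<and> (\<forall>M\<in>Ob T. Z (fob F M) = Z M)}"

definition scalar_action :: "complex \<Rightarrow> 'o stab_data \<Rightarrow> 'o stab_data" where
  "scalar_action s = (\<lambda>(Z, P). (\<lambda>X. Z X * exp (- \<i> * of_real pi * s), \<lambda>\<phi>. P (\<phi> + Re s)))"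

text \<open>
  \<open>\<Phi>\<^sup>-\<^sup>1(X)\<close> is any object \<open>Y\<close> with \<open>\<Phi>(Y) \<cong> X\<close>; \<open>\<Phi>(P(\<phi>))\<close> is closed under isomorphism.
\<close>

definition functor_action ::
    "('o, 'm) tricat \<Rightarrow> ('o, 'm) endofunctor \<Rightarrow> 'o stab_data \<Rightarrow> 'o stab_data" where
  "functor_action T \<Phi> = (\<lambda>(Z, P).
     (\<lambda>X. if X \<in> Ob T then Z (SOME Y. Y \<in> Ob T \<and> iso_obj T (fob \<Phi> Y) X) else 0,
      \<lambda>\<phi>. ess_image T (fob \<Phi>) (P \<phi>)))"

definition gepner_type ::
    "('o, 'm) tricat \<Rightarrow> ('o, 'm) endofunctor \<Rightarrow> complex \<Rightarrow> 'o stab_data \<Rightarrow> bool" where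
  "gepner_type T \<Phi> s \<sigma> \<longleftrightarrow>
     \<sigma> \<in> Stab T \<and> auto_equivalence T \<Phi> \<and> functor_action T \<Phi> \<sigma> = scalar_action s \<sigma>"

section \<open>The bounded derived category\<close>

text \<open>
  The localization of the homotopy category of bounded complexes at the quasi-isomorphisms: morphisms
  from \<open>X\<close> to \<open>Y\<close> are equivalence classes of roofs \<open>(W, s, f)\<close>, that is \<open>X \<leftarrow> W \<rightarrow> Y\<close> with \<open>s\<close> a
  quasi-isomorphism.
\<close>

type_synonym ('v, 'e, 'k) roof = "('v, 'e, 'k) cpx \<times> 'k gmap \<times> 'k gmap"

definition roofs ::
    "('v, 'e) pre_digraph \<Rightarrow> ('v, 'e, 'k::field) cpx \<Rightarrow> ('v, 'e, 'k) cpx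
      \<Rightarrow> ('v, 'e, 'k) roof set" where
  "roofs Q X Y = {(W, s, f). bounded_complex Q W \<and> quasi_iso Q W X s \<and> chain_map Q W Y f}"

definition roof_rel ::
    "('v, 'e) pre_digraph \<Rightarrow> ('v, 'e, 'k::field) cpx \<Rightarrow> ('v, 'e, 'k) cpx
      \<Rightarrow> (('v, 'e, 'k) roof \<times> ('v, 'e, 'k) roof) set" where
  "roof_rel Q X Y = {((W, s, f), (W', s', f')).
     (W, s, f) \<in> roofs Q X Y \<and> (W', s', f') \<in> roofs Q X Y \<and>
     (\<exists>V u u'. bounded_complex Q V \<and> chain_map Q V W u \<and> chain_map Q V W' u' \<and>
        quasi_iso Q V X (gcomp s u) \<and>
        homotopic Q V X (gcomp s u) (gcomp s' u') \<and>
        homotopic Q V Y (gcomp f u) (gcomp f' u'))}"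

definition map_class ::
    "('v, 'e) pre_digraph \<Rightarrow> ('v, 'e, 'k::field) cpx \<Rightarrow> ('v, 'e, 'k) cpx \<Rightarrow> 'k gmap
      \<Rightarrow> ('v, 'e, 'k) roof set" where
  "map_class Q X Y f = roof_rel Q X Y `` {(X, gid, f)}"

text \<open>
  The composite of the classes of \<open>X \<leftarrow> W \<rightarrow> Y\<close> and \<open>Y \<leftarrow> W' \<rightarrow> Z\<close> is the class of \<open>X \<leftarrow> V \<rightarrow> Z\<close>, for
  any \<open>W \<leftarrow> V \<rightarrow> W'\<close>, with first arrow a quasi-isomorphism, that makes the square over \<open>Y\<close> commute
  up to homotopy.
\<close>

definition roof_comp ::
    "('v, 'e) pre_digraph \<Rightarrow> ('v, 'e, 'k::field) cpx \<Rightarrow> ('v, 'e, 'k) cpx \<Rightarrow> ('v, 'e, 'k) cpx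
      \<Rightarrow> ('v, 'e, 'k) roof set \<Rightarrow> ('v, 'e, 'k) roof set \<Rightarrow> ('v, 'e, 'k) roof set" where
  "roof_comp Q X Y Z b a = {r. \<exists>W s f W' t g V w h. (W, s, f) \<in> a \<and> (W', t, g) \<in> b \<and>
     bounded_complex Q V \<and> quasi_iso Q V W w \<and> chain_map Q V W' h \<and>
     homotopic Q V Y (gcomp f w) (gcomp t h) \<and>
     ((V, gcomp s w, gcomp g h), r) \<in> roof_rel Q X Z}"

definition roof_category ::
    "('v, 'e) pre_digraph \<Rightarrow> (('v, 'e, 'k::field) cpx, ('v, 'e, 'k) roof set) tricat" where
  "roof_category Q =
     \<lparr>Ob = {C. bounded_complex Q C},
      Hom = (\<lambda>X Y. roofs Q X Y // roof_rel Q X Y),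
      Idn = (\<lambda>X. map_class Q X X gid),
      Cmp = roof_comp Q,
      Sh = shift_cpx,
      ShM = (\<lambda>X Y a. (\<lambda>(W, s, f). (shift_cpx W, shift_gmap s, shift_gmap f)) ` a),
      Tri = {}\<rparr>"

text \<open>
  The distinguished triangles are those isomorphic to \<open>C \<rightarrow> D \<rightarrow> cone u \<rightarrow> C[1]\<close> for a chain map
  \<open>u : C \<rightarrow> D\<close>.  Shifting is a bijection on complexes, so the image of a class of roofs in \<open>ShM\<close> above
  is again a class.
\<close>

definition derived_category ::
    "('v, 'e) pre_digraph \<Rightarrow> (('v, 'e, 'k::field) cpx, ('v, 'e, 'k) roof set) tricat" where
  "derived_category Q = (let T = roof_category Q in T \<lparr>Tri := {(X, Y, Z, f, g, h).
     X \<in> Ob T \<and> Y \<in> Ob T \<and> Z \<in> Ob T \<and>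
     f \<in> Hom T X Y \<and> g \<in> Hom T Y Z \<and> h \<in> Hom T Z (Sh T X) \<and>
     (\<exists>C D u a b c. C \<in> Ob T \<and> D \<in> Ob T \<and> chain_map Q C D u \<and>
        is_iso T X C a \<and> is_iso T Y D b \<and> is_iso T Z (cone C D u) c \<and>
        Cmp T X Y D b f = Cmp T X C D (map_class Q C D u) a \<and>
        Cmp T Y Z (cone C D u) c g =
          Cmp T Y D (cone C D u) (map_class Q D (cone C D u) cone_in) b \<and>
        Cmp T Z (Sh T X) (Sh T C) (ShM T X C a) h =
          Cmp T Z (cone C D u) (Sh T C) (map_class Q (cone C D u) (Sh T C) cone_out) c)}\<rparr>)"

text \<open>
  The functor induced by twisting modules along \<^const>\<open>frob_alg\<close>.  A homomorphism is also a
  homomorphism of the twisted modules.  As \<^const>\<open>frob_alg\<close> is bijective, twisting is a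
  bijection on complexes, and so the image of a class of roofs is again a class.
\<close>

definition frobenius_functor ::
    "('v \<Rightarrow> 'v) \<Rightarrow> ('e \<Rightarrow> 'e) \<Rightarrow>
      (('v, 'e, 'f::{field,finite} alg_closure) cpx, ('v, 'e, 'f alg_closure) roof set) endofunctor"
  where
  "frobenius_functor \<iota>\<^sub>v \<iota>\<^sub>e =
     \<lparr>fob = twist_cpx (frob_alg \<iota>\<^sub>v \<iota>\<^sub>e),
      fmor = (\<lambda>X Y a. (\<lambda>(W, s, f). (twist_cpx (frob_alg \<iota>\<^sub>v \<iota>\<^sub>e) W, s, f)) ` a)\<rparr>"

end

theory Submission
  imports Defs "HOL-Algebra.Sylow"
begin

text \<open>
  The Frobenius twist \<open>F\<close> is more than an auto-equivalence of the derived category \<open>D\<close>: it permutes the complexes,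
  and leaves the underlying maps alone.  It commutes strictly with shifts, cones and composition, so that every
  notion formulated in \<open>D\<close> is transported by it without natural isomorphisms.  Two arguments then prove the proposition.

  \<^bold>\<open>Invariant stability conditions are of Gepner type \<open>(F, 0)\<close>.\<close>
  Let \<open>\<sigma> = (Z, P)\<close> be invariant.  The twisted slicing \<open>F P\<close> has the same heart and the same central charge as \<open>P\<close>, and
  these two determine a slicing (\<open>semistable_unique\<close>).  Indeed, let \<open>E\<close> be semistable of phase \<open>\<phi>\<close> for \<open>P\<close>, and let
  \<open>X\<close> be the first step of its filtration for \<open>P' = F P\<close>.  As \<open>X\<close> lies in the common heart, it also has a filtration
  for \<open>P\<close>, with first step \<open>W\<close>.  Composition with \<open>W \<rightarrow> X \<rightarrow> E\<close> is injective on \<open>Hom(W, W)\<close>, because the next terms of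
  the long exact sequences are maps from \<open>W[1]\<close> to objects of smaller phase.  So \<open>Hom(W, E) \<noteq> 0\<close>, the phase of \<open>W\<close> is at
  most \<open>\<phi>\<close>, and hence the phase of \<open>Z(X)\<close> is at most \<open>\<phi>\<close>.  All phases of \<open>E\<close> for \<open>P'\<close> are therefore at most \<open>\<phi>\<close>;
  as \<open>Z(E)\<close> has phase \<open>\<phi>\<close>, they are all equal to \<open>\<phi>\<close>, and \<open>E\<close> is semistable for \<open>P'\<close>.

  \<^bold>\<open>Gepner type \<open>(F, s)\<close> forces \<open>s = 0\<close>\<close> (\<open>gepner_imp_FStab\<close>).
  Let \<open>M\<close> be the direct sum of all simple modules.  Permuting the summands along \<open>\<iota>\<close> and applying the Frobenius to the
  coordinates is an isomorphism \<open>F M \<cong> M\<close> (\<open>simples_frob\<close>), and \<open>M \<noteq> 0\<close> unless the quiver is empty and \<open>D = 0\<close>.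
  Applying \<open>F\<close> to the filtration of \<open>M\<close> adds \<open>Re s\<close> to every phase, and the largest phase of an object is
  determined by the object, so that \<open>Re s = 0\<close>.  The first step
  \<open>G\<close> of the filtration is determined by \<open>M\<close> too, whence \<open>F G \<cong> G\<close>.  So \<open>Z(G) = Z(F G)\<close>; as \<open>Z(G) \<noteq> 0\<close> this makes
  the factor \<open>exp (- \<i> \<pi> s)\<close> equal to \<open>1\<close>, and \<open>Im s = 0\<close>.  Then \<open>F\<close> preserves both \<open>P\<close> and \<open>Z\<close>.

  Both arguments need only a few properties of a triangulated category, which are collected in the locale
  \<open>tri_category\<close>: the isomorphisms between objects, and the exactness of \<open>Hom(W, \<cdot>)\<close> and \<open>Hom(\<cdot>, B)\<close> at places where a
  neighbouring term vanishes.  These have to be proved for the derived category as it is defined here.  The localization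
  is treated by an abstract calculus of right fractions (locale \<open>fractions\<close>), whose conditions hold for complexes
  by means of homotopy fibre products; exactness is reduced to statements on the homotopies into and out of a mapping
  cone, and to the five lemma for cones (\<open>cone_quasi_iso\<close>).
\<close>

section \<open>Calculus of fractions\<close>

text \<open>
  A category with a congruence \<open>eqv\<close> (homotopy) and a class \<open>qis\<close> of morphisms to be inverted.  Morphisms are kept as
  representatives and are not replaced by their classes, so that composition is strictly associative and unital.  The
  last two assumptions are the conditions for a calculus of right fractions, up to the congruence.
\<close>

locale fractions =
  fixes ob :: "'o \<Rightarrow> bool" and mor :: "'o \<Rightarrow> 'o \<Rightarrow> 'm \<Rightarrow> bool"
    and eqv :: "'o \<Rightarrow> 'o \<Rightarrow> 'm \<Rightarrow> 'm \<Rightarrow> bool" and qis :: "'o \<Rightarrow> 'o \<Rightarrow> 'm \<Rightarrow> bool"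
    and cmp :: "'m \<Rightarrow> 'm \<Rightarrow> 'm" (infixl \<open>\<cdot>\<close> 70) and one :: "'m"
  assumes assoc: "(h \<cdot> g) \<cdot> f = h \<cdot> (g \<cdot> f)" and idl: "one \<cdot> f = f" and idr: "f \<cdot> one = f"
    and mor_one: "ob X \<Longrightarrow> mor X X one"
    and mor_cmp: "mor X Y f \<Longrightarrow> mor Y Z g \<Longrightarrow> mor X Z (g \<cdot> f)"
    and eqv_refl: "mor X Y f \<Longrightarrow> ob X \<Longrightarrow> ob Y \<Longrightarrow> eqv X Y f f"
    and eqv_sym: "eqv X Y f g \<Longrightarrow> ob X \<Longrightarrow> ob Y \<Longrightarrow> eqv X Y g f"
    and eqv_trans: "eqv X Y f g \<Longrightarrow> eqv X Y g h \<Longrightarrow> ob X \<Longrightarrow> ob Y \<Longrightarrow> eqv X Y f h"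
    and eqv_l: "eqv X Y f g \<Longrightarrow> mor Y Z h \<Longrightarrow> mor X Y f \<Longrightarrow> mor X Y g \<Longrightarrow> ob X \<Longrightarrow> ob Y \<Longrightarrow> ob Z \<Longrightarrow> eqv X Z (h \<cdot> f) (h \<cdot> g)"
    and eqv_r: "eqv Y Z f g \<Longrightarrow> mor X Y h \<Longrightarrow> ob X \<Longrightarrow> ob Y \<Longrightarrow> ob Z \<Longrightarrow> eqv X Z (f \<cdot> h) (g \<cdot> h)"
    and qis_mor: "qis X Y f \<Longrightarrow> mor X Y f"
    and qis_one: "ob X \<Longrightarrow> qis X X one"
    and qis_cmp: "qis X Y f \<Longrightarrow> qis Y Z g \<Longrightarrow> ob X \<Longrightarrow> ob Y \<Longrightarrow> ob Z \<Longrightarrow> qis X Z (g \<cdot> f)"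
    and qis_cancel: "qis X Z (g \<cdot> f) \<Longrightarrow> qis Y Z g \<Longrightarrow> mor X Y f \<Longrightarrow> ob X \<Longrightarrow> ob Y \<Longrightarrow> ob Z \<Longrightarrow> qis X Y f"
    and qis_eqv: "qis X Y f \<Longrightarrow> eqv X Y f g \<Longrightarrow> mor X Y g \<Longrightarrow> ob X \<Longrightarrow> ob Y \<Longrightarrow> qis X Y g"
    and ore: "mor W Y f \<Longrightarrow> qis W' Y t \<Longrightarrow> ob W \<Longrightarrow> ob W' \<Longrightarrow> ob Y \<Longrightarrow>
      \<exists>V w h. ob V \<and> qis V W w \<and> mor V W' h \<and> eqv V Y (f \<cdot> w) (t \<cdot> h)"
    and cancel: "mor W Y f \<Longrightarrow> mor W Y g \<Longrightarrow> qis Y Y' t \<Longrightarrow> eqv W Y' (t \<cdot> f) (t \<cdot> g) \<Longrightarrow> ob W \<Longrightarrow> ob Y \<Longrightarrow> ob Y' \<Longrightarrow>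
      \<exists>V w. ob V \<and> qis V W w \<and> eqv V Y (f \<cdot> w) (g \<cdot> w)"
begin

text \<open>
  Roofs, their equivalence and their composition; with \<open>eqv\<close> the homotopy of chain maps these are
  \<^const>\<open>roofs\<close>, \<^const>\<open>roof_rel\<close> and \<^const>\<open>roof_comp\<close>.
\<close>

definition rfs :: "'o \<Rightarrow> 'o \<Rightarrow> ('o \<times> 'm \<times> 'm) set" where
  "rfs X Y = {(W, s, f). ob W \<and> qis W X s \<and> mor W Y f}"

definition rel :: "'o \<Rightarrow> 'o \<Rightarrow> (('o \<times> 'm \<times> 'm) \<times> ('o \<times> 'm \<times> 'm)) set" where
  "rel X Y = {((W, s, f), (W', s', f')).
     (W, s, f) \<in> rfs X Y \<and> (W', s', f') \<in> rfs X Y \<and>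
     (\<exists>V u u'. ob V \<and> mor V W u \<and> mor V W' u' \<and> qis V X (s \<cdot> u) \<and>
        eqv V X (s \<cdot> u) (s' \<cdot> u') \<and> eqv V Y (f \<cdot> u) (f' \<cdot> u'))}"

definition rcomp :: "'o \<Rightarrow> 'o \<Rightarrow> 'o \<Rightarrow> ('o \<times> 'm \<times> 'm) set \<Rightarrow> ('o \<times> 'm \<times> 'm) set \<Rightarrow> ('o \<times> 'm \<times> 'm) set" where
  "rcomp X Y Z b a = {r. \<exists>W s f W' t g V w h. (W, s, f) \<in> a \<and> (W', t, g) \<in> b \<and>
     ob V \<and> qis V W w \<and> mor V W' h \<and> eqv V Y (f \<cdot> w) (t \<cdot> h) \<and>
     ((V, s \<cdot> w, g \<cdot> h), r) \<in> rel X Z}"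

definition cls :: "'o \<Rightarrow> 'o \<Rightarrow> 'o \<Rightarrow> 'm \<Rightarrow> 'm \<Rightarrow> ('o \<times> 'm \<times> 'm) set" where
  "cls X Y W s f = rel X Y `` {(W, s, f)}"

abbreviation hom where "hom X Y \<equiv> rfs X Y // rel X Y"
abbreviation arr where "arr X Y f \<equiv> cls X Y X one f"

lemma rfs_iff: "(W, s, f) \<in> rfs X Y \<longleftrightarrow> ob W \<and> qis W X s \<and> mor W Y f"
  by (simp add: rfs_def)

lemma relI:
  assumes "ob W" "ob W'" "qis W X s" "qis W' X s'" "mor W Y f" "mor W' Y f'"
    "ob V" "mor V W u" "mor V W' u'" "qis V X (s \<cdot> u)" "eqv V X (s \<cdot> u) (s' \<cdot> u')" "eqv V Y (f \<cdot> u) (f' \<cdot> u')"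
  shows "((W, s, f), (W', s', f')) \<in> rel X Y"
  using assms unfolding rel_def rfs_def by blast

lemma rel_refine:
  assumes "ob X" "ob Y" "ob W" "qis W X s" "mor W Y f" "ob V" "qis V W u"
  shows "((W, s, f), (V, s \<cdot> u, f \<cdot> u)) \<in> rel X Y"
proof (rule relI)
  show "qis V X (s \<cdot> u)" using assms qis_cmp by blast
  then show "qis V X (s \<cdot> u)" .
  show "eqv V X (s \<cdot> u) (s \<cdot> u \<cdot> one)" "eqv V Y (f \<cdot> u) (f \<cdot> u \<cdot> one)"
    using assms eqv_refl mor_cmp qis_mor by (metis idr)+
qed (use assms in \<open>auto intro: mor_one mor_cmp qis_mor\<close>)

text \<open>
  The equivalence of roofs asks for a quasi-isomorphism to the source only; cancellation makes both legs of the
  common refinement quasi-isomorphisms, which is what the composition of refinements needs.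
\<close>

lemma relE:
  assumes "((W, s, f), (W', s', f')) \<in> rel X Y" and X: "ob X" and Y: "ob Y"
  obtains V u u' where "ob W" "ob W'" "qis W X s" "qis W' X s'" "mor W Y f" "mor W' Y f'"
    "ob V" "qis V W u" "qis V W' u'" "eqv V X (s \<cdot> u) (s' \<cdot> u')" "eqv V Y (f \<cdot> u) (f' \<cdot> u')"
proof -
  from assms obtain V u u' where *: "ob W" "ob W'" "qis W X s" "qis W' X s'" "mor W Y f" "mor W' Y f'"
    "ob V" "mor V W u" "mor V W' u'" "qis V X (s \<cdot> u)" "eqv V X (s \<cdot> u) (s' \<cdot> u')" "eqv V Y (f \<cdot> u) (f' \<cdot> u')"
    unfolding rel_def rfs_def by blast
  have u: "qis V W u" using * X by (blast intro: qis_cancel)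
  have "qis V X (s' \<cdot> u')" using * X by (meson qis_eqv qis_mor mor_cmp)
  then have "qis V W' u'" using * X by (blast intro: qis_cancel)
  with * u that show ?thesis by blast
qed

lemma equiv_rel: assumes X: "ob X" and Y: "ob Y" shows "equiv (rfs X Y) (rel X Y)"
proof (rule equivI)
  show "rel X Y \<subseteq> rfs X Y \<times> rfs X Y" unfolding rel_def by auto
  show "refl_on (rfs X Y) (rel X Y)"
  proof (rule refl_onI)
    fix r assume "r \<in> rfs X Y"
    then obtain W s f where r: "r = (W, s, f)" "ob W" "qis W X s" "mor W Y f" by (cases r) (auto simp: rfs_def)
    then show "(r, r) \<in> rel X Y" using rel_refine[OF X Y, of W s f W one] qis_one by (simp add: idr)
  qed
  show "sym (rel X Y)"
  proof (rule symI)
    fix a b assume ab: "(a, b) \<in> rel X Y"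
    obtain W s f W' s' f' where a: "a = (W, s, f)" and b: "b = (W', s', f')" by (metis prod_cases3)
    from ab[unfolded a b] obtain V u u' where *: "ob W" "ob W'" "qis W X s" "qis W' X s'" "mor W Y f" "mor W' Y f'"
      "ob V" "qis V W u" "qis V W' u'" "eqv V X (s \<cdot> u) (s' \<cdot> u')" "eqv V Y (f \<cdot> u) (f' \<cdot> u')"
      using X Y by (rule relE)
    show "(b, a) \<in> rel X Y" unfolding a b
      by (rule relI[where V=V and u=u' and u'=u])
        (use * X Y qis_mor mor_cmp qis_cmp eqv_sym in blast)+
  qed
  show "trans (rel X Y)"
  proof (rule transI)
    fix a b c assume ab: "(a, b) \<in> rel X Y" and bc: "(b, c) \<in> rel X Y"
    obtain W1 s1 f1 W2 s2 f2 W3 s3 f3 where a: "a = (W1, s1, f1)" and b: "b = (W2, s2, f2)" and c: "c = (W3, s3, f3)"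
      by (metis prod_cases3)
    from ab[unfolded a b] obtain V u u' where 1: "ob W1" "ob W2" "qis W1 X s1" "qis W2 X s2" "mor W1 Y f1" "mor W2 Y f2"
      "ob V" "qis V W1 u" "qis V W2 u'" "eqv V X (s1 \<cdot> u) (s2 \<cdot> u')" "eqv V Y (f1 \<cdot> u) (f2 \<cdot> u')"
      using X Y by (rule relE)
    from bc[unfolded b c] obtain V' v v' where 2: "ob W3" "qis W3 X s3" "mor W3 Y f3"
      "ob V'" "qis V' W2 v" "qis V' W3 v'" "eqv V' X (s2 \<cdot> v) (s3 \<cdot> v')" "eqv V' Y (f2 \<cdot> v) (f3 \<cdot> v')"
      using X Y by (rule relE)
    from ore[of V W2 u' V' v] 1 2 qis_mor obtain U p q where
      U: "ob U" "qis U V p" "mor U V' q" "eqv U W2 (u' \<cdot> p) (v \<cdot> q)" by blast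
    have m: "mor U W1 (u \<cdot> p)" "mor U W3 (v' \<cdot> q)" "mor V W2 u'" "mor V' W2 v" "mor U V p" "mor U W2 (u' \<cdot> p)" "mor U W2 (v \<cdot> q)"
      using 1 2 U qis_mor mor_cmp by blast+
    have e: "eqv U T (g1 \<cdot> (u \<cdot> p)) (g3 \<cdot> (v' \<cdot> q))"
      if g: "ob T" "mor W1 T g1" "mor W2 T g2" "mor W3 T g3" "eqv V T (g1 \<cdot> u) (g2 \<cdot> u')" "eqv V' T (g2 \<cdot> v) (g3 \<cdot> v')" for T g1 g2 g3
    proof -
      have "eqv U T (g1 \<cdot> u \<cdot> p) (g2 \<cdot> u' \<cdot> p)" using g(1,5) U m 1 by (blast intro: eqv_r)
      moreover have "eqv U T (g2 \<cdot> (u' \<cdot> p)) (g2 \<cdot> (v \<cdot> q))" using g(1,3) U m 1 by (blast intro: eqv_l)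
      moreover have "eqv U T (g2 \<cdot> v \<cdot> q) (g3 \<cdot> v' \<cdot> q)" using g(1,6) U 2 by (blast intro: eqv_r)
      ultimately show ?thesis using U(1) g(1) by (metis assoc eqv_trans)
    qed
    show "(a, c) \<in> rel X Y" unfolding a c
    proof (rule relI[where V=U and u="u \<cdot> p" and u'="v' \<cdot> q"])
      show "eqv U X (s1 \<cdot> (u \<cdot> p)) (s3 \<cdot> (v' \<cdot> q))" using 1 2 X qis_mor by (intro e[of _ _ s2]) auto
      show "eqv U Y (f1 \<cdot> (u \<cdot> p)) (f3 \<cdot> (v' \<cdot> q))" using 1 2 Y by (intro e[of _ _ f2]) auto
      show "qis U X (s1 \<cdot> (u \<cdot> p))" using 1 U X by (meson qis_cmp)
    qed (use 1 2 U m in auto)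
  qed
qed

lemma cls_in_hom: "ob X \<Longrightarrow> ob Y \<Longrightarrow> ob W \<Longrightarrow> qis W X s \<Longrightarrow> mor W Y f \<Longrightarrow> cls X Y W s f \<in> hom X Y"
  unfolding cls_def by (rule quotientI) (simp add: rfs_iff)

lemma arr_in_hom: "ob X \<Longrightarrow> ob Y \<Longrightarrow> mor X Y f \<Longrightarrow> arr X Y f \<in> hom X Y"
  by (simp add: cls_in_hom qis_one)

lemma homE:
  assumes "a \<in> hom X Y"
  obtains W s f where "a = cls X Y W s f" "ob W" "qis W X s" "mor W Y f"
  using assms unfolding cls_def by (auto elim!: quotientE simp: rfs_iff)

lemma cls_self: "ob X \<Longrightarrow> ob Y \<Longrightarrow> ob W \<Longrightarrow> qis W X s \<Longrightarrow> mor W Y f \<Longrightarrow> (W, s, f) \<in> cls X Y W s f"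
  unfolding cls_def using equiv_rel[of X Y] by (auto simp: equiv_def refl_on_def rfs_iff)

lemma cls_eq_iff:
  assumes "ob X" "ob Y" "ob W" "qis W X s" "mor W Y f" "ob W'" "qis W' X s'" "mor W' Y f'"
  shows "cls X Y W s f = cls X Y W' s' f' \<longleftrightarrow> ((W, s, f), (W', s', f')) \<in> rel X Y"
  unfolding cls_def using assms equiv_rel[of X Y] by (intro eq_equiv_class_iff) (auto simp: rfs_iff)

lemma cls_refine:
  assumes "ob X" "ob Y" "ob W" "qis W X s" "mor W Y f" "ob V" "qis V W u"
  shows "cls X Y V (s \<cdot> u) (f \<cdot> u) = cls X Y W s f"
  using rel_refine[OF assms] assms
  by (subst eq_commute, subst cls_eq_iff) (meson qis_cmp qis_mor mor_cmp)+

lemma cls_cong: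
  assumes "ob X" "ob Y" "ob W" "qis W X s" "mor W Y f" "mor W X s'" "mor W Y f'" "eqv W X s s'" "eqv W Y f f'"
  shows "cls X Y W s f = cls X Y W s' f'"
proof -
  have "((W, s, f), (W, s', f')) \<in> rel X Y"
    by (rule relI[where V=W and u=one and u'=one]) (use assms qis_eqv mor_one idr in auto)
  then show ?thesis using assms qis_eqv by (simp add: cls_eq_iff)
qed

text \<open>
  Addition of fractions in disguise: once the denominators agree, morphisms can be compared by their numerators.
\<close>

lemma common_denominator:
  assumes "ob X" "ob Y" "ob Y'" "a \<in> hom X Y" "b \<in> hom X Y'"
  obtains W s f g where "ob W" "qis W X s" "mor W Y f" "mor W Y' g" "a = cls X Y W s f" "b = cls X Y' W s g"
proof -
  from assms obtain W s f where a: "a = cls X Y W s f" "ob W" "qis W X s" "mor W Y f" by (auto elim: homE)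
  from assms obtain W' s' g where b: "b = cls X Y' W' s' g" "ob W'" "qis W' X s'" "mor W' Y' g" by (auto elim: homE)
  from ore[of W X s W' s'] a b assms qis_mor obtain V w h where
    V: "ob V" "qis V W w" "mor V W' h" "eqv V X (s \<cdot> w) (s' \<cdot> h)" by blast
  have q: "qis V X (s \<cdot> w)" using a V assms qis_cmp by blast
  have q': "qis V X (s' \<cdot> h)" using q V b assms qis_eqv qis_mor mor_cmp by blast
  have h: "qis V W' h" using q' V b assms qis_cancel by blast
  have 1: "a = cls X Y V (s \<cdot> w) (f \<cdot> w)" using cls_refine a V assms by auto
  have "b = cls X Y' V (s' \<cdot> h) (g \<cdot> h)" using cls_refine b V h assms by auto
  also have "\<dots> = cls X Y' V (s \<cdot> w) (g \<cdot> h)"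
    by (rule cls_cong) (use assms V q q' b mor_cmp qis_mor eqv_sym eqv_refl in blast)+
  finally show ?thesis using that[of V "s \<cdot> w" "f \<cdot> w" "g \<cdot> h"] 1 V q a b mor_cmp qis_mor by blast
qed

lemma cls_same_denominator_iff:
  assumes "ob X" "ob Y" "ob W" "qis W X s" "mor W Y f" "mor W Y g"
  shows "cls X Y W s f = cls X Y W s g \<longleftrightarrow> (\<exists>V w. ob V \<and> qis V W w \<and> eqv V Y (f \<cdot> w) (g \<cdot> w))"
proof
  assume "cls X Y W s f = cls X Y W s g"
  then have "((W, s, f), (W, s, g)) \<in> rel X Y" using assms by (simp add: cls_eq_iff)
  then obtain V u u' where *: "ob V" "qis V W u" "qis V W u'" "eqv V X (s \<cdot> u) (s \<cdot> u')" "eqv V Y (f \<cdot> u) (g \<cdot> u')"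
    using assms(1,2) by (rule relE)
  obtain U v where U: "ob U" "qis U V v" "eqv U W (u \<cdot> v) (u' \<cdot> v)"
    using cancel[of V W u u' X s] * assms qis_mor by blast
  have 1: "eqv U Y (f \<cdot> u \<cdot> v) (g \<cdot> u' \<cdot> v)" using * U assms qis_mor eqv_r by blast
  have m: "mor U W (u \<cdot> v)" "mor U W (u' \<cdot> v)" using * U qis_mor mor_cmp by blast+
  have "eqv U Y (g \<cdot> (u' \<cdot> v)) (g \<cdot> (u \<cdot> v))"
    by (rule eqv_l) (use m U assms eqv_sym in blast)+
  with 1 have "eqv U Y (f \<cdot> (u \<cdot> v)) (g \<cdot> (u \<cdot> v))" using U assms eqv_trans by (metis assoc)
  then show "\<exists>V w. ob V \<and> qis V W w \<and> eqv V Y (f \<cdot> w) (g \<cdot> w)"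
    using U * assms qis_cmp by blast
next
  assume "\<exists>V w. ob V \<and> qis V W w \<and> eqv V Y (f \<cdot> w) (g \<cdot> w)"
  then obtain V w where V: "ob V" "qis V W w" "eqv V Y (f \<cdot> w) (g \<cdot> w)" by blast
  have q: "qis V X (s \<cdot> w)" using assms V qis_cmp by blast
  have "cls X Y W s f = cls X Y V (s \<cdot> w) (f \<cdot> w)" using cls_refine assms V by auto
  also have "\<dots> = cls X Y V (s \<cdot> w) (g \<cdot> w)"
    by (rule cls_cong) (use assms V q mor_cmp qis_mor eqv_refl in blast)+
  also have "\<dots> = cls X Y W s g" using cls_refine assms V by auto
  finally show "cls X Y W s f = cls X Y W s g" .
qed

text \<open>
  All the data live over a common refinement.  First the two denominators of the composites are refined over the
  refinement of the left roofs (\<open>E\<close>), then over that of the right roofs (\<open>H\<close>).  There the two maps to \<open>W1'\<close> agree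
  only after composition with the denominator \<open>t1\<close>, which is cancelled by a last refinement (\<open>K\<close>).
\<close>

lemma rcomp_well_defined:
  assumes X: "ob X" and Y: "ob Y" and Z: "ob Z"
    and 1: "((W, s, f), (W1, s1, f1)) \<in> rel X Y" and 2: "((W', t, g), (W1', t1, g1)) \<in> rel Y Z"
    and V: "ob V" "qis V W w" "mor V W' h" "eqv V Y (f \<cdot> w) (t \<cdot> h)"
    and V1: "ob V1" "qis V1 W1 w1" "mor V1 W1' h1" "eqv V1 Y (f1 \<cdot> w1) (t1 \<cdot> h1)"
  shows "((V, s \<cdot> w, g \<cdot> h), (V1, s1 \<cdot> w1, g1 \<cdot> h1)) \<in> rel X Z"
proof -
  from 1 X Y obtain A u u1 where A: "ob W" "ob W1" "qis W X s" "qis W1 X s1" "mor W Y f" "mor W1 Y f1"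
    "ob A" "qis A W u" "qis A W1 u1" "eqv A X (s \<cdot> u) (s1 \<cdot> u1)" "eqv A Y (f \<cdot> u) (f1 \<cdot> u1)"
    by (rule relE)
  from 2 Y Z obtain B v v1 where B: "ob W'" "ob W1'" "qis W' Y t" "qis W1' Y t1" "mor W' Z g" "mor W1' Z g1"
    "ob B" "qis B W' v" "qis B W1' v1" "eqv B Y (t \<cdot> v) (t1 \<cdot> v1)" "eqv B Z (g \<cdot> v) (g1 \<cdot> v1)"
    by (rule relE)
  note M = A B V V1 X Y Z
  note [intro] = qis_mor mor_cmp
  obtain C c a where C: "ob C" "qis C A c" "mor C V a" "eqv C W (u \<cdot> c) (w \<cdot> a)"
    using ore[of A W u V w] M by blast
  obtain E e b where E: "ob E" "qis E C e" "mor E V1 b" "eqv E W1 (u1 \<cdot> c \<cdot> e) (w1 \<cdot> b)"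
    using ore[of C W1 "u1 \<cdot> c" V1 w1] M C by blast
  define p p1 x where "p = a \<cdot> e" and "p1 = b" and "x = c \<cdot> e"
  have x: "qis E A x" unfolding x_def using C E M qis_cmp by blast
  have m: "mor E V p" "mor E V1 p1" "mor E A x" unfolding p_def p1_def using C E x by blast+
  have ep: "eqv E W (w \<cdot> p) (u \<cdot> x)"
    using eqv_r[OF C(4), of E e] C E M eqv_sym unfolding p_def x_def by (metis assoc qis_mor)
  have ep1: "eqv E W1 (u1 \<cdot> x) (w1 \<cdot> p1)" using E unfolding p1_def x_def by (simp add: assoc)
  have qp: "qis E V p"
  proof -
    have "qis E W (u \<cdot> x)" using x M E qis_cmp by blast
    then have "qis E W (w \<cdot> p)" using ep m M E by (meson qis_eqv eqv_sym qis_mor mor_cmp)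
    then show ?thesis using M E m qis_cancel by blast
  qed
  obtain H k l where H: "ob H" "qis H E k" "mor H B l" "eqv H W' (h \<cdot> p \<cdot> k) (v \<cdot> l)"
    using ore[of E W' "h \<cdot> p" B v] M E m by blast
  have mk: "mor H E k" "mor H W (w \<cdot> p \<cdot> k)" "mor H W (u \<cdot> x \<cdot> k)" "mor H A (x \<cdot> k)"
      "mor H W1 (u1 \<cdot> x \<cdot> k)" "mor H W1 (w1 \<cdot> p1 \<cdot> k)" "mor H V1 (p1 \<cdot> k)" "mor H V (p \<cdot> k)"
      "mor H W' (h \<cdot> p \<cdot> k)" "mor H W' (v \<cdot> l)" "mor H W1' (v1 \<cdot> l)" "mor H W1' (h1 \<cdot> p1 \<cdot> k)"
    using H m M by blast+
  have ex: "eqv H T (r \<cdot> (w \<cdot> p \<cdot> k)) (r1 \<cdot> (w1 \<cdot> p1 \<cdot> k))"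
    if r: "ob T" "mor W T r" "mor W1 T r1" "eqv A T (r \<cdot> u) (r1 \<cdot> u1)" for T r r1
  proof -
    have 1: "eqv H T (r \<cdot> (w \<cdot> p \<cdot> k)) (r \<cdot> (u \<cdot> x \<cdot> k))"
      by (rule eqv_l[OF eqv_r[OF ep]]) (use r mk H M E in blast)+
    have 2: "eqv H T (r \<cdot> u \<cdot> (x \<cdot> k)) (r1 \<cdot> u1 \<cdot> (x \<cdot> k))"
      by (rule eqv_r) (use r mk H M E in blast)+
    have 3: "eqv H T (r1 \<cdot> (u1 \<cdot> x \<cdot> k)) (r1 \<cdot> (w1 \<cdot> p1 \<cdot> k))"
      by (rule eqv_l[OF eqv_r[OF ep1]]) (use r mk H M E in blast)+
    show ?thesis using 1 2 3 H(1) r(1) by (metis assoc eqv_trans)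
  qed
  have "eqv H Y (t1 \<cdot> (v1 \<cdot> l)) (t1 \<cdot> (h1 \<cdot> p1 \<cdot> k))"
  proof -
    have 1: "eqv H Y (t1 \<cdot> v1 \<cdot> l) (t \<cdot> v \<cdot> l)"
      by (rule eqv_r) (use H M eqv_sym in blast)+
    have 2: "eqv H Y (t \<cdot> (v \<cdot> l)) (t \<cdot> (h \<cdot> p \<cdot> k))"
      by (rule eqv_l) (use H M mk eqv_sym in blast)+
    have 3: "eqv H Y (t \<cdot> h \<cdot> (p \<cdot> k)) (f \<cdot> w \<cdot> (p \<cdot> k))"
      by (rule eqv_r) (use H M mk eqv_sym in blast)+
    have 4: "eqv H Y (f \<cdot> (w \<cdot> p \<cdot> k)) (f1 \<cdot> (w1 \<cdot> p1 \<cdot> k))" using M by (intro ex) auto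
    have 5: "eqv H Y (f1 \<cdot> w1 \<cdot> (p1 \<cdot> k)) (t1 \<cdot> h1 \<cdot> (p1 \<cdot> k))"
      by (rule eqv_r) (use H M mk in blast)+
    show ?thesis using 1 2 3 4 5 H(1) Y unfolding assoc by (metis eqv_trans)
  qed
  then obtain K j where K: "ob K" "qis K H j" "eqv K W1' (v1 \<cdot> l \<cdot> j) (h1 \<cdot> p1 \<cdot> k \<cdot> j)"
    using cancel[of H W1' "v1 \<cdot> l" "h1 \<cdot> p1 \<cdot> k" Y t1] H M mk by (metis assoc)
  show ?thesis
  proof (rule relI[where V=K and u="p \<cdot> k \<cdot> j" and u'="p1 \<cdot> k \<cdot> j"])
    have "eqv H X (s \<cdot> (w \<cdot> p \<cdot> k)) (s1 \<cdot> (w1 \<cdot> p1 \<cdot> k))" using M by (intro ex) auto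
    then have "eqv K X (s \<cdot> (w \<cdot> p \<cdot> k) \<cdot> j) (s1 \<cdot> (w1 \<cdot> p1 \<cdot> k) \<cdot> j)"
      by (rule eqv_r) (use H M K in blast)+
    then show "eqv K X (s \<cdot> w \<cdot> (p \<cdot> k \<cdot> j)) (s1 \<cdot> w1 \<cdot> (p1 \<cdot> k \<cdot> j))" by (simp add: assoc)
    have "qis K V (p \<cdot> k \<cdot> j)" using qp H K E V by (meson qis_cmp)
    then show "qis K X (s \<cdot> w \<cdot> (p \<cdot> k \<cdot> j))" using M K by (meson qis_cmp)
    have mj: "mor K H j" "mor K W' (h \<cdot> p \<cdot> k \<cdot> j)" "mor K W' (v \<cdot> l \<cdot> j)" "mor K B (l \<cdot> j)"
      "mor K W1' (v1 \<cdot> l \<cdot> j)" "mor K W1' (h1 \<cdot> p1 \<cdot> k \<cdot> j)"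
      using K mk H M by blast+
    have 1: "eqv K Z (g \<cdot> (h \<cdot> p \<cdot> k \<cdot> j)) (g \<cdot> (v \<cdot> l \<cdot> j))"
      by (rule eqv_l[OF eqv_r[OF H(4)]]) (use mj K H M in blast)+
    have 2: "eqv K Z (g \<cdot> v \<cdot> (l \<cdot> j)) (g1 \<cdot> v1 \<cdot> (l \<cdot> j))"
      by (rule eqv_r) (use mj K H M in blast)+
    have 3: "eqv K Z (g1 \<cdot> (v1 \<cdot> l \<cdot> j)) (g1 \<cdot> (h1 \<cdot> p1 \<cdot> k \<cdot> j))"
      by (rule eqv_l) (use mj K H M in blast)+
    show "eqv K Z (g \<cdot> h \<cdot> (p \<cdot> k \<cdot> j)) (g1 \<cdot> h1 \<cdot> (p1 \<cdot> k \<cdot> j))"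
      using 1 2 3 K(1) Z unfolding assoc by (metis eqv_trans)
  qed (use M K H mk qis_cmp in blast)+
qed

text \<open>
  So a composite may be computed with whichever square is at hand.
\<close>

lemma rcomp_cls:
  assumes X: "ob X" and Y: "ob Y" and Z: "ob Z"
    and 1: "ob W" "qis W X s" "mor W Y f" and 2: "ob W'" "qis W' Y t" "mor W' Z g"
    and V: "ob V" "qis V W w" "mor V W' h" "eqv V Y (f \<cdot> w) (t \<cdot> h)"
  shows "rcomp X Y Z (cls Y Z W' t g) (cls X Y W s f) = cls X Z V (s \<cdot> w) (g \<cdot> h)"
proof (intro equalityI subsetI)
  fix r assume "r \<in> cls X Z V (s \<cdot> w) (g \<cdot> h)"
  then have "((V, s \<cdot> w, g \<cdot> h), r) \<in> rel X Z" by (simp add: cls_def)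
  then show "r \<in> rcomp X Y Z (cls Y Z W' t g) (cls X Y W s f)"
    unfolding rcomp_def using cls_self[OF X Y 1] cls_self[OF Y Z 2] V by blast
next
  fix r assume "r \<in> rcomp X Y Z (cls Y Z W' t g) (cls X Y W s f)"
  then obtain W1 s1 f1 W1' t1 g1 V1 w1 h1 where *: "(W1, s1, f1) \<in> cls X Y W s f"
    "(W1', t1, g1) \<in> cls Y Z W' t g" "ob V1" "qis V1 W1 w1" "mor V1 W1' h1" "eqv V1 Y (f1 \<cdot> w1) (t1 \<cdot> h1)"
     "((V1, s1 \<cdot> w1, g1 \<cdot> h1), r) \<in> rel X Z" unfolding rcomp_def by blast
  have "((V, s \<cdot> w, g \<cdot> h), (V1, s1 \<cdot> w1, g1 \<cdot> h1)) \<in> rel X Z"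
    using rcomp_well_defined[OF X Y Z _ _ V *(3-6)] *(1,2) by (simp add: cls_def)
  with *(7) show "r \<in> cls X Z V (s \<cdot> w) (g \<cdot> h)"
    using equiv_rel[OF X Z] unfolding cls_def equiv_def by (blast dest: transD)
qed

lemma rcomp_arr:
  assumes "ob X" "ob Y" "ob Z" "ob W" "qis W X s" "mor W Y f" "mor Y Z g"
  shows "rcomp X Y Z (arr Y Z g) (cls X Y W s f) = cls X Z W s (g \<cdot> f)"
proof -
  have "eqv W Y (f \<cdot> one) (one \<cdot> f)" using assms eqv_refl by (simp add: idl idr)
  then have "rcomp X Y Z (arr Y Z g) (cls X Y W s f) = cls X Z W (s \<cdot> one) (g \<cdot> f)"
    using assms qis_one by (intro rcomp_cls) auto
  then show ?thesis by (simp add: idr)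
qed

lemma rcomp_in_hom:
  assumes "ob X" "ob Y" "ob Z" "a \<in> hom X Y" "b \<in> hom Y Z"
  shows "rcomp X Y Z b a \<in> hom X Z"
proof -
  from assms obtain W s f where a: "a = cls X Y W s f" "ob W" "qis W X s" "mor W Y f" by (auto elim: homE)
  from assms obtain W' t g where b: "b = cls Y Z W' t g" "ob W'" "qis W' Y t" "mor W' Z g" by (auto elim: homE)
  obtain V w h where V: "ob V" "qis V W w" "mor V W' h" "eqv V Y (f \<cdot> w) (t \<cdot> h)"
    using ore[of W Y f W' t] a b assms by blast
  have "rcomp X Y Z b a = cls X Z V (s \<cdot> w) (g \<cdot> h)" using a b V assms by (simp add: rcomp_cls)
  also have "\<dots> \<in> hom X Z" using a b V assms qis_cmp mor_cmp by (intro cls_in_hom) blast+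
  finally show ?thesis .
qed

lemma rcomp_id_left: assumes "ob X" "ob Y" "a \<in> hom X Y" shows "rcomp X Y Y (arr Y Y one) a = a"
proof -
  from assms obtain W s f where a: "a = cls X Y W s f" "ob W" "qis W X s" "mor W Y f" by (auto elim: homE)
  then show ?thesis using assms rcomp_arr[of X Y Y W s f one] mor_one by (simp add: idl)
qed

lemma rcomp_id_right: assumes "ob X" "ob Y" "a \<in> hom X Y" shows "rcomp X X Y a (arr X X one) = a"
proof -
  from assms obtain W s f where a: "a = cls X Y W s f" "ob W" "qis W X s" "mor W Y f" by (auto elim: homE)
  have "eqv W X (one \<cdot> s) (s \<cdot> one)" using a assms eqv_refl qis_mor by (simp add: idl idr)
  then show ?thesis using a assms rcomp_cls[of X X Y X one one W s f W s one] mor_one qis_one by (simp add: idl idr)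
qed

text \<open>
  Both composites are represented by the same roof, built from three squares over the middle terms.
\<close>

lemma rcomp_assoc:
  assumes "ob X" "ob Y" "ob Z" "ob U" "a \<in> hom X Y" "b \<in> hom Y Z" "c \<in> hom Z U"
  shows "rcomp X Y U (rcomp Y Z U c b) a = rcomp X Z U c (rcomp X Y Z b a)"
proof -
  from assms obtain W1 s1 f1 where a: "a = cls X Y W1 s1 f1" "ob W1" "qis W1 X s1" "mor W1 Y f1" by (auto elim: homE)
  from assms obtain W2 s2 f2 where b: "b = cls Y Z W2 s2 f2" "ob W2" "qis W2 Y s2" "mor W2 Z f2" by (auto elim: homE)
  from assms obtain W3 s3 f3 where c: "c = cls Z U W3 s3 f3" "ob W3" "qis W3 Z s3" "mor W3 U f3" by (auto elim: homE)
  note M = a(2-) b(2-) c(2-) assms(1-4)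
  obtain A w h where A: "ob A" "qis A W1 w" "mor A W2 h" "eqv A Y (f1 \<cdot> w) (s2 \<cdot> h)"
    using ore[of W1 Y f1 W2 s2] M by blast
  obtain C d k where C: "ob C" "qis C W2 d" "mor C W3 k" "eqv C Z (f2 \<cdot> d) (s3 \<cdot> k)"
    using ore[of W2 Z f2 W3 s3] M by blast
  obtain E e l where E: "ob E" "qis E A e" "mor E C l" "eqv E W2 (h \<cdot> e) (d \<cdot> l)"
    using ore[of A W2 h C d] M A C by blast
  note [intro] = qis_mor mor_cmp
  have m: "mor E W2 (h \<cdot> e)" "mor E W2 (d \<cdot> l)" "mor E A e" "mor E C l" "mor C W2 d" using A C E by blast+
  have q: "qis C Y (s2 \<cdot> d)" "qis E W1 (w \<cdot> e)" "qis A X (s1 \<cdot> w)" using M A C E qis_cmp by blast+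
  have e1: "eqv E Y (f1 \<cdot> (w \<cdot> e)) (s2 \<cdot> d \<cdot> l)"
  proof -
    have "eqv E Y (f1 \<cdot> w \<cdot> e) (s2 \<cdot> h \<cdot> e)" by (rule eqv_r) (use M A E m in blast)+
    moreover have "eqv E Y (s2 \<cdot> (h \<cdot> e)) (s2 \<cdot> (d \<cdot> l))" by (rule eqv_l) (use M A E m in blast)+
    ultimately show ?thesis using E(1) assms(2) by (metis assoc eqv_trans)
  qed
  have e2: "eqv E Z (f2 \<cdot> h \<cdot> e) (s3 \<cdot> (k \<cdot> l))"
  proof -
    have "eqv E Z (f2 \<cdot> d \<cdot> l) (s3 \<cdot> k \<cdot> l)" by (rule eqv_r) (use M C E m in blast)+
    moreover have "eqv E Z (f2 \<cdot> (h \<cdot> e)) (f2 \<cdot> (d \<cdot> l))" by (rule eqv_l) (use M A E m in blast)+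
    ultimately show ?thesis using E(1) assms(3) by (metis assoc eqv_trans)
  qed
  have "rcomp Y Z U c b = cls Y U C (s2 \<cdot> d) (f3 \<cdot> k)" unfolding b(1) c(1)
    by (rule rcomp_cls) (use M C in auto)
  then have L: "rcomp X Y U (rcomp Y Z U c b) a = cls X U E (s1 \<cdot> (w \<cdot> e)) (f3 \<cdot> k \<cdot> l)" unfolding a(1)
    using rcomp_cls[of X Y U W1 s1 f1 C "s2 \<cdot> d" "f3 \<cdot> k" E "w \<cdot> e" l] M A C E q e1 by auto
  have "rcomp X Y Z b a = cls X Z A (s1 \<cdot> w) (f2 \<cdot> h)" unfolding a(1) b(1)
    by (rule rcomp_cls) (use M A in auto)
  then have R: "rcomp X Z U c (rcomp X Y Z b a) = cls X U E (s1 \<cdot> w \<cdot> e) (f3 \<cdot> (k \<cdot> l))" unfolding c(1)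
    using rcomp_cls[OF assms(1,3,4) A(1) q(3) mor_cmp[OF A(3) M(6)] M(7-9) E(1,2) mor_cmp[OF E(3) C(3)] e2] by simp
  show ?thesis unfolding L R by (simp add: assoc)
qed

lemma qis_inverse:
  assumes "ob X" "ob Y" "qis X Y s"
  shows "rcomp X Y X (cls Y X X s one) (arr X Y s) = arr X X one"
    and "rcomp Y X Y (arr X Y s) (cls Y X X s one) = arr Y Y one"
proof -
  have "eqv X Y (s \<cdot> one) (s \<cdot> one)" using assms qis_mor by (simp add: idr eqv_refl)
  then have "rcomp X Y X (cls Y X X s one) (arr X Y s) = cls X X X (one \<cdot> one) (one \<cdot> one)"
    using assms qis_one qis_mor mor_one by (intro rcomp_cls) auto
  then show "rcomp X Y X (cls Y X X s one) (arr X Y s) = arr X X one" by (simp add: idl)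
  have "rcomp Y X Y (arr X Y s) (cls Y X X s one) = cls Y Y X s (s \<cdot> one)"
    using assms qis_mor mor_one by (intro rcomp_arr) auto
  also have "\<dots> = cls Y Y X (one \<cdot> s) (one \<cdot> s)" by (simp add: idl idr)
  also have "\<dots> = arr Y Y one" using assms qis_one mor_one by (intro cls_refine) auto
  finally show "rcomp Y X Y (arr X Y s) (cls Y X X s one) = arr Y Y one" .
qed

end

section \<open>Automorphisms of a category of fractions\<close>

text \<open>
  A strict automorphism acts on the roofs themselves, so that the image of a class of roofs is again a class.  The shift
  and the twists of complexes are of this kind.
\<close>

locale fractions_automorphism = fractions ob mor eqv qis cmp one
  for ob :: "'o \<Rightarrow> bool" and mor :: "'o \<Rightarrow> 'o \<Rightarrow> 'm \<Rightarrow> bool" and eqv qis and cmp (infixl \<open>\<cdot>\<close> 70) and one +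
  fixes t :: "'o \<Rightarrow> 'o" and m :: "'m \<Rightarrow> 'm"
  assumes t_bij: "bij t" and m_bij: "bij m"
    and t_ob: "ob (t X) \<longleftrightarrow> ob X"
    and m_cmp: "m (g \<cdot> f) = m g \<cdot> m f" and m_one: "m one = one"
    and m_mor: "ob X \<Longrightarrow> ob Y \<Longrightarrow> mor (t X) (t Y) (m f) \<longleftrightarrow> mor X Y f"
    and m_eqv: "ob X \<Longrightarrow> ob Y \<Longrightarrow> eqv (t X) (t Y) (m f) (m g) \<longleftrightarrow> eqv X Y f g"
    and m_qis: "ob X \<Longrightarrow> ob Y \<Longrightarrow> qis (t X) (t Y) (m f) \<longleftrightarrow> qis X Y f"
begin

definition rmap :: "'o \<times> 'm \<times> 'm \<Rightarrow> 'o \<times> 'm \<times> 'm" where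
  "rmap = (\<lambda>(W, s, f). (t W, m s, m f))"

lemma rmap_simp [simp]: "rmap (W, s, f) = (t W, m s, m f)" by (simp add: rmap_def)

lemma t_surj: obtains X where "Y = t X"
  using t_bij by (metis bij_pointE)

lemma m_surj: obtains f where "g = m f"
  using m_bij by (metis bij_pointE)

lemma rmap_inj: "inj rmap"
  using t_bij m_bij by (auto simp: inj_on_def bij_def)

lemma rmap_surj: obtains r where "r' = rmap r"
proof -
  obtain W s f where "r' = (W, s, f)" by (cases r')
  moreover obtain W' where "W = t W'" by (rule t_surj)
  moreover obtain s' where "s = m s'" by (rule m_surj)
  moreover obtain f' where "f = m f'" by (rule m_surj)
  ultimately show ?thesis using that[of "(W', s', f')"] by simp
qed

lemma rmap_rfs: "ob X \<Longrightarrow> ob Y \<Longrightarrow> rmap r \<in> rfs (t X) (t Y) \<longleftrightarrow> r \<in> rfs X Y"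
  by (cases r) (auto simp: rfs_def t_ob m_mor m_qis)

lemma rmap_rel:
  assumes X: "ob X" and Y: "ob Y"
  shows "(rmap r, rmap r') \<in> rel (t X) (t Y) \<longleftrightarrow> (r, r') \<in> rel X Y"
proof -
  obtain W s f W' s' f' where r: "r = (W, s, f)" "r' = (W', s', f')" by (metis prod_cases3)
  have "(\<exists>V u u'. ob V \<and> mor V (t W) u \<and> mor V (t W') u' \<and> qis V (t X) (m s \<cdot> u) \<and>
        eqv V (t X) (m s \<cdot> u) (m s' \<cdot> u') \<and> eqv V (t Y) (m f \<cdot> u) (m f' \<cdot> u')) \<longleftrightarrow>
      (\<exists>V u u'. ob (t V) \<and> mor (t V) (t W) (m u) \<and> mor (t V) (t W') (m u') \<and> qis (t V) (t X) (m s \<cdot> m u) \<and>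
        eqv (t V) (t X) (m s \<cdot> m u) (m s' \<cdot> m u') \<and> eqv (t V) (t Y) (m f \<cdot> m u) (m f' \<cdot> m u'))"
    (is "?L \<longleftrightarrow> ?M") by (metis t_surj m_surj)
  also have "?M \<longleftrightarrow> (\<exists>V u u'. ob V \<and> mor V W u \<and> mor V W' u' \<and> qis V X (s \<cdot> u) \<and>
        eqv V X (s \<cdot> u) (s' \<cdot> u') \<and> eqv V Y (f \<cdot> u) (f' \<cdot> u'))" if "ob W" "ob W'"
    using that X Y unfolding m_cmp[symmetric] by (simp add: t_ob m_mor m_qis m_eqv cong: conj_cong)
  ultimately have "r \<in> rfs X Y \<Longrightarrow> r' \<in> rfs X Y \<Longrightarrow> ?L \<longleftrightarrow> (\<exists>V u u'. ob V \<and> mor V W u \<and> mor V W' u' \<and> qis V X (s \<cdot> u) \<and>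
        eqv V X (s \<cdot> u) (s' \<cdot> u') \<and> eqv V Y (f \<cdot> u) (f' \<cdot> u'))" unfolding r rfs_iff by simp
  then show ?thesis
    using rmap_rfs[OF X Y, of r] rmap_rfs[OF X Y, of r'] unfolding r rel_def by auto
qed

lemma rmap_cls:
  assumes X: "ob X" and Y: "ob Y"
  shows "rmap ` cls X Y W s f = cls (t X) (t Y) (t W) (m s) (m f)"
proof (intro equalityI subsetI)
  fix r assume "r \<in> rmap ` cls X Y W s f"
  then show "r \<in> cls (t X) (t Y) (t W) (m s) (m f)"
    using rmap_rel[OF X Y, of "(W, s, f)"] by (auto simp: cls_def simp flip: rmap_simp)
next
  fix r' assume r': "r' \<in> cls (t X) (t Y) (t W) (m s) (m f)"
  obtain r where "r' = rmap r" by (rule rmap_surj)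
  with r' show "r' \<in> rmap ` cls X Y W s f"
    using rmap_rel[OF X Y, of "(W, s, f)" r] by (auto simp: cls_def)
qed

lemma rmap_arr: "ob X \<Longrightarrow> ob Y \<Longrightarrow> rmap ` arr X Y f = arr (t X) (t Y) (m f)"
  by (simp add: rmap_cls m_one)

lemma rmap_hom:
  assumes X: "ob X" and Y: "ob Y"
  shows "bij_betw ((`) rmap) (hom X Y) (hom (t X) (t Y))"
  unfolding bij_betw_def
proof (intro conjI equalityI subsetI)
  show "inj_on ((`) rmap) (hom X Y)" using rmap_inj by (meson inj_image_eq_iff inj_onI)
  fix b assume "b \<in> (`) rmap ` hom X Y"
  then obtain W s f where "b = rmap ` cls X Y W s f" "ob W" "qis W X s" "mor W Y f" by (auto elim: homE)
  then show "b \<in> hom (t X) (t Y)"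
    using X Y by (auto simp: rmap_cls t_ob m_qis m_mor intro!: cls_in_hom)
next
  fix b assume "b \<in> hom (t X) (t Y)"
  then obtain W' s' f' where b: "b = cls (t X) (t Y) W' s' f'" "ob W'" "qis W' (t X) s'" "mor W' (t Y) f'" by (rule homE)
  obtain W where W: "W' = t W" by (rule t_surj)
  obtain s where s: "s' = m s" by (rule m_surj)
  obtain f where f: "f' = m f" by (rule m_surj)
  have "cls X Y W s f \<in> hom X Y" using b X Y unfolding W s f by (auto simp: t_ob m_qis m_mor intro!: cls_in_hom)
  moreover have "b = rmap ` cls X Y W s f" unfolding b W s f rmap_cls[OF X Y] ..
  ultimately show "b \<in> (`) rmap ` hom X Y" by blast
qed

lemma rmap_rcomp:
  assumes X: "ob X" and Y: "ob Y" and Z: "ob Z" and a: "a \<in> hom X Y" and b: "b \<in> hom Y Z"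
  shows "rmap ` rcomp X Y Z b a = rcomp (t X) (t Y) (t Z) (rmap ` b) (rmap ` a)"
proof -
  from a obtain W s f where a: "a = cls X Y W s f" "ob W" "qis W X s" "mor W Y f" by (rule homE)
  from b obtain W' s' g where b: "b = cls Y Z W' s' g" "ob W'" "qis W' Y s'" "mor W' Z g" by (rule homE)
  obtain V w h where V: "ob V" "qis V W w" "mor V W' h" "eqv V Y (f \<cdot> w) (s' \<cdot> h)"
    using ore[of W Y f W' s'] a b Y by blast
  have "rcomp X Y Z b a = cls X Z V (s \<cdot> w) (g \<cdot> h)" unfolding a b by (rule rcomp_cls) (use assms a b V in auto)
  then have 1: "rmap ` rcomp X Y Z b a = cls (t X) (t Z) (t V) (m s \<cdot> m w) (m g \<cdot> m h)" by (simp add: rmap_cls[OF X Z] m_cmp)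
  have 2: "rmap ` a = cls (t X) (t Y) (t W) (m s) (m f)" unfolding a by (rule rmap_cls[OF X Y])
  have 3: "rmap ` b = cls (t Y) (t Z) (t W') (m s') (m g)" unfolding b by (rule rmap_cls[OF Y Z])
  show ?thesis unfolding 1 2 3
    by (rule rcomp_cls[symmetric]) (use X Y Z a b V m_eqv[of V Y "f \<cdot> w" "s' \<cdot> h"] in \<open>simp_all add: t_ob m_mor m_qis m_cmp\<close>)
qed

end

section \<open>Modules and their homomorphisms\<close>

lemma path_scalar_in:
  fixes c :: "'k::field"
  assumes "finite (verts Q)"
  shows "path_scalar Q c \<in> path_algebra Q"
proof -
  have sub: "{s. path_scalar Q c s \<noteq> 0} \<subseteq> verts Q \<times> {[]}"
    by (auto simp: path_scalar_def path_one_def split: if_splits)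
  have "verts Q \<times> {[]} \<subseteq> paths Q"
    by (auto simp: paths_def pre_digraph.awalk_def pre_digraph.cas.simps)
  with sub assms show ?thesis unfolding path_algebra_def
    by (auto intro: finite_subset[OF sub])
qed

lemma fd_zero: "fd_module Q M \<Longrightarrow> 0 \<in> mcar M"
  and fd_add: "fd_module Q M \<Longrightarrow> x \<in> mcar M \<Longrightarrow> y \<in> mcar M \<Longrightarrow> x + y \<in> mcar M"
  and fd_minus: "fd_module Q M \<Longrightarrow> x \<in> mcar M \<Longrightarrow> - x \<in> mcar M"
  and fd_act: "fd_module Q M \<Longrightarrow> a \<in> path_algebra Q \<Longrightarrow> x \<in> mcar M \<Longrightarrow> mact M a x \<in> mcar M"
  and fd_act_add: "fd_module Q M \<Longrightarrow> a \<in> path_algebra Q \<Longrightarrow> x \<in> mcar M \<Longrightarrow> y \<in> mcar M \<Longrightarrow>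
      mact M a (x + y) = mact M a x + mact M a y"
  by (auto simp: fd_module_def)

lemma fd_diff: "fd_module Q M \<Longrightarrow> x \<in> mcar M \<Longrightarrow> y \<in> mcar M \<Longrightarrow> x - y \<in> mcar M"
  using fd_add[of Q M x "- y"] fd_minus[of Q M y] by simp

lemma fd_act_zero: "fd_module Q M \<Longrightarrow> a \<in> path_algebra Q \<Longrightarrow> mact M a 0 = 0"
  using fd_act_add[of Q M a 0 0] by (simp add: fd_zero)

lemma fd_act_minus: "fd_module Q M \<Longrightarrow> a \<in> path_algebra Q \<Longrightarrow> x \<in> mcar M \<Longrightarrow> mact M a (- x) = - mact M a x"
  using fd_act_add[of Q M a x "- x"] by (simp add: fd_act_zero fd_minus minus_unique)

lemmas fd_closed = fd_zero fd_add fd_minus fd_diff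

lemma hom_in: "module_hom Q M N f \<Longrightarrow> x \<in> mcar M \<Longrightarrow> f x \<in> mcar N"
  and hom_add: "module_hom Q M N f \<Longrightarrow> x \<in> mcar M \<Longrightarrow> y \<in> mcar M \<Longrightarrow> f (x + y) = f x + f y"
  and hom_act: "module_hom Q M N f \<Longrightarrow> a \<in> path_algebra Q \<Longrightarrow> x \<in> mcar M \<Longrightarrow> f (mact M a x) = mact N a (f x)"
  by (auto simp: module_hom_def)

lemma hom_0: "module_hom Q M N f \<Longrightarrow> fd_module Q M \<Longrightarrow> f 0 = 0"
  using hom_add[of Q M N f 0 0] by (simp add: fd_zero)

lemma hom_minus: "module_hom Q M N f \<Longrightarrow> fd_module Q M \<Longrightarrow> x \<in> mcar M \<Longrightarrow> f (- x) = - f x"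
  using hom_add[of Q M N f x "- x"] hom_0[of Q M N f] by (simp add: fd_minus minus_unique)

lemma hom_diff: "module_hom Q M N f \<Longrightarrow> fd_module Q M \<Longrightarrow> x \<in> mcar M \<Longrightarrow> y \<in> mcar M \<Longrightarrow> f (x - y) = f x - f y"
proof -
  assume *: "module_hom Q M N f" "fd_module Q M" "x \<in> mcar M" "y \<in> mcar M"
  show ?thesis
    using hom_add[OF *(1,3) fd_minus[OF *(2,4)]] unfolding hom_minus[OF *(1,2,4)] add_uminus_conv_diff .
qed

lemma module_hom_id: "module_hom Q M M (\<lambda>x. x)"
  by (simp add: module_hom_def)

lemma module_hom_comp: "module_hom Q M N f \<Longrightarrow> module_hom Q N P g \<Longrightarrow> module_hom Q M P (\<lambda>x. g (f x))"
  by (simp add: module_hom_def)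

lemma module_hom_zero: "fd_module Q N \<Longrightarrow> module_hom Q M N (\<lambda>x. 0)"
  by (simp add: module_hom_def fd_zero fd_act_zero)

lemma module_hom_add: "fd_module Q N \<Longrightarrow> module_hom Q M N f \<Longrightarrow> module_hom Q M N g \<Longrightarrow> module_hom Q M N (\<lambda>x. f x + g x)"
  by (simp add: module_hom_def fd_add fd_act_add)

lemma module_hom_minus: "fd_module Q N \<Longrightarrow> module_hom Q M N f \<Longrightarrow> module_hom Q M N (\<lambda>x. - f x)"
  by (simp add: module_hom_def fd_minus fd_act_minus)

lemma module_hom_diff: "fd_module Q N \<Longrightarrow> module_hom Q M N f \<Longrightarrow> module_hom Q M N g \<Longrightarrow> module_hom Q M N (\<lambda>x. f x - g x)"
  using module_hom_add[of Q N M f "\<lambda>x. - g x"] module_hom_minus[of Q N M g] by simp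

subsection \<open>Direct sums\<close>

lemma evens_join [simp]: "evens (join x y) = x" by (simp add: evens_def join_def)
lemma odds_join [simp]: "odds (join x y) = y" by (simp add: odds_def join_def)
lemma join_evens_odds [simp]: "join (evens z) (odds z) = z"
  by (rule ext) (simp add: evens_def odds_def join_def)
lemma join_eq_iff: "join x y = join x' y' \<longleftrightarrow> x = x' \<and> y = y'" by (metis evens_join odds_join)
lemma join_eqI: "x = evens z \<Longrightarrow> y = odds z \<Longrightarrow> join x y = z" by simp
lemma evens_0 [simp]: "evens 0 = 0" and odds_0 [simp]: "odds 0 = 0" by (auto simp: evens_def odds_def)
lemma join_0 [simp]: "join 0 0 = 0" by (rule join_eqI) simp_all
lemma evens_add [simp]: "evens (x + y) = evens x + evens y" and odds_add [simp]: "odds (x + y) = odds x + odds y"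
  by (auto simp: evens_def odds_def)
lemma evens_minus [simp]: "evens (- x :: nat \<Rightarrow> 'k::group_add) = - evens x" and odds_minus [simp]: "odds (- x) = - odds x"
  by (auto simp: evens_def odds_def)
lemma evens_diff [simp]: "evens (x - y :: nat \<Rightarrow> 'k::group_add) = evens x - evens y" and odds_diff [simp]: "odds (x - y) = odds x - odds y"
  by (auto simp: evens_def odds_def)
lemma evens_odds_eqI: "evens z = evens z' \<Longrightarrow> odds z = odds z' \<Longrightarrow> z = z'" by (metis join_evens_odds)
lemma join_add [simp]: "join a b + join c d = join (a + c) (b + d)"
  and join_minus [simp]: "- join a' b' = join (- a') (- b' :: nat \<Rightarrow> 'k::group_add)"
  and join_diff [simp]: "join a' b' - join c' d' = join (a' - c') (b' - d')"
  by (rule evens_odds_eqI, simp_all)+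
lemma join_eq_0_iff [simp]: "join x y = 0 \<longleftrightarrow> x = 0 \<and> y = 0" by (metis evens_0 evens_join join_0 odds_0 odds_join)

lemma mcar_sum: "z \<in> mcar (sum_module M N) \<longleftrightarrow> evens z \<in> mcar M \<and> odds z \<in> mcar N"
  by (auto simp: sum_module_def) (metis join_evens_odds)

lemma mact_sum: "mact (sum_module M N) a z = join (mact M a (evens z)) (mact N a (odds z))"
  by (simp add: sum_module_def)

text \<open>
  For the generators, the vector \<open>0\<close> is removed from the two generating sets: their images in the sum are then disjoint.
\<close>

lemma fd_module_sum:
  assumes fin: "finite (verts Q)" and M: "fd_module Q M" and N: "fd_module Q N"
  shows "fd_module Q (sum_module M N)"
proof -
  have gen: "\<exists>B. finite B \<and> 0 \<notin> B \<and> B \<subseteq> mcar L \<and> (\<forall>x\<in>mcar L. \<exists>c. x = (\<Sum>b\<in>B. mact L (path_scalar Q (c b)) b))"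
    if L: "fd_module Q L" for L :: "('a, 'b, 'c) kqmod"
  proof -
    from L obtain B where B: "finite B" "B \<subseteq> mcar L" "\<forall>x\<in>mcar L. \<exists>c. x = (\<Sum>b\<in>B. mact L (path_scalar Q (c b)) b)"
      unfolding fd_module_def by blast
    have "(\<Sum>b\<in>B. mact L (path_scalar Q (c b)) b) = (\<Sum>b\<in>B - {0}. mact L (path_scalar Q (c b)) b)" for c
      using B(1) by (intro sum.mono_neutral_right) (auto simp: fd_act_zero[OF L path_scalar_in[OF fin]])
    then show ?thesis using B by (intro exI[of _ "B - {0}"]) auto
  qed
  obtain A where A: "finite A" "0 \<notin> A" "A \<subseteq> mcar M" "\<forall>x\<in>mcar M. \<exists>c. x = (\<Sum>b\<in>A. mact M (path_scalar Q (c b)) b)"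
    using gen[OF M] by blast
  obtain B where B: "finite B" "0 \<notin> B" "B \<subseteq> mcar N" "\<forall>x\<in>mcar N. \<exists>c. x = (\<Sum>b\<in>B. mact N (path_scalar Q (c b)) b)"
    using gen[OF N] by blast
  define G where "G = (\<lambda>a. join a 0) ` A \<union> join 0 ` B"
  have inj: "inj_on (\<lambda>a. join a (0::nat \<Rightarrow> 'c)) A" "inj_on (join (0::nat \<Rightarrow> 'c)) B" by (auto simp: inj_on_def join_eq_iff)
  have disj: "(\<lambda>a. join a 0) ` A \<inter> join 0 ` B = {}" using A(2) B(2) by (auto simp: join_eq_iff)
  have ev: "evens (sum f S) = (\<Sum>s\<in>S. evens (f s))" "odds (sum f S) = (\<Sum>s\<in>S. odds (f s))"
    for f :: "(nat \<Rightarrow> 'c) \<Rightarrow> nat \<Rightarrow> 'c" and S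
    by (induction S rule: infinite_finite_induct) auto
  have "\<exists>c. z = (\<Sum>b\<in>G. mact (sum_module M N) (path_scalar Q (c b)) b)" if z: "z \<in> mcar (sum_module M N)" for z
  proof -
    from z A(4) obtain c where c: "evens z = (\<Sum>b\<in>A. mact M (path_scalar Q (c b)) b)" by (auto simp: mcar_sum)
    from z B(4) obtain d where d: "odds z = (\<Sum>b\<in>B. mact N (path_scalar Q (d b)) b)" by (auto simp: mcar_sum)
    define e where "e b = (if odds b = 0 then c (evens b) else d (odds b))" for b
    have e1: "e (join a 0) = c a" for a by (simp add: e_def)
    have e2: "b \<in> B \<Longrightarrow> e (join 0 b) = d b" for b using B(2) by (auto simp: e_def)
    have "(\<Sum>b\<in>G. mact (sum_module M N) (path_scalar Q (e b)) b) =
      (\<Sum>b\<in>A. join (mact M (path_scalar Q (c b)) b) 0) + (\<Sum>b\<in>B. join 0 (mact N (path_scalar Q (d b)) b))"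
      unfolding G_def using A(1) B(1) disj inj
      by (subst sum.union_disjoint) (auto simp: sum.reindex mact_sum e1 e2 fd_act_zero[OF M path_scalar_in[OF fin]]
          fd_act_zero[OF N path_scalar_in[OF fin]] intro!: sum.cong)
    also have "\<dots> = z"
    proof (rule evens_odds_eqI)
      show "evens ((\<Sum>b\<in>A. join (mact M (path_scalar Q (c b)) b) 0) + (\<Sum>b\<in>B. join 0 (mact N (path_scalar Q (d b)) b))) = evens z"
        unfolding c evens_add ev evens_join sum.neutral_const add_0_right ..
      show "odds ((\<Sum>b\<in>A. join (mact M (path_scalar Q (c b)) b) 0) + (\<Sum>b\<in>B. join 0 (mact N (path_scalar Q (d b)) b))) = odds z"
        unfolding d odds_add ev odds_join sum.neutral_const add_0_left ..
    qed
    finally show ?thesis by metis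
  qed
  moreover have "finite G" "G \<subseteq> mcar (sum_module M N)"
    using A B M N by (auto simp: G_def mcar_sum fd_zero)
  ultimately have "\<exists>G. finite G \<and> G \<subseteq> mcar (sum_module M N) \<and>
      (\<forall>z\<in>mcar (sum_module M N). \<exists>c. z = (\<Sum>b\<in>G. mact (sum_module M N) (path_scalar Q (c b)) b))" by blast
  moreover have "mact (sum_module M N) (a + b) x = mact (sum_module M N) a x + mact (sum_module M N) b x \<and>
    mact (sum_module M N) (path_mult Q a b) x = mact (sum_module M N) a (mact (sum_module M N) b x)"
    if "a \<in> path_algebra Q" "b \<in> path_algebra Q" "x \<in> mcar (sum_module M N)" for a b x
    using M N that unfolding fd_module_def by (simp add: mcar_sum mact_sum)
  moreover have "\<forall>x\<in>mcar (sum_module M N). mact (sum_module M N) (path_one Q) x = x"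
    using M N unfolding fd_module_def by (simp add: mcar_sum mact_sum)
  ultimately show ?thesis
    unfolding fd_module_def[of Q "sum_module M N"] using M N
    by (simp add: mcar_sum mact_sum fd_closed fd_act fd_act_add)
qed

section \<open>Complexes, homotopies and quasi-isomorphisms\<close>

lemma gcomp_assoc: "gcomp (gcomp h g) f = gcomp h (gcomp g f)" by (simp add: gcomp_def)
lemma gcomp_gid [simp]: "gcomp gid f = f" "gcomp f gid = f" by (auto simp: gcomp_def gid_def)

lemma cpx_fd: "bounded_complex Q C \<Longrightarrow> fd_module Q (cob C n)"
  and cpx_d: "bounded_complex Q C \<Longrightarrow> module_hom Q (cob C n) (cob C (n + 1)) (cdf C n)"
  and cpx_dd: "bounded_complex Q C \<Longrightarrow> x \<in> mcar (cob C n) \<Longrightarrow> cdf C (n + 1) (cdf C n x) = 0"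
  by (auto simp: bounded_complex_def)

lemma cpx_d': "bounded_complex Q C \<Longrightarrow> module_hom Q (cob C (n - 1)) (cob C n) (cdf C (n - 1))"
  using cpx_d[of Q C "n - 1"] by simp

lemma cpx_dd': "bounded_complex Q C \<Longrightarrow> x \<in> mcar (cob C (n - 1)) \<Longrightarrow> cdf C n (cdf C (n - 1) x) = 0"
  using cpx_dd[of Q C x "n - 1"] by simp

lemmas d_in = hom_in[OF cpx_d] and d_in' = hom_in[OF cpx_d']
lemmas d_add = hom_add[OF cpx_d]
lemmas cpx_zero = fd_zero[OF cpx_fd] and cpx_add = fd_add[OF cpx_fd]
  and cpx_minus = fd_minus[OF cpx_fd] and cpx_diff = fd_diff[OF cpx_fd]
lemma d_minus: "bounded_complex Q C \<Longrightarrow> x \<in> mcar (cob C n) \<Longrightarrow> cdf C n (- x) = - cdf C n x"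
  and d_diff: "bounded_complex Q C \<Longrightarrow> x \<in> mcar (cob C n) \<Longrightarrow> y \<in> mcar (cob C n) \<Longrightarrow> cdf C n (x - y) = cdf C n x - cdf C n y"
  and d_zero: "bounded_complex Q C \<Longrightarrow> cdf C n 0 = 0"
  by (auto intro: hom_minus[OF cpx_d] hom_diff[OF cpx_d] hom_0[OF cpx_d] cpx_fd)

lemma chain_hom: "chain_map Q C D f \<Longrightarrow> module_hom Q (cob C n) (cob D n) (f n)"
  and chain_d: "chain_map Q C D f \<Longrightarrow> x \<in> mcar (cob C n) \<Longrightarrow> f (n + 1) (cdf C n x) = cdf D n (f n x)"
  by (auto simp: chain_map_def)

lemma chain_d': "chain_map Q C D f \<Longrightarrow> x \<in> mcar (cob C (n - 1)) \<Longrightarrow> f n (cdf C (n - 1) x) = cdf D (n - 1) (f (n - 1) x)"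
  using chain_d[of Q C D f x "n - 1"] by simp

lemmas chain_in = hom_in[OF chain_hom] and chain_add = hom_add[OF chain_hom]

lemma chain_minus: "chain_map Q C D f \<Longrightarrow> bounded_complex Q C \<Longrightarrow> x \<in> mcar (cob C n) \<Longrightarrow> f n (- x) = - f n x"
  and chain_diff: "chain_map Q C D f \<Longrightarrow> bounded_complex Q C \<Longrightarrow> x \<in> mcar (cob C n) \<Longrightarrow> y \<in> mcar (cob C n) \<Longrightarrow> f n (x - y) = f n x - f n y"
  and chain_0: "chain_map Q C D f \<Longrightarrow> bounded_complex Q C \<Longrightarrow> f n 0 = 0"
  by (auto intro: hom_minus[OF chain_hom] hom_diff[OF chain_hom] hom_0[OF chain_hom] cpx_fd)

lemma chain_map_id: "chain_map Q C C gid"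
  by (simp add: chain_map_def gid_def module_hom_id)

lemma chain_map_comp: "chain_map Q C D f \<Longrightarrow> chain_map Q D E g \<Longrightarrow> chain_map Q C E (gcomp g f)"
  unfolding gcomp_def chain_map_def[of Q C E]
  by (auto intro: module_hom_comp chain_hom simp: chain_d[of Q C D f] chain_d[of Q D E g] chain_in[of Q C D f])

lemma chain_map_zero: "bounded_complex Q D \<Longrightarrow> chain_map Q C D 0"
  by (auto simp: chain_map_def module_hom_def d_zero cpx_zero fd_act_zero[OF cpx_fd])

lemma chain_map_diff: "bounded_complex Q D \<Longrightarrow> chain_map Q C D f \<Longrightarrow> chain_map Q C D g \<Longrightarrow> chain_map Q C D (f - g)"
proof -
  assume *: "bounded_complex Q D" "chain_map Q C D f" "chain_map Q C D g"
  show ?thesis unfolding chain_map_def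
  proof (intro conjI allI ballI)
    fix n
    show "module_hom Q (cob C n) (cob D n) ((f - g) n)"
      using module_hom_diff[OF cpx_fd[OF *(1)] chain_hom[OF *(2)] chain_hom[OF *(3)], of n]
      by (simp add: module_hom_def)
    fix x assume "x \<in> mcar (cob C n)"
    then show "(f - g) (n + 1) (cdf C n x) = cdf D n ((f - g) n x)"
      using * by (simp add: chain_d chain_in d_diff)
  qed
qed

subsection \<open>Homotopy\<close>

lemma homotopicI:
  assumes "\<And>n. module_hom Q (cob C n) (cob D (n - 1)) (h n)"
    and "\<And>n x. x \<in> mcar (cob C n) \<Longrightarrow> f n x - g n x = cdf D (n - 1) (h n x) + h (n + 1) (cdf C n x)"
  shows "homotopic Q C D f g"
  using assms unfolding homotopic_def by blast

lemma homotopic_refl: "bounded_complex Q C \<Longrightarrow> bounded_complex Q D \<Longrightarrow> homotopic Q C D f f"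
  by (rule homotopicI[where h="\<lambda>n x. 0"]) (auto simp: module_hom_zero cpx_fd d_zero)

lemma homotopic_sym: assumes "bounded_complex Q D" "homotopic Q C D f g" shows "homotopic Q C D g f"
proof -
  from assms obtain h where h: "\<And>n. module_hom Q (cob C n) (cob D (n - 1)) (h n)"
    "\<And>n x. x \<in> mcar (cob C n) \<Longrightarrow> f n x - g n x = cdf D (n - 1) (h n x) + h (n + 1) (cdf C n x)"
    unfolding homotopic_def by blast
  show ?thesis
  proof (rule homotopicI[where h="\<lambda>n x. - h n x"])
    fix n x assume x: "x \<in> mcar (cob C n)"
    have "g n x - f n x = - (f n x - g n x)" by simp
    also have "\<dots> = cdf D (n - 1) (- h n x) + - h (n + 1) (cdf C n x)"
      using x h(1) assms(1) by (simp add: h(2) d_minus hom_in[OF h(1)])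
    finally show "g n x - f n x = cdf D (n - 1) (- h n x) + - h (n + 1) (cdf C n x)" .
  qed (use h assms in \<open>auto intro: module_hom_minus cpx_fd\<close>)
qed

lemma homotopic_trans:
  assumes "bounded_complex Q D" "homotopic Q C D f g" "homotopic Q C D g k"
  shows "homotopic Q C D f k"
proof -
  from assms obtain h where h: "\<And>n. module_hom Q (cob C n) (cob D (n - 1)) (h n)"
    "\<And>n x. x \<in> mcar (cob C n) \<Longrightarrow> f n x - g n x = cdf D (n - 1) (h n x) + h (n + 1) (cdf C n x)"
    unfolding homotopic_def by blast
  from assms obtain h' where h': "\<And>n. module_hom Q (cob C n) (cob D (n - 1)) (h' n)"
    "\<And>n x. x \<in> mcar (cob C n) \<Longrightarrow> g n x - k n x = cdf D (n - 1) (h' n x) + h' (n + 1) (cdf C n x)"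
    unfolding homotopic_def by blast
  show ?thesis
  proof (rule homotopicI[where h="\<lambda>n x. h n x + h' n x"])
    fix n x assume x: "x \<in> mcar (cob C n)"
    have "f n x - k n x = (f n x - g n x) + (g n x - k n x)" by simp
    also have "\<dots> = cdf D (n - 1) (h n x + h' n x) + (h (n + 1) (cdf C n x) + h' (n + 1) (cdf C n x))"
      using x d_add[OF assms(1) hom_in[OF h(1) x] hom_in[OF h'(1) x]] by (simp add: h(2) h'(2))
    finally show "f n x - k n x = cdf D (n - 1) (h n x + h' n x) + (h (n + 1) (cdf C n x) + h' (n + 1) (cdf C n x))" .
  qed (use h h' assms in \<open>auto intro: module_hom_add cpx_fd\<close>)
qed

lemma homotopic_comp_left:
  assumes "bounded_complex Q D" "homotopic Q C D f g" "chain_map Q D E k"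
    and "chain_map Q C D f" "chain_map Q C D g" "bounded_complex Q C"
  shows "homotopic Q C E (gcomp k f) (gcomp k g)"
proof -
  from assms obtain h where h: "\<And>n. module_hom Q (cob C n) (cob D (n - 1)) (h n)"
    "\<And>n x. x \<in> mcar (cob C n) \<Longrightarrow> f n x - g n x = cdf D (n - 1) (h n x) + h (n + 1) (cdf C n x)"
    unfolding homotopic_def by blast
  show ?thesis
  proof (rule homotopicI[where h="\<lambda>n x. k (n - 1) (h n x)"])
    fix n x assume x: "x \<in> mcar (cob C n)"
    have hx: "h n x \<in> mcar (cob D (n - 1))" and hdx: "h (n + 1) (cdf C n x) \<in> mcar (cob D n)"
      using x hom_in[OF h(1)[of n]] hom_in[OF h(1)[of "n + 1"]] d_in[OF assms(6)] by auto
    have "gcomp k f n x - gcomp k g n x = k n (f n x - g n x)"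
      using x by (simp add: gcomp_def chain_diff[OF assms(3,1)] chain_in[OF assms(4)] chain_in[OF assms(5)])
    also have "\<dots> = k n (cdf D (n - 1) (h n x)) + k n (h (n + 1) (cdf C n x))"
      using h(2) x hx hdx assms by (simp add: chain_add[OF assms(3)] d_in')
    also have "k n (cdf D (n - 1) (h n x)) = cdf E (n - 1) (k (n - 1) (h n x))"
      using hx by (rule chain_d'[OF assms(3)])
    finally show "gcomp k f n x - gcomp k g n x = cdf E (n - 1) (k (n - 1) (h n x)) + k (n + 1 - 1) (h (n + 1) (cdf C n x))"
      unfolding add_diff_cancel_right' .
  qed (use h assms in \<open>auto intro: module_hom_comp chain_hom\<close>)
qed

lemma homotopic_comp_right:
  assumes "homotopic Q D E f g" "chain_map Q C D k"
  shows "homotopic Q C E (gcomp f k) (gcomp g k)"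
proof -
  from assms obtain h where h: "\<And>n. module_hom Q (cob D n) (cob E (n - 1)) (h n)"
    "\<And>n x. x \<in> mcar (cob D n) \<Longrightarrow> f n x - g n x = cdf E (n - 1) (h n x) + h (n + 1) (cdf D n x)"
    unfolding homotopic_def by blast
  show ?thesis
    by (rule homotopicI[where h="\<lambda>n x. h n (k n x)"])
      (use h assms in \<open>auto intro: module_hom_comp chain_hom simp: gcomp_def chain_in chain_d\<close>)
qed

subsection \<open>Cohomology\<close>

lemma cocycles_iff: "x \<in> cocycles C n \<longleftrightarrow> x \<in> mcar (cob C n) \<and> cdf C n x = 0"
  by (simp add: cocycles_def)

lemma coboundaries_iff: "x \<in> coboundaries C n \<longleftrightarrow> (\<exists>y\<in>mcar (cob C (n - 1)). x = cdf C (n - 1) y)"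
  by (auto simp: coboundaries_def)

lemma coboundaryI: "y \<in> mcar (cob C (n - 1)) \<Longrightarrow> cdf C (n - 1) y \<in> coboundaries C n"
  by (auto simp: coboundaries_def)

lemma cocycles_diff: "bounded_complex Q C \<Longrightarrow> x \<in> cocycles C n \<Longrightarrow> y \<in> cocycles C n \<Longrightarrow> x - y \<in> cocycles C n"
  by (simp add: cocycles_iff cpx_diff d_diff)

lemma coboundaries_cocycles: "bounded_complex Q C \<Longrightarrow> x \<in> coboundaries C n \<Longrightarrow> x \<in> cocycles C n"
  by (auto simp: cocycles_iff coboundaries_iff d_in' cpx_dd')

lemma coboundaries_diff: "bounded_complex Q C \<Longrightarrow> x \<in> coboundaries C n \<Longrightarrow> y \<in> coboundaries C n \<Longrightarrow> x - y \<in> coboundaries C n"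
  unfolding coboundaries_iff by (metis cpx_diff d_diff)

lemma coboundaries_zero: "bounded_complex Q C \<Longrightarrow> 0 \<in> coboundaries C n"
  unfolding coboundaries_iff by (metis cpx_zero d_zero)

lemma coboundaries_minus: "bounded_complex Q C \<Longrightarrow> x \<in> coboundaries C n \<Longrightarrow> - x \<in> coboundaries C n"
  using coboundaries_diff[of Q C 0 n x] coboundaries_zero[of Q C n] by simp

lemma coboundaries_add: "bounded_complex Q C \<Longrightarrow> x \<in> coboundaries C n \<Longrightarrow> y \<in> coboundaries C n \<Longrightarrow> x + y \<in> coboundaries C n"
  using coboundaries_diff[of Q C x n "- y"] coboundaries_minus[of Q C y n] by simp

lemma chain_cocycle: "chain_map Q C D f \<Longrightarrow> bounded_complex Q C \<Longrightarrow> x \<in> cocycles C n \<Longrightarrow> f n x \<in> cocycles D n"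
  using chain_d[of Q C D f x n] by (simp add: cocycles_iff chain_in chain_0[of Q C D f])

lemma chain_coboundary: "chain_map Q C D f \<Longrightarrow> x \<in> coboundaries C n \<Longrightarrow> f n x \<in> coboundaries D n"
  by (auto simp: coboundaries_iff chain_d' intro: chain_in)

lemma qi_chain: "quasi_iso Q C D f \<Longrightarrow> chain_map Q C D f" by (simp add: quasi_iso_def)

lemma qi_inj: "quasi_iso Q C D f \<Longrightarrow> x \<in> cocycles C n \<Longrightarrow> f n x \<in> coboundaries D n \<Longrightarrow> x \<in> coboundaries C n"
  by (auto simp: quasi_iso_def)

lemma qi_surj: "quasi_iso Q C D f \<Longrightarrow> y \<in> cocycles D n \<Longrightarrow> \<exists>x\<in>cocycles C n. y - f n x \<in> coboundaries D n"
  by (auto simp: quasi_iso_def)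

lemma quasi_iso_id: "bounded_complex Q C \<Longrightarrow> quasi_iso Q C C gid"
  unfolding quasi_iso_def gid_def
  by (auto simp: chain_map_id[unfolded gid_def] intro!: coboundaries_zero bexI[where P="\<lambda>x. _ - x \<in> _"])

lemma quasi_iso_comp:
  assumes f: "quasi_iso Q C D f" and g: "quasi_iso Q D E g" and C: "bounded_complex Q C" and D: "bounded_complex Q D" and E: "bounded_complex Q E"
  shows "quasi_iso Q C E (gcomp g f)"
proof -
  note cf = qi_chain[OF f] and cg = qi_chain[OF g]
  have "\<exists>x\<in>cocycles C n. z - g n (f n x) \<in> coboundaries E n" if z: "z \<in> cocycles E n" for n z
  proof -
    from qi_surj[OF g z] obtain y where y: "y \<in> cocycles D n" "z - g n y \<in> coboundaries E n" by blast
    from qi_surj[OF f y(1)] obtain x where x: "x \<in> cocycles C n" "y - f n x \<in> coboundaries D n" by blast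
    have "g n (y - f n x) = g n y - g n (f n x)"
      using x y by (simp add: chain_diff[OF cg D] cocycles_iff chain_in[OF cf])
    then have "g n y - g n (f n x) \<in> coboundaries E n" using chain_coboundary[OF cg x(2)] by simp
    from coboundaries_add[OF E y(2) this] show ?thesis using x(1) by auto
  qed
  moreover have "x \<in> coboundaries C n" if "x \<in> cocycles C n" "g n (f n x) \<in> coboundaries E n" for x n
    using qi_inj[OF f that(1)] qi_inj[OF g _ that(2)] chain_cocycle[OF cf C that(1)] by blast
  ultimately show ?thesis
    unfolding quasi_iso_def using chain_map_comp[OF cf cg] by (auto simp: gcomp_def)
qed

lemma quasi_iso_cancel:
  assumes gf: "quasi_iso Q C E (gcomp g f)" and g: "quasi_iso Q D E g" and f: "chain_map Q C D f"
    and C: "bounded_complex Q C" and D: "bounded_complex Q D"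
  shows "quasi_iso Q C D f"
proof -
  note cg = qi_chain[OF g]
  have "\<exists>x\<in>cocycles C n. y - f n x \<in> coboundaries D n" if y: "y \<in> cocycles D n" for n y
  proof -
    from qi_surj[OF gf chain_cocycle[OF cg D y]] obtain x where
      x: "x \<in> cocycles C n" "g n y - g n (f n x) \<in> coboundaries E n" by (auto simp: gcomp_def)
    have "g n (y - f n x) = g n y - g n (f n x)"
      using x y by (simp add: chain_diff[OF cg D] cocycles_iff chain_in[OF f])
    then show ?thesis using x qi_inj[OF g cocycles_diff[OF D y chain_cocycle[OF f C x(1)]]] by auto
  qed
  moreover have "x \<in> coboundaries C n" if "x \<in> cocycles C n" "f n x \<in> coboundaries D n" for x n
    using qi_inj[OF gf that(1)] chain_coboundary[OF cg that(2)] by (simp add: gcomp_def)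
  ultimately show ?thesis unfolding quasi_iso_def using f by auto
qed

lemma quasi_iso_homotopic:
  assumes f: "quasi_iso Q C D f" and fg: "homotopic Q C D f g" and g: "chain_map Q C D g"
    and C: "bounded_complex Q C" and D: "bounded_complex Q D"
  shows "quasi_iso Q C D g"
proof -
  from fg obtain h where h: "\<And>n. module_hom Q (cob C n) (cob D (n - 1)) (h n)"
    "\<And>n x. x \<in> mcar (cob C n) \<Longrightarrow> f n x - g n x = cdf D (n - 1) (h n x) + h (n + 1) (cdf C n x)"
    unfolding homotopic_def by blast
  have d: "f n x - g n x \<in> coboundaries D n" if "x \<in> cocycles C n" for n x
    using that h(2)[of x n] hom_0[OF h(1) cpx_fd[OF C]] coboundaryI[OF hom_in[OF h(1)]] by (simp add: cocycles_iff)
  have "x \<in> coboundaries C n" if x: "x \<in> cocycles C n" "g n x \<in> coboundaries D n" for x n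
    using qi_inj[OF f x(1)] coboundaries_add[OF D d[OF x(1)] x(2)] by simp
  moreover have "\<exists>x\<in>cocycles C n. y - g n x \<in> coboundaries D n" if y: "y \<in> cocycles D n" for n y
    using qi_surj[OF f y] coboundaries_add[OF D _ d] by fastforce
  ultimately show ?thesis unfolding quasi_iso_def using g by auto
qed

definition acyclic_cpx :: "('v, 'e, 'k::field) cpx \<Rightarrow> bool" where
  "acyclic_cpx C \<longleftrightarrow> (\<forall>n. cocycles C n \<subseteq> coboundaries C n)"

lemma acyclicD: "acyclic_cpx C \<Longrightarrow> x \<in> cocycles C n \<Longrightarrow> x \<in> coboundaries C n"
  by (auto simp: acyclic_cpx_def)

lemma quasi_iso_acyclic:
  assumes f: "chain_map Q C D f" and C: "acyclic_cpx C" and D: "acyclic_cpx D" "bounded_complex Q D" and C': "bounded_complex Q C"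
  shows "quasi_iso Q C D f"
  unfolding quasi_iso_def
proof (intro conjI allI ballI impI)
  fix n y assume y: "y \<in> cocycles D n"
  have "0 \<in> cocycles C n" using C' coboundaries_cocycles coboundaries_zero by blast
  then show "\<exists>x\<in>cocycles C n. y - f n x \<in> coboundaries D n"
    using acyclicD[OF D(1) y] chain_0[OF f C'] by (intro bexI[of _ 0]) simp_all
qed (use f acyclicD[OF C] in auto)

text \<open>
  Homotopic maps agree on cohomology; so the zero map would be surjective on cohomology.
\<close>

lemma acyclic_if_null:
  assumes f: "quasi_iso Q C D f" and h: "homotopic Q C D f 0" and C: "bounded_complex Q C" and D: "bounded_complex Q D"
  shows "acyclic_cpx D"
proof -
  have 0: "quasi_iso Q C D 0" using quasi_iso_homotopic[OF f h chain_map_zero[OF D] C D] .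
  show ?thesis unfolding acyclic_cpx_def using qi_surj[OF 0] by fastforce
qed

section \<open>Shifts and cones\<close>

definition unshift_cpx :: "('v, 'e, 'k::field) cpx \<Rightarrow> ('v, 'e, 'k) cpx" where
  "unshift_cpx C = \<lparr>cob = (\<lambda>n. cob C (n - 1)), cdf = (\<lambda>n x. - cdf C (n - 1) x)\<rparr>"

definition unshift_gmap :: "'k gmap \<Rightarrow> 'k gmap" where
  "unshift_gmap f = (\<lambda>n. f (n - 1))"

lemma cob_shift [simp]: "cob (shift_cpx C) n = cob C (n + 1)" by (simp add: shift_cpx_def)
lemma cdf_shift [simp]: "cdf (shift_cpx C) n x = - cdf C (n + 1) x" by (simp add: shift_cpx_def)
lemma cob_unshift [simp]: "cob (unshift_cpx C) n = cob C (n - 1)" by (simp add: unshift_cpx_def)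
lemma cdf_unshift [simp]: "cdf (unshift_cpx C) n x = - cdf C (n - 1) x" by (simp add: unshift_cpx_def)
lemma shift_unshift_cpx [simp]: "shift_cpx (unshift_cpx C) = C" "unshift_cpx (shift_cpx C) = C"
  by (simp_all add: shift_cpx_def unshift_cpx_def)
lemma shift_unshift_gmap [simp]: "shift_gmap (unshift_gmap f) = f" "unshift_gmap (shift_gmap f) = f"
  by (simp_all add: shift_gmap_def unshift_gmap_def)
lemma shift_gmap_apply [simp]: "shift_gmap f n = f (n + 1)" by (simp add: shift_gmap_def)
lemma shift_gmap_gcomp: "shift_gmap (gcomp g f) = gcomp (shift_gmap g) (shift_gmap f)"
  by (simp add: shift_gmap_def gcomp_def)
lemma shift_gmap_gid [simp]: "shift_gmap gid = gid" by (simp add: shift_gmap_def gid_def)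

lemma all_int_shift: "(\<forall>n::int. P (n + 1)) \<longleftrightarrow> (\<forall>n. P n)" by (metis diff_add_cancel)

lemma bounded_shift: assumes C: "bounded_complex Q C" shows "bounded_complex Q (shift_cpx C)"
  unfolding bounded_complex_def
proof (intro conjI allI ballI)
  from C obtain b where b: "\<And>n. \<bar>n\<bar> > b \<Longrightarrow> mcar (cob C n) = {0}" unfolding bounded_complex_def by blast
  have "\<forall>n. \<bar>n\<bar> > b + 1 \<longrightarrow> mcar (cob (shift_cpx C) n) = {0}" using b by simp
  then show "\<exists>b. \<forall>n. \<bar>n\<bar> > b \<longrightarrow> mcar (cob (shift_cpx C) n) = {0}" by blast
  fix n
  show "fd_module Q (cob (shift_cpx C) n)" by (simp add: cpx_fd[OF C])
  show "module_hom Q (cob (shift_cpx C) n) (cob (shift_cpx C) (n + 1)) (cdf (shift_cpx C) n)"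
    using module_hom_minus[OF cpx_fd[OF C] cpx_d[OF C, of "n + 1"]] by (simp add: shift_cpx_def)
  fix x assume "x \<in> mcar (cob (shift_cpx C) n)"
  then show "cdf (shift_cpx C) (n + 1) (cdf (shift_cpx C) n x) = 0"
    using cpx_dd[OF C, of x "n + 1"] d_in[OF C, of x "n + 1"] d_minus[OF C, of _ "n + 1 + 1"] by simp
qed

lemma bounded_unshift: assumes C: "bounded_complex Q C" shows "bounded_complex Q (unshift_cpx C)"
  unfolding bounded_complex_def
proof (intro conjI allI ballI)
  from C obtain b where b: "\<And>n. \<bar>n\<bar> > b \<Longrightarrow> mcar (cob C n) = {0}" unfolding bounded_complex_def by blast
  have "\<forall>n. \<bar>n\<bar> > b + 1 \<longrightarrow> mcar (cob (unshift_cpx C) n) = {0}" using b by simp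
  then show "\<exists>b. \<forall>n. \<bar>n\<bar> > b \<longrightarrow> mcar (cob (unshift_cpx C) n) = {0}" by blast
  fix n
  show "fd_module Q (cob (unshift_cpx C) n)" by (simp add: cpx_fd[OF C])
  show "module_hom Q (cob (unshift_cpx C) n) (cob (unshift_cpx C) (n + 1)) (cdf (unshift_cpx C) n)"
    using module_hom_minus[OF cpx_fd[OF C] cpx_d'[OF C, of n]] by (simp add: unshift_cpx_def)
  fix x assume "x \<in> mcar (cob (unshift_cpx C) n)"
  then show "cdf (unshift_cpx C) (n + 1) (cdf (unshift_cpx C) n x) = 0"
    using cpx_dd'[OF C, of x n] d_in'[OF C, of x n] d_minus[OF C, of _ n] by simp
qed

lemma bounded_shift_iff [simp]: "bounded_complex Q (shift_cpx C) \<longleftrightarrow> bounded_complex Q C"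
  using bounded_shift[of Q C] bounded_unshift[of Q "shift_cpx C"] by auto

text \<open>
  The sign in the differential of the shift is harmless as homomorphisms commute with negation.
\<close>

lemma chain_map_shift_iff:
  assumes C: "bounded_complex Q C" and D: "bounded_complex Q D"
  shows "chain_map Q (shift_cpx C) (shift_cpx D) (shift_gmap f) \<longleftrightarrow> chain_map Q C D f"
proof -
  have eq: "f (n + 1 + 1) (- cdf C (n + 1) x) = - cdf D (n + 1) (f (n + 1) x) \<longleftrightarrow>
      f (n + 1 + 1) (cdf C (n + 1) x) = cdf D (n + 1) (f (n + 1) x)"
    if h: "\<forall>n. module_hom Q (cob C n) (cob D n) (f n)" and x: "x \<in> mcar (cob C (n + 1))" for n x
    using hom_minus[OF h[rule_format] cpx_fd[OF C] d_in[OF C x]] by simp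
  have "chain_map Q (shift_cpx C) (shift_cpx D) (shift_gmap f) \<longleftrightarrow>
    (\<forall>n. module_hom Q (cob C n) (cob D n) (f n)) \<and>
     (\<forall>n. \<forall>x\<in>mcar (cob C (n + 1)). f (n + 1 + 1) (- cdf C (n + 1) x) = - cdf D (n + 1) (f (n + 1) x))"
    unfolding chain_map_def shift_gmap_apply cob_shift cdf_shift
    by (simp only: all_int_shift[of "\<lambda>n. module_hom Q (cob C n) (cob D n) (f n)"])
  also have "\<dots> \<longleftrightarrow> (\<forall>n. module_hom Q (cob C n) (cob D n) (f n)) \<and>
     (\<forall>n. \<forall>x\<in>mcar (cob C (n + 1)). f (n + 1 + 1) (cdf C (n + 1) x) = cdf D (n + 1) (f (n + 1) x))"
    using eq by blast
  also have "\<dots> \<longleftrightarrow> chain_map Q C D f"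
    unfolding chain_map_def all_int_shift[of "\<lambda>n. \<forall>x\<in>mcar (cob C n). f (n + 1) (cdf C n x) = cdf D n (f n x)"] ..
  finally show ?thesis .
qed

lemma cocycles_shift: "cocycles (shift_cpx C) n = cocycles C (n + 1)"
  by (auto simp: cocycles_def)

lemma coboundaries_shift: assumes C: "bounded_complex Q C" shows "coboundaries (shift_cpx C) n = coboundaries C (n + 1)"
proof -
  have "x \<in> coboundaries (shift_cpx C) n \<longleftrightarrow> - x \<in> coboundaries C (n + 1)" for x
    by (auto simp: coboundaries_iff minus_equation_iff[of x])
  also have "- x \<in> coboundaries C (n + 1) \<longleftrightarrow> x \<in> coboundaries C (n + 1)" for x
    using coboundaries_minus[OF C, of x] coboundaries_minus[OF C, of "- x"] by auto
  finally show ?thesis by blast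
qed

lemma quasi_iso_shift_iff:
  assumes C: "bounded_complex Q C" and D: "bounded_complex Q D"
  shows "quasi_iso Q (shift_cpx C) (shift_cpx D) (shift_gmap f) \<longleftrightarrow> quasi_iso Q C D f"
  unfolding quasi_iso_def chain_map_shift_iff[OF C D] cocycles_shift coboundaries_shift[OF C] coboundaries_shift[OF D] shift_gmap_apply
  unfolding all_int_shift[of "\<lambda>n. \<forall>x\<in>cocycles C n. f n x \<in> coboundaries D n \<longrightarrow> x \<in> coboundaries C n"]
    all_int_shift[of "\<lambda>n. \<forall>y\<in>cocycles D n. \<exists>x\<in>cocycles C n. y - f n x \<in> coboundaries D n"] ..

lemma homotopic_shift:
  assumes C: "bounded_complex Q C" and D: "bounded_complex Q D" and h: "homotopic Q C D f g"
  shows "homotopic Q (shift_cpx C) (shift_cpx D) (shift_gmap f) (shift_gmap g)"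
proof -
  from h obtain h where h: "\<And>n. module_hom Q (cob C n) (cob D (n - 1)) (h n)"
    "\<And>n x. x \<in> mcar (cob C n) \<Longrightarrow> f n x - g n x = cdf D (n - 1) (h n x) + h (n + 1) (cdf C n x)"
    unfolding homotopic_def by blast
  show ?thesis
  proof (rule homotopicI[where h="\<lambda>n x. - h (n + 1) x"])
    fix n
    show "module_hom Q (cob (shift_cpx C) n) (cob (shift_cpx D) (n - 1)) (\<lambda>x. - h (n + 1) x)"
      using module_hom_minus[OF cpx_fd[OF D] h(1)[of "n + 1"]] by simp
    fix x assume "x \<in> mcar (cob (shift_cpx C) n)"
    then have x: "x \<in> mcar (cob C (n + 1))" by simp
    have hx: "h (n + 1) x \<in> mcar (cob D n)" using hom_in[OF h(1) x] by simp
    have "h (n + 1 + 1) (- cdf C (n + 1) x) = - h (n + 1 + 1) (cdf C (n + 1) x)"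
      by (rule hom_minus[OF h(1) cpx_fd[OF C] d_in[OF C x]])
    then show "shift_gmap f n x - shift_gmap g n x =
      cdf (shift_cpx D) (n - 1) (- h (n + 1) x) + - h (n + 1 + 1) (cdf (shift_cpx C) n x)"
      using h(2)[OF x] d_minus[OF D hx] by simp
  qed
qed

lemma homotopic_unshift:
  assumes C: "bounded_complex Q C" and D: "bounded_complex Q D"
    and h: "homotopic Q (shift_cpx C) (shift_cpx D) (shift_gmap f) (shift_gmap g)"
  shows "homotopic Q C D f g"
proof -
  from h obtain h where h: "\<And>n. module_hom Q (cob C (n + 1)) (cob D (n - 1 + 1)) (h n)"
    "\<And>n x. x \<in> mcar (cob C (n + 1)) \<Longrightarrow> f (n + 1) x - g (n + 1) x = - cdf D (n - 1 + 1) (h n x) + h (n + 1) (- cdf C (n + 1) x)"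
    unfolding homotopic_def cob_shift cdf_shift shift_gmap_apply by blast
  show ?thesis
  proof (rule homotopicI[where h="\<lambda>n x. - h (n - 1) x"])
    fix n
    have h1: "module_hom Q (cob C n) (cob D (n - 1)) (h (n - 1))" using h(1)[of "n - 1"] by simp
    show "module_hom Q (cob C n) (cob D (n - 1)) (\<lambda>x. - h (n - 1) x)"
      by (rule module_hom_minus[OF cpx_fd[OF D] h1])
    fix x assume x: "x \<in> mcar (cob C n)"
    have "h n (- cdf C n x) = - h n (cdf C n x)"
      by (rule hom_minus[OF h(1) cpx_fd[OF C] d_in[OF C x]])
    then show "f n x - g n x = cdf D (n - 1) (- h (n - 1) x) + - h (n + 1 - 1) (cdf C n x)"
      using h(2)[of x "n - 1"] x d_minus[OF D hom_in[OF h1 x]] by simp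
  qed
qed

subsection \<open>Cones\<close>

lemma cob_cone [simp]: "cob (cone C D f) n = sum_module (cob C (n + 1)) (cob D n)" by (simp add: cone_def)
lemma cdf_cone [simp]: "cdf (cone C D f) n z =
    join (- cdf C (n + 1) (evens z)) (f (n + 1) (evens z) + cdf D n (odds z))" by (simp add: cone_def)

lemma mcar_sum_zero:
  assumes "mcar M = {0}" "mcar N = {0}"
  shows "mcar (sum_module M N) = {0}"
proof (intro equalityI subsetI)
  fix z assume "z \<in> mcar (sum_module M N)"
  then have "evens z = 0" "odds z = 0" using assms by (simp_all add: mcar_sum)
  then show "z \<in> {0}" using evens_odds_eqI[of z 0] by simp
next
  fix z :: "nat \<Rightarrow> 'a" assume "z \<in> {0}"
  then show "z \<in> mcar (sum_module M N)" using assms by (simp add: mcar_sum)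
qed

lemma module_hom_evens: "module_hom Q (sum_module M N) M evens"
  and module_hom_odds: "module_hom Q (sum_module M N) N odds"
  by (simp_all add: module_hom_def mcar_sum mact_sum)

lemma module_hom_join:
  assumes "module_hom Q L M f" "module_hom Q L N g"
  shows "module_hom Q L (sum_module M N) (\<lambda>x. join (f x) (g x))"
  using assms by (simp add: module_hom_def mcar_sum mact_sum)

context
  fixes Q :: "('v, 'e) pre_digraph" and C D :: "('v, 'e, 'k::field) cpx" and f
  assumes fin: "finite (verts Q)" and C: "bounded_complex Q C" and D: "bounded_complex Q D" and f: "chain_map Q C D f"
begin

lemma bounded_cone: "bounded_complex Q (cone C D f)"
  unfolding bounded_complex_def
proof (intro conjI allI ballI)
  from C obtain b where b: "\<And>n. \<bar>n\<bar> > b \<Longrightarrow> mcar (cob C n) = {0}" unfolding bounded_complex_def by blast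
  from D obtain b' where b': "\<And>n. \<bar>n\<bar> > b' \<Longrightarrow> mcar (cob D n) = {0}" unfolding bounded_complex_def by blast
  have "mcar (cob (cone C D f) n) = {0}" if n: "\<bar>n\<bar> > max b b' + 1" for n
  proof -
    have "mcar (cob C (n + 1)) = {0}" "mcar (cob D n) = {0}" using n b b' by auto
    then show ?thesis unfolding cob_cone by (rule mcar_sum_zero)
  qed
  then show "\<exists>b. \<forall>n. \<bar>n\<bar> > b \<longrightarrow> mcar (cob (cone C D f) n) = {0}" by blast
  fix n
  show "fd_module Q (cob (cone C D f) n)" by (simp add: fd_module_sum[OF fin] cpx_fd[OF C] cpx_fd[OF D])
  have e: "module_hom Q (sum_module (cob C (n + 1)) (cob D n)) (cob C (n + 1)) evens"
    "module_hom Q (sum_module (cob C (n + 1)) (cob D n)) (cob D n) odds"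
    by (rule module_hom_evens module_hom_odds)+
  have "module_hom Q (sum_module (cob C (n + 1)) (cob D n)) (sum_module (cob C (n + 1 + 1)) (cob D (n + 1)))
      (\<lambda>z. join (- cdf C (n + 1) (evens z)) (f (n + 1) (evens z) + cdf D n (odds z)))"
    by (intro module_hom_join module_hom_minus[OF cpx_fd[OF C]] module_hom_add[OF cpx_fd[OF D]]
        module_hom_comp[OF e(1) cpx_d[OF C]] module_hom_comp[OF e(1) chain_hom[OF f]] module_hom_comp[OF e(2) cpx_d[OF D]])
  then show "module_hom Q (cob (cone C D f) n) (cob (cone C D f) (n + 1)) (cdf (cone C D f) n)"
    by (simp add: cone_def)
  fix z assume "z \<in> mcar (cob (cone C D f) n)"
  then have z: "evens z \<in> mcar (cob C (n + 1))" "odds z \<in> mcar (cob D n)" by (simp_all add: mcar_sum)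
  have "cdf C (n + 1 + 1) (- cdf C (n + 1) (evens z)) = 0"
    using d_minus[OF C d_in[OF C z(1)]] cpx_dd[OF C z(1)] by simp
  moreover have "f (n + 1 + 1) (- cdf C (n + 1) (evens z)) = - cdf D (n + 1) (f (n + 1) (evens z))"
    using chain_minus[OF f C d_in[OF C z(1)]] chain_d[OF f z(1)] by simp
  moreover have "cdf D (n + 1) (f (n + 1) (evens z) + cdf D n (odds z)) = cdf D (n + 1) (f (n + 1) (evens z))"
    using d_add[OF D chain_in[OF f z(1)] d_in[OF D z(2)]] cpx_dd[OF D z(2)] by simp
  ultimately show "cdf (cone C D f) (n + 1) (cdf (cone C D f) n z) = 0" by simp
qed

lemma chain_cone_in: "chain_map Q D (cone C D f) cone_in"
  unfolding chain_map_def cone_in_def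
proof (intro conjI allI ballI)
  fix n
  show "module_hom Q (cob D n) (cob (cone C D f) n) (join 0)"
    unfolding cob_cone by (rule module_hom_join[OF module_hom_zero[OF cpx_fd[OF C]] module_hom_id])
  fix x assume "x \<in> mcar (cob D n)"
  then show "join 0 (cdf D n x) = cdf (cone C D f) n (join 0 x)"
    by (simp add: d_zero[OF C] chain_0[OF f C])
qed

lemma chain_cone_out: "chain_map Q (cone C D f) (shift_cpx C) cone_out"
  by (simp add: chain_map_def cone_out_def module_hom_evens)

lemma cone_cocycle:
  "z \<in> cocycles (cone C D f) n \<longleftrightarrow> evens z \<in> cocycles C (n + 1) \<and> odds z \<in> mcar (cob D n) \<and>
     f (n + 1) (evens z) + cdf D n (odds z) = 0"
  by (auto simp: cocycles_iff mcar_sum)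

lemma cone_coboundaryI:
  assumes "a \<in> mcar (cob C n)" "b \<in> mcar (cob D (n - 1))" "- cdf C n a = evens z" "f n a + cdf D (n - 1) b = odds z"
  shows "z \<in> coboundaries (cone C D f) n"
  unfolding coboundaries_iff
  by (rule bexI[of _ "join a b"]) (use assms in \<open>simp_all add: mcar_sum\<close>)

lemma cone_coboundaryE:
  assumes "z \<in> coboundaries (cone C D f) n"
  obtains a b where "a \<in> mcar (cob C n)" "b \<in> mcar (cob D (n - 1))" "evens z = - cdf C n a" "odds z = f n a + cdf D (n - 1) b"
  using assms unfolding coboundaries_iff by (auto simp: mcar_sum)

text \<open>
  For a cocycle \<open>(x, y)\<close> of the cone, injectivity on cohomology writes \<open>x\<close> as a coboundary, and surjectivity corrects
  the choice made there by a cocycle such that \<open>y\<close> is hit as well.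
\<close>

lemma acyclic_cone: assumes q: "quasi_iso Q C D f" shows "acyclic_cpx (cone C D f)"
  unfolding acyclic_cpx_def
proof (intro allI subsetI)
  fix n z assume "z \<in> cocycles (cone C D f) n"
  then have x: "evens z \<in> cocycles C (n + 1)" and y: "odds z \<in> mcar (cob D n)" and e: "f (n + 1) (evens z) + cdf D n (odds z) = 0"
    by (simp_all add: cone_cocycle)
  from e have "f (n + 1) (evens z) = cdf D n (- odds z)" unfolding d_minus[OF D y] eq_neg_iff_add_eq_0 .
  then have "f (n + 1) (evens z) \<in> coboundaries D (n + 1)" using y cpx_minus[OF D y] by (auto simp: coboundaries_iff)
  from qi_inj[OF q x this] obtain a where a: "a \<in> mcar (cob C n)" "evens z = cdf C n a" by (auto simp: coboundaries_iff)
  have fa: "f n a \<in> mcar (cob D n)" using chain_in[OF f a(1)] .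
  have "f n a + odds z \<in> cocycles D n"
    using a y e fa chain_d[OF f a(1)] by (simp add: cocycles_iff cpx_add[OF D] d_add[OF D])
  from qi_surj[OF q this] obtain c b where c: "c \<in> cocycles C n" and b: "b \<in> mcar (cob D (n - 1))"
      "f n a + odds z - f n c = cdf D (n - 1) b" by (auto simp: coboundaries_iff)
  have c': "c \<in> mcar (cob C n)" "cdf C n c = 0" using c by (simp_all add: cocycles_iff)
  show "z \<in> coboundaries (cone C D f) n"
  proof (rule cone_coboundaryI)
    show "c - a \<in> mcar (cob C n)" "b \<in> mcar (cob D (n - 1))" using a b c' cpx_diff[OF C] by auto
    show "- cdf C n (c - a) = evens z" using d_diff[OF C c'(1) a(1)] c' a by simp
    show "f n (c - a) + cdf D (n - 1) b = odds z" using chain_diff[OF f C c'(1) a(1)] by (simp flip: b(2))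
  qed
qed

lemma quasi_iso_cone_out: assumes D0: "acyclic_cpx D" shows "quasi_iso Q (cone C D f) (shift_cpx C) cone_out"
  unfolding quasi_iso_def
proof (intro conjI allI ballI impI chain_cone_out)
  fix n z assume "z \<in> cocycles (cone C D f) n" and "cone_out n z \<in> coboundaries (shift_cpx C) n"
  then have x: "evens z \<in> cocycles C (n + 1)" and y: "odds z \<in> mcar (cob D n)" and e: "f (n + 1) (evens z) + cdf D n (odds z) = 0"
    and "evens z \<in> coboundaries (shift_cpx C) n"
    by (simp_all add: cone_cocycle cone_out_def)
  then obtain a where a: "a \<in> mcar (cob C n)" "evens z = - cdf C n a" by (auto simp: coboundaries_iff)
  have fa: "f n a \<in> mcar (cob D n)" using chain_in[OF f a(1)] .
  have "f (n + 1) (- cdf C n a) = - cdf D n (f n a)"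
    using chain_minus[OF f C d_in[OF C a(1)]] chain_d[OF f a(1)] by simp
  with e a have "odds z - f n a \<in> cocycles D n"
    using y fa by (simp add: cocycles_iff cpx_diff[OF D] d_diff[OF D])
  from acyclicD[OF D0 this] obtain b where b: "b \<in> mcar (cob D (n - 1))" "odds z - f n a = cdf D (n - 1) b"
    by (auto simp: coboundaries_iff)
  show "z \<in> coboundaries (cone C D f) n"
    by (rule cone_coboundaryI[of a _ b]) (use a b in \<open>simp_all flip: b(2)\<close>)
next
  fix n x assume "x \<in> cocycles (shift_cpx C) n"
  then have x: "x \<in> cocycles C (n + 1)" by (simp add: cocycles_shift)
  have fx: "f (n + 1) x \<in> cocycles D (n + 1)" by (rule chain_cocycle[OF f C x])
  from acyclicD[OF D0 this] obtain b where b: "b \<in> mcar (cob D n)" "f (n + 1) x = cdf D n b"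
    by (auto simp: coboundaries_iff)
  have "join x (- b) \<in> cocycles (cone C D f) n"
    using x b cpx_minus[OF D b(1)] d_minus[OF D b(1)] by (simp add: cone_cocycle)
  then show "\<exists>z\<in>cocycles (cone C D f) n. x - cone_out n z \<in> coboundaries (shift_cpx C) n"
    by (rule bexI[rotated]) (simp add: cone_out_def coboundaries_zero[OF bounded_shift[OF C]])
qed

lemma quasi_iso_cone_in: assumes C0: "acyclic_cpx C" shows "quasi_iso Q D (cone C D f) cone_in"
  unfolding quasi_iso_def
proof (intro conjI allI ballI impI chain_cone_in)
  fix n y assume y: "y \<in> cocycles D n" and "cone_in n y \<in> coboundaries (cone C D f) n"
  then obtain a b where a: "a \<in> mcar (cob C n)" and b: "b \<in> mcar (cob D (n - 1))" and "- cdf C n a = 0" "y = f n a + cdf D (n - 1) b"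
    by (auto elim!: cone_coboundaryE simp: cone_in_def)
  moreover from this have "a \<in> cocycles C n" by (simp add: cocycles_iff)
  then have "f n a \<in> coboundaries D n" by (rule chain_coboundary[OF f acyclicD[OF C0]])
  moreover have "cdf D (n - 1) b \<in> coboundaries D n" using b by (rule coboundaryI)
  ultimately show "y \<in> coboundaries D n" using coboundaries_add[OF D] by simp
next
  fix n z assume "z \<in> cocycles (cone C D f) n"
  then have x: "evens z \<in> cocycles C (n + 1)" and y: "odds z \<in> mcar (cob D n)" and e: "f (n + 1) (evens z) + cdf D n (odds z) = 0"
    by (simp_all add: cone_cocycle)
  from acyclicD[OF C0 x] obtain a0 where a0: "a0 \<in> mcar (cob C n)" "evens z = cdf C n a0" by (auto simp: coboundaries_iff)
  define a where "a = - a0"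
  have a: "a \<in> mcar (cob C n)" "- cdf C n a = evens z" using a0 cpx_minus[OF C a0(1)] d_minus[OF C a0(1)] by (simp_all add: a_def)
  have fa: "f n a \<in> mcar (cob D n)" using chain_in[OF f a(1)] .
  have "f (n + 1) (evens z) = - cdf D n (f n a)"
    unfolding a(2)[symmetric] using chain_minus[OF f C d_in[OF C a(1)]] chain_d[OF f a(1)] by simp
  with e have "odds z - f n a \<in> cocycles D n"
    using y fa by (simp add: cocycles_iff cpx_diff[OF D] d_diff[OF D])
  moreover have "z - cone_in n (odds z - f n a) \<in> coboundaries (cone C D f) n"
    by (rule cone_coboundaryI[of a _ 0]) (use a in \<open>simp_all add: cone_in_def cpx_zero[OF D] d_zero[OF D]\<close>)
  ultimately show "\<exists>y\<in>cocycles D n. z - cone_in n y \<in> coboundaries (cone C D f) n" by blast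
qed

text \<open>
  A null-homotopy of \<open>V \<rightarrow> D \<rightarrow> cone f\<close> has two components.  That in \<open>C\<close> is the lift, that in \<open>D\<close> is the homotopy
  between the given map and the composite of the lift with \<open>f\<close>.
\<close>

lemma lift_to_source:
  assumes g: "chain_map Q V D g" and h: "homotopic Q V (cone C D f) (gcomp cone_in g) 0"
  shows "\<exists>g'. chain_map Q V C g' \<and> homotopic Q V D g (gcomp f g')"
proof -
  from h obtain h where h: "\<And>n. module_hom Q (cob V n) (sum_module (cob C n) (cob D (n - 1))) (h n)"
    "\<And>n x. x \<in> mcar (cob V n) \<Longrightarrow> join 0 (g n x) = cdf (cone C D f) (n - 1) (h n x) + h (n + 1) (cdf V n x)"
    unfolding homotopic_def by (auto simp: gcomp_def cone_in_def)
  have e: "cdf C n (evens (h n x)) = evens (h (n + 1) (cdf V n x))"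
    "g n x - f n (evens (h n x)) = cdf D (n - 1) (odds (h n x)) + odds (h (n + 1) (cdf V n x))" if x: "x \<in> mcar (cob V n)" for n x
    using arg_cong[OF h(2)[OF x], of evens] arg_cong[OF h(2)[OF x], of odds] by (simp_all add: algebra_simps)
  have h1: "module_hom Q (cob V n) (cob C n) (\<lambda>x. evens (h n x))" "module_hom Q (cob V n) (cob D (n - 1)) (\<lambda>x. odds (h n x))" for n
    using module_hom_comp[OF h(1) module_hom_evens] module_hom_comp[OF h(1) module_hom_odds] by auto
  have "chain_map Q V C (\<lambda>n x. evens (h n x))" unfolding chain_map_def using h1 e(1) by simp
  moreover have "homotopic Q V D g (gcomp f (\<lambda>n x. evens (h n x)))"
    by (rule homotopicI[where h="\<lambda>n x. odds (h n x)"]) (simp_all add: h1 e(2) gcomp_def)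
  ultimately show ?thesis by blast
qed

text \<open>
  A homotopy between \<open>f g\<close> and \<open>f g'\<close>, with its sign changed, completes \<open>g - g'\<close> to a chain map to the cone.
\<close>

lemma lift_to_cone:
  assumes V: "bounded_complex Q V" and g: "chain_map Q V C g" and g': "chain_map Q V C g'"
    and h: "homotopic Q V D (gcomp f g) (gcomp f g')"
  shows "\<exists>k. chain_map Q (shift_cpx V) (cone C D f) k \<and> gcomp cone_out k = shift_gmap (g - g')"
proof -
  from h obtain h where h: "\<And>n. module_hom Q (cob V n) (cob D (n - 1)) (h n)"
    "\<And>n x. x \<in> mcar (cob V n) \<Longrightarrow> f n (g n x) - f n (g' n x) = cdf D (n - 1) (h n x) + h (n + 1) (cdf V n x)"
    unfolding homotopic_def gcomp_def by blast
  have gg: "chain_map Q V C (g - g')" by (rule chain_map_diff[OF C g g'])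
  define k where "k = (\<lambda>n x. join ((g - g') (n + 1) x) (- h (n + 1) x))"
  have "chain_map Q (shift_cpx V) (cone C D f) k"
    unfolding chain_map_def
  proof (intro conjI allI ballI)
    fix n
    have "module_hom Q (cob V (n + 1)) (cob D n) (h (n + 1))" using h(1)[of "n + 1"] by simp
    then show "module_hom Q (cob (shift_cpx V) n) (cob (cone C D f) n) (k n)"
      unfolding k_def cob_shift cob_cone
      by (rule module_hom_join[OF chain_hom[OF gg] module_hom_minus[OF cpx_fd[OF D]]])
    fix x assume "x \<in> mcar (cob (shift_cpx V) n)"
    then have x: "x \<in> mcar (cob V (n + 1))" by simp
    have 1: "(g - g') (n + 1 + 1) (- cdf V (n + 1) x) = - cdf C (n + 1) ((g - g') (n + 1) x)"
      unfolding chain_minus[OF gg V d_in[OF V x]] chain_d[OF gg x] ..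
    have 2: "h (n + 1 + 1) (- cdf V (n + 1) x) = - h (n + 1 + 1) (cdf V (n + 1) x)"
      by (rule hom_minus[OF h(1) cpx_fd[OF V] d_in[OF V x]])
    have hx: "h (n + 1) x \<in> mcar (cob D n)" using hom_in[OF h(1)[of "n + 1"] x] by simp
    have "f (n + 1) ((g - g') (n + 1) x) = f (n + 1) (g (n + 1) x) - f (n + 1) (g' (n + 1) x)"
      using chain_diff[OF f C chain_in[OF g x] chain_in[OF g' x]] by simp
    also have "\<dots> = cdf D n (h (n + 1) x) + h (n + 1 + 1) (cdf V (n + 1) x)" using h(2)[OF x] by simp
    finally have 3: "f (n + 1) ((g - g') (n + 1) x) + - cdf D n (h (n + 1) x) = h (n + 1 + 1) (cdf V (n + 1) x)" by simp
    show "k (n + 1) (cdf (shift_cpx V) n x) = cdf (cone C D f) n (k n x)"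
      unfolding k_def cdf_shift cdf_cone evens_join odds_join 1 2 d_minus[OF D hx] 3 by simp
  qed
  moreover have "gcomp cone_out k = shift_gmap (g - g')"
    by (intro ext) (simp add: gcomp_def cone_out_def k_def)
  ultimately show ?thesis by blast
qed

text \<open>
  The null-homotopy of \<open>g f\<close> is the component of the extension on \<open>C\<close>.
\<close>

lemma extend_to_cone:
  assumes g: "chain_map Q D B g" and B: "bounded_complex Q B" and h: "homotopic Q C B (gcomp g f) 0"
  shows "\<exists>k. chain_map Q (cone C D f) B k \<and> gcomp k cone_in = g"
proof -
  from h obtain h where h: "\<And>n. module_hom Q (cob C n) (cob B (n - 1)) (h n)"
    "\<And>n x. x \<in> mcar (cob C n) \<Longrightarrow> g n (f n x) = cdf B (n - 1) (h n x) + h (n + 1) (cdf C n x)"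
    unfolding homotopic_def gcomp_def by auto
  define k where "k = (\<lambda>n z. g n (odds z) + h (n + 1) (evens z))"
  have "chain_map Q (cone C D f) B k"
    unfolding chain_map_def
  proof (intro conjI allI ballI)
    fix n
    have "module_hom Q (cob C (n + 1)) (cob B n) (h (n + 1))" using h(1)[of "n + 1"] by simp
    then show "module_hom Q (cob (cone C D f) n) (cob B n) (k n)"
      unfolding k_def cob_cone
      by (intro module_hom_add[OF cpx_fd[OF B]] module_hom_comp[OF module_hom_odds chain_hom[OF g]]
          module_hom_comp[OF module_hom_evens])
    fix z assume "z \<in> mcar (cob (cone C D f) n)"
    then have z: "evens z \<in> mcar (cob C (n + 1))" "odds z \<in> mcar (cob D n)" by (simp_all add: mcar_sum)
    have 1: "g (n + 1) (f (n + 1) (evens z) + cdf D n (odds z)) = g (n + 1) (f (n + 1) (evens z)) + cdf B n (g n (odds z))"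
      using chain_add[OF g chain_in[OF f z(1)] d_in[OF D z(2)]] chain_d[OF g z(2)] by simp
    have 2: "h (n + 1 + 1) (- cdf C (n + 1) (evens z)) = - h (n + 1 + 1) (cdf C (n + 1) (evens z))"
      by (rule hom_minus[OF h(1) cpx_fd[OF C] d_in[OF C z(1)]])
    have hz: "h (n + 1) (evens z) \<in> mcar (cob B n)" using hom_in[OF h(1)[of "n + 1"] z(1)] by simp
    show "k (n + 1) (cdf (cone C D f) n z) = cdf B n (k n z)"
      unfolding k_def cdf_cone evens_join odds_join 1 2 d_add[OF B chain_in[OF g z(2)] hz]
      using h(2)[OF z(1)] by simp
  qed
  moreover have "gcomp k cone_in = g"
    by (intro ext) (simp add: gcomp_def cone_in_def k_def hom_0[OF h(1) cpx_fd[OF C]])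
  ultimately show ?thesis by blast
qed

end

text \<open>
  The five lemma for a square that commutes up to homotopy, by a diagram chase: the homotopy enters the map of cones, and
  has to be carried along in every step.
\<close>

lemma cone_quasi_iso:
  assumes fin: "finite (verts Q)" and C: "bounded_complex Q C" and D: "bounded_complex Q D" and u: "chain_map Q C D u"
    and A: "bounded_complex Q A" and B: "bounded_complex Q B" and q: "chain_map Q A B q"
    and p: "quasi_iso Q A C p" and s: "quasi_iso Q B D s" and h: "homotopic Q A D (gcomp u p) (gcomp s q)"
  shows "\<exists>S. quasi_iso Q (cone A B q) (cone C D u) S \<and> gcomp S cone_in = gcomp cone_in s"
proof -
  from h obtain h where h: "\<And>n. module_hom Q (cob A n) (cob D (n - 1)) (h n)"
    "\<And>n x. x \<in> mcar (cob A n) \<Longrightarrow> u n (p n x) - s n (q n x) = cdf D (n - 1) (h n x) + h (n + 1) (cdf A n x)"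
    unfolding homotopic_def gcomp_def by blast
  note cp = qi_chain[OF p] and cs = qi_chain[OF s]
  have h1: "module_hom Q (cob A (n + 1)) (cob D n) (h (n + 1))" for n using h(1)[of "n + 1"] by simp
  have h2: "u (n + 1) (p (n + 1) x) - s (n + 1) (q (n + 1) x) = cdf D n (h (n + 1) x) + h (n + 1 + 1) (cdf A (n + 1) x)"
    if "x \<in> mcar (cob A (n + 1))" for n x using h(2)[OF that] by simp
  define S where "S = (\<lambda>n z. join (p (n + 1) (evens z)) (s n (odds z) - h (n + 1) (evens z)))"
  have chS: "chain_map Q (cone A B q) (cone C D u) S"
    unfolding chain_map_def
  proof (intro conjI allI ballI)
    fix n
    show "module_hom Q (cob (cone A B q) n) (cob (cone C D u) n) (S n)"
      unfolding S_def cob_cone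
      by (intro module_hom_join module_hom_diff[OF cpx_fd[OF D]] module_hom_comp[OF module_hom_odds chain_hom[OF cs]]
          module_hom_comp[OF module_hom_evens h1] module_hom_comp[OF module_hom_evens chain_hom[OF cp]])
    fix z assume "z \<in> mcar (cob (cone A B q) n)"
    then have a: "evens z \<in> mcar (cob A (n + 1))" and b: "odds z \<in> mcar (cob B n)" by (simp_all add: mcar_sum)
    have 1: "p (n + 1 + 1) (- cdf A (n + 1) (evens z)) = - cdf C (n + 1) (p (n + 1) (evens z))"
      using chain_minus[OF cp A d_in[OF A a]] chain_d[OF cp a] by simp
    have 2: "h (n + 1 + 1) (- cdf A (n + 1) (evens z)) = - h (n + 1 + 1) (cdf A (n + 1) (evens z))"
      by (rule hom_minus[OF h(1) cpx_fd[OF A] d_in[OF A a]])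
    have 3: "s (n + 1) (q (n + 1) (evens z) + cdf B n (odds z)) = s (n + 1) (q (n + 1) (evens z)) + cdf D n (s n (odds z))"
      using chain_add[OF cs chain_in[OF q a] d_in[OF B b]] chain_d[OF cs b] by simp
    have 4: "cdf D n (s n (odds z) - h (n + 1) (evens z)) = cdf D n (s n (odds z)) - cdf D n (h (n + 1) (evens z))"
      by (rule d_diff[OF D chain_in[OF cs b] hom_in[OF h1 a]])
    show "S (n + 1) (cdf (cone A B q) n z) = cdf (cone C D u) n (S n z)"
      unfolding S_def cdf_cone evens_join odds_join 1 2 3 4 join_eq_iff
      using h2[OF a] by (simp add: algebra_simps)
  qed
  have "z \<in> coboundaries (cone A B q) n" if z: "z \<in> cocycles (cone A B q) n" and Sz: "S n z \<in> coboundaries (cone C D u) n" for n z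
  proof -
    from z have a: "evens z \<in> cocycles A (n + 1)" and b: "odds z \<in> mcar (cob B n)" and e: "q (n + 1) (evens z) + cdf B n (odds z) = 0"
      by (simp_all add: cone_cocycle[OF fin A B q])
    from Sz obtain \<alpha> \<beta> where \<alpha>: "\<alpha> \<in> mcar (cob C n)" "p (n + 1) (evens z) = - cdf C n \<alpha>" and
      \<beta>: "\<beta> \<in> mcar (cob D (n - 1))" "s n (odds z) - h (n + 1) (evens z) = u n \<alpha> + cdf D (n - 1) \<beta>"
      by (rule cone_coboundaryE[OF fin C D u]) (simp add: S_def)
    have "p (n + 1) (evens z) \<in> coboundaries C (n + 1)"
      unfolding \<alpha>(2) by (rule coboundaries_minus[OF C]) (use \<alpha>(1) in \<open>auto simp: coboundaries_iff\<close>)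
    from qi_inj[OF p a this] obtain a0 where a0: "a0 \<in> mcar (cob A n)" "evens z = cdf A n a0" by (auto simp: coboundaries_iff)
    have pa0: "p n a0 \<in> mcar (cob C n)" using chain_in[OF cp a0(1)] .
    have "cdf C n (p n a0) = - cdf C n \<alpha>" unfolding chain_d[OF cp a0(1), symmetric] a0(2)[symmetric] by (rule \<alpha>(2))
    then have "p n a0 + \<alpha> \<in> cocycles C n"
      using pa0 \<alpha>(1) by (simp add: cocycles_iff cpx_add[OF C] d_add[OF C])
    from qi_surj[OF p this] obtain c \<epsilon> where c: "c \<in> mcar (cob A n)" "cdf A n c = 0" and \<epsilon>: "\<epsilon> \<in> mcar (cob C (n - 1))"
        "p n a0 + \<alpha> - p n c = cdf C (n - 1) \<epsilon>" by (auto simp: coboundaries_iff cocycles_iff)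
    \<comment> \<open>\<open>a1\<close> has boundary \<open>- evens z\<close>, and \<open>p a1\<close> differs from \<open>\<alpha>\<close> by a coboundary only\<close>
    define a1 where "a1 = c - a0"
    have a1: "a1 \<in> mcar (cob A n)" "cdf A n a1 = - evens z"
      using a0 c cpx_diff[OF A c(1) a0(1)] d_diff[OF A c(1) a0(1)] by (simp_all add: a1_def)
    have qa1: "q n a1 \<in> mcar (cob B n)" using chain_in[OF q a1(1)] .
    have "q (n + 1) (- evens z) = - q (n + 1) (evens z)"
      using a by (intro chain_minus[OF q A]) (simp add: cocycles_iff)
    then have "cdf B n (q n a1) = - q (n + 1) (evens z)" unfolding chain_d[OF q a1(1), symmetric] a1(2) .
    also have "\<dots> = cdf B n (odds z)" using e by (simp only: neg_eq_iff_add_eq_0)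
    finally have cyc: "odds z - q n a1 \<in> cocycles B n"
      using b qa1 by (simp add: cocycles_iff cpx_diff[OF B] d_diff[OF B])
    have 1: "s n (odds z - q n a1) = s n (odds z) - s n (q n a1)" by (rule chain_diff[OF cs B b qa1])
    have 2: "h (n + 1) (cdf A n a1) = - h (n + 1) (evens z)"
      unfolding a1(2) using a by (intro hom_minus[OF h(1) cpx_fd[OF A]]) (simp add: cocycles_iff)
    have 3: "p n a1 = \<alpha> - cdf C (n - 1) \<epsilon>"
      unfolding a1_def chain_diff[OF cp A c(1) a0(1)] by (simp add: algebra_simps flip: \<epsilon>(2))
    have 4: "u n (\<alpha> - cdf C (n - 1) \<epsilon>) = u n \<alpha> - cdf D (n - 1) (u (n - 1) \<epsilon>)"
      using chain_diff[OF u C \<alpha>(1) d_in'[OF C \<epsilon>(1)]] chain_d'[OF u \<epsilon>(1)] by simp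
    have 5: "s n (q n a1) = u n \<alpha> - cdf D (n - 1) (u (n - 1) \<epsilon>) - cdf D (n - 1) (h n a1) + h (n + 1) (evens z)"
      using h(2)[OF a1(1)] unfolding 2 3 4 by (simp add: algebra_simps)
    have "s n (odds z - q n a1) = cdf D (n - 1) \<beta> + cdf D (n - 1) (u (n - 1) \<epsilon>) + cdf D (n - 1) (h n a1)"
      unfolding 1 5 using \<beta>(2) by (simp add: algebra_simps)
    also have "\<dots> \<in> coboundaries D n"
      by (intro coboundaries_add[OF D] coboundaryI \<beta>(1) chain_in[OF u \<epsilon>(1)] hom_in[OF h(1) a1(1)])
    finally obtain b1 where b1: "b1 \<in> mcar (cob B (n - 1))" "odds z - q n a1 = cdf B (n - 1) b1"
      using qi_inj[OF s cyc] by (auto simp: coboundaries_iff)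
    show ?thesis
      by (rule cone_coboundaryI[OF fin A B q, of a1 _ b1]) (use a1 b1 in \<open>simp_all flip: b1(2)\<close>)
  qed
  moreover have "\<exists>w\<in>cocycles (cone A B q) n. z - S n w \<in> coboundaries (cone C D u) n" if z: "z \<in> cocycles (cone C D u) n" for n z
  proof -
    from z have x: "evens z \<in> cocycles C (n + 1)" and y: "odds z \<in> mcar (cob D n)" and e: "u (n + 1) (evens z) + cdf D n (odds z) = 0"
      by (simp_all add: cone_cocycle[OF fin C D u])
    from qi_surj[OF p x] obtain a \<epsilon> where a: "a \<in> cocycles A (n + 1)" and \<epsilon>: "\<epsilon> \<in> mcar (cob C n)" "evens z - p (n + 1) a = cdf C n \<epsilon>"
      by (auto simp: coboundaries_iff)
    have a': "a \<in> mcar (cob A (n + 1))" "cdf A (n + 1) a = 0" using a by (simp_all add: cocycles_iff)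
    have u\<epsilon>: "u n \<epsilon> \<in> mcar (cob D n)" and ha: "h (n + 1) a \<in> mcar (cob D n)"
      using chain_in[OF u \<epsilon>(1)] hom_in[OF h1 a'(1)] by auto
    have h0: "h (n + 1 + 1) 0 = 0" by (rule hom_0[OF h(1) cpx_fd[OF A]])
    have "u (n + 1) (p (n + 1) a) = u (n + 1) (evens z - cdf C n \<epsilon>)" by (simp flip: \<epsilon>(2))
    also have "\<dots> = - cdf D n (odds z) - cdf D n (u n \<epsilon>)"
      using x e chain_diff[OF u C _ d_in[OF C \<epsilon>(1)], of "evens z"] chain_d[OF u \<epsilon>(1)]
      by (simp add: cocycles_iff eq_neg_iff_add_eq_0)
    finally have upa: "u (n + 1) (p (n + 1) a) = - cdf D n (odds z) - cdf D n (u n \<epsilon>)" .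
    have sqa: "s (n + 1) (q (n + 1) a) = - cdf D n (odds z) - cdf D n (u n \<epsilon>) - cdf D n (h (n + 1) a)"
      using h2[OF a'(1)] unfolding a'(2) h0 upa by (simp add: algebra_simps)
    also have "\<dots> = cdf D n (- odds z - u n \<epsilon> - h (n + 1) a)"
      using y u\<epsilon> ha cpx_minus[OF D y] cpx_diff[OF D _ u\<epsilon>, of "- odds z"] by (simp add: d_diff[OF D] d_minus[OF D])
    also have "\<dots> \<in> coboundaries D (n + 1)"
      using y u\<epsilon> ha by (auto simp: coboundaries_iff intro!: bexI[of _ "- odds z - u n \<epsilon> - h (n + 1) a"] cpx_diff[OF D] cpx_minus[OF D])
    finally obtain b0 where b0: "b0 \<in> mcar (cob B n)" "q (n + 1) a = cdf B n b0"
      using qi_inj[OF s chain_cocycle[OF q A a]] by (auto simp: coboundaries_iff)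
    have sb0: "s n b0 \<in> mcar (cob D n)" using chain_in[OF cs b0(1)] .
    have dsb0: "cdf D n (s n b0) = - cdf D n (odds z) - cdf D n (u n \<epsilon>) - cdf D n (h (n + 1) a)"
      using chain_d[OF cs b0(1)] sqa b0(2) by simp
    have in3: "odds z + s n b0 \<in> mcar (cob D n)" "odds z + s n b0 + h (n + 1) a \<in> mcar (cob D n)"
      "odds z + s n b0 + h (n + 1) a + u n \<epsilon> \<in> mcar (cob D n)"
      using y sb0 ha u\<epsilon> by (auto intro: cpx_add[OF D])
    have "odds z + s n b0 + h (n + 1) a + u n \<epsilon> \<in> cocycles D n"
      using in3 y sb0 ha u\<epsilon> dsb0 by (simp add: cocycles_iff d_add[OF D])
    from qi_surj[OF s this] obtain c \<eta> where c: "c \<in> mcar (cob B n)" "cdf B n c = 0" and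
      \<eta>: "\<eta> \<in> mcar (cob D (n - 1))" "odds z + s n b0 + h (n + 1) a + u n \<epsilon> - s n c = cdf D (n - 1) \<eta>"
      by (auto simp: coboundaries_iff cocycles_iff)
    \<comment> \<open>\<open>b0\<close> makes \<open>(a, - b0)\<close> a cocycle; \<open>c\<close> corrects its image in the second component\<close>
    define b where "b = c - b0"
    have b: "b \<in> mcar (cob B n)" "cdf B n b = - q (n + 1) a" "s n b = s n c - s n b0"
      using b0 c cpx_diff[OF B c(1) b0(1)] d_diff[OF B c(1) b0(1)] chain_diff[OF cs B c(1) b0(1)] by (simp_all add: b_def)
    have "join a b \<in> cocycles (cone A B q) n" using a b by (simp add: cone_cocycle[OF fin A B q])
    moreover have "z - S n (join a b) \<in> coboundaries (cone C D u) n"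
    proof (rule cone_coboundaryI[OF fin C D u])
      show "- \<epsilon> \<in> mcar (cob C n)" by (rule cpx_minus[OF C \<epsilon>(1)])
      show "\<eta> \<in> mcar (cob D (n - 1))" by (rule \<eta>(1))
      show "- cdf C n (- \<epsilon>) = evens (z - S n (join a b))"
        using d_minus[OF C \<epsilon>(1)] \<epsilon>(2) by (simp add: S_def)
      show "u n (- \<epsilon>) + cdf D (n - 1) \<eta> = odds (z - S n (join a b))"
        unfolding chain_minus[OF u C \<epsilon>(1)] \<eta>(2)[symmetric] using b(3) by (simp add: S_def algebra_simps)
    qed
    ultimately show ?thesis by blast
  qed
  ultimately have "quasi_iso Q (cone A B q) (cone C D u) S" unfolding quasi_iso_def using chS by blast
  moreover have "gcomp S cone_in = gcomp cone_in s"
    by (intro ext) (simp add: gcomp_def S_def cone_in_def chain_0[OF cp A] hom_0[OF h(1) cpx_fd[OF A]])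
  ultimately show ?thesis by blast
qed

subsection \<open>The calculus of fractions for quasi-isomorphisms\<close>

text \<open>
  The homotopy fibre product of \<open>f\<close> and \<open>t\<close>: the cone of the composite \<open>W \<rightarrow> Y \<rightarrow> cone t\<close>, shifted back.  Its projection to
  \<open>W\<close> is a quasi-isomorphism because \<open>cone t\<close> is acyclic, and the component in \<open>Y\<close> is the homotopy.
\<close>

lemma ore_complexes:
  assumes fin: "finite (verts Q)" and f: "chain_map Q W Y f" and t: "quasi_iso Q W' Y t"
    and W: "bounded_complex Q W" and W': "bounded_complex Q W'" and Y: "bounded_complex Q Y"
  shows "\<exists>V w h. bounded_complex Q V \<and> quasi_iso Q V W w \<and> chain_map Q V W' h \<and> homotopic Q V Y (gcomp f w) (gcomp t h)"
proof -
  note ct = qi_chain[OF t]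
  define N where "N = cone W' Y t"
  define g where "g = gcomp cone_in f"
  have N: "bounded_complex Q N" unfolding N_def by (rule bounded_cone[OF fin W' Y ct])
  have g: "chain_map Q W N g" unfolding g_def N_def by (rule chain_map_comp[OF f chain_cone_in[OF fin W' Y ct]])
  \<comment> \<open>degree \<open>n\<close> of \<open>V\<close> is \<open>W\<^sup>n \<oplus> W'\<^sup>n \<oplus> Y\<^sup>n\<^sup>-\<^sup>1\<close>, the last component being minus a homotopy\<close>
  define E where "E = cone W N g"
  have E: "bounded_complex Q E" unfolding E_def by (rule bounded_cone[OF fin W N g])
  define V where "V = unshift_cpx E"
  have V: "bounded_complex Q V" unfolding V_def by (rule bounded_unshift[OF E])
  have "acyclic_cpx N" unfolding N_def by (rule acyclic_cone[OF fin W' Y ct t])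
  from quasi_iso_cone_out[OF fin W N g this]
  have "quasi_iso Q (shift_cpx V) (shift_cpx W) (shift_gmap cone_out)"
    by (simp add: V_def E_def cone_out_def shift_gmap_def)
  then have w: "quasi_iso Q V W cone_out" by (simp add: quasi_iso_shift_iff[OF V W])
  have cobV: "cob V n = sum_module (cob W n) (sum_module (cob W' n) (cob Y (n - 1)))" for n
    by (simp add: V_def E_def N_def)
  have cdfV: "cdf V n z = join (cdf W n (evens z))
      (join (cdf W' n (evens (odds z))) (- (f n (evens z) + t n (evens (odds z)) + cdf Y (n - 1) (odds (odds z)))))" for n z
    by (simp add: V_def E_def N_def g_def gcomp_def cone_in_def algebra_simps)
  \<comment> \<open>the sign is forced: the two maps to \<open>Y\<close> enter the differential of \<open>V\<close> as a sum\<close>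
  define h where "h = (\<lambda>(n::int) z. - evens (odds z) :: nat \<Rightarrow> 'c)"
  have hom_h: "module_hom Q (cob V n) (cob W' n) (h n)" for n
    unfolding h_def cobV by (intro module_hom_minus[OF cpx_fd[OF W']] module_hom_comp[OF module_hom_odds module_hom_evens])
  have "chain_map Q V W' h"
    unfolding chain_map_def using hom_h
    by (auto simp: h_def cdfV cobV mcar_sum d_minus[OF W'])
  moreover have "homotopic Q V Y (gcomp f cone_out) (gcomp t h)"
  proof (rule homotopicI[where h="\<lambda>n z. - odds (odds z)"])
    fix n
    show "module_hom Q (cob V n) (cob Y (n - 1)) (\<lambda>z. - odds (odds z))"
      unfolding cobV by (intro module_hom_minus[OF cpx_fd[OF Y]] module_hom_comp[OF module_hom_odds module_hom_odds])
    fix z assume "z \<in> mcar (cob V n)"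
    then have z: "evens (odds z) \<in> mcar (cob W' n)" "odds (odds z) \<in> mcar (cob Y (n - 1))" by (simp_all add: cobV mcar_sum)
    show "gcomp f cone_out n z - gcomp t h n z = cdf Y (n - 1) (- odds (odds z)) + - odds (odds (cdf V n z))"
      using z by (simp add: gcomp_def cone_out_def h_def cdfV chain_minus[OF ct W'] d_minus[OF Y])
  qed
  ultimately show ?thesis using V w by blast
qed

definition zero_cpx :: "('v, 'e, 'k::field) cpx" where
  "zero_cpx = \<lparr>cob = (\<lambda>n. \<lparr>mcar = {0}, mact = (\<lambda>a x. 0)\<rparr>), cdf = (\<lambda>n x. 0)\<rparr>"

lemma bounded_zero_cpx: "bounded_complex Q zero_cpx"
  by (auto simp: bounded_complex_def zero_cpx_def fd_module_def module_hom_def)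

lemma acyclic_zero_cpx: "acyclic_cpx zero_cpx"
  by (auto simp: acyclic_cpx_def cocycles_iff coboundaries_iff zero_cpx_def)

lemma homotopic_diff_zero: "homotopic Q C D (f - g) 0 \<longleftrightarrow> homotopic Q C D f g"
  by (simp add: homotopic_def)

text \<open>
  The homotopy between \<open>t f\<close> and \<open>t g\<close> factors \<open>f - g\<close> through the acyclic cone of \<open>t\<close>, up to a shift.  Pulling back the
  quasi-isomorphism from \<open>0\<close> to that cone gives a refinement of \<open>W\<close> on which \<open>f - g\<close> is null-homotopic.
\<close>

lemma cancel_complexes:
  assumes fin: "finite (verts Q)" and f: "chain_map Q W Y f" and g: "chain_map Q W Y g" and t: "quasi_iso Q Y Y' t"
    and h: "homotopic Q W Y' (gcomp t f) (gcomp t g)"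
    and W: "bounded_complex Q W" and Y: "bounded_complex Q Y" and Y': "bounded_complex Q Y'"
  shows "\<exists>V w. bounded_complex Q V \<and> quasi_iso Q V W w \<and> homotopic Q V Y (gcomp f w) (gcomp g w)"
proof -
  note ct = qi_chain[OF t]
  define N where "N = cone Y Y' t"
  have N: "bounded_complex Q N" unfolding N_def by (rule bounded_cone[OF fin Y Y' ct])
  have N0: "acyclic_cpx N" unfolding N_def by (rule acyclic_cone[OF fin Y Y' ct t])
  obtain k where k: "chain_map Q (shift_cpx W) N k" "gcomp cone_out k = shift_gmap (f - g)"
    using lift_to_cone[OF fin Y Y' ct W f g h] unfolding N_def by blast
  have "quasi_iso Q zero_cpx N 0"
    by (rule quasi_iso_acyclic[OF chain_map_zero[OF N] acyclic_zero_cpx N0 N bounded_zero_cpx])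
  then obtain V' w' h' where V': "bounded_complex Q V'" "quasi_iso Q V' (shift_cpx W) w'" "chain_map Q V' zero_cpx h'"
    "homotopic Q V' N (gcomp k w') (gcomp 0 h')"
    using ore_complexes[OF fin k(1) _ bounded_shift[OF W] bounded_zero_cpx N] by blast
  define V where "V = unshift_cpx V'"
  define w where "w = unshift_gmap w'"
  have V: "bounded_complex Q V" unfolding V_def by (rule bounded_unshift[OF V'(1)])
  have sV: "V' = shift_cpx V" "w' = shift_gmap w" by (simp_all add: V_def w_def)
  have w: "quasi_iso Q V W w" using V'(2) unfolding sV quasi_iso_shift_iff[OF V W] .
  have z: "gcomp 0 h' = 0" by (intro ext) (simp add: gcomp_def)
  have "homotopic Q V' (shift_cpx Y) (gcomp cone_out (gcomp k w')) (gcomp cone_out 0)"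
    by (rule homotopic_comp_left[OF N _ _ _ _ V'(1)])
      (use V' z in \<open>auto simp: N_def chain_cone_out[OF fin Y Y' ct] intro: chain_map_comp[OF qi_chain k(1)[unfolded N_def]] chain_map_zero[OF N[unfolded N_def]]\<close>)
  moreover have "gcomp cone_out (gcomp k w') = shift_gmap (gcomp (f - g) w)"
    unfolding gcomp_assoc[symmetric] k(2) sV(2) shift_gmap_gcomp ..
  moreover have "gcomp cone_out 0 = shift_gmap (0 :: 'c gmap)" by (intro ext) (simp add: gcomp_def cone_out_def)
  ultimately have "homotopic Q (shift_cpx V) (shift_cpx Y) (shift_gmap (gcomp (f - g) w)) (shift_gmap 0)" unfolding sV(1) by simp
  from homotopic_unshift[OF V Y this] have "homotopic Q V Y (gcomp (f - g) w) 0" .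
  moreover have "gcomp (f - g) w = gcomp f w - gcomp g w" by (intro ext) (simp add: gcomp_def)
  ultimately have "homotopic Q V Y (gcomp f w) (gcomp g w)" by (simp add: homotopic_diff_zero)
  then show ?thesis using V w by blast
qed

lemma fractions_complexes:
  assumes fin: "finite (verts Q)"
  shows "fractions (bounded_complex Q) (chain_map Q) (homotopic Q) (quasi_iso Q) gcomp (gid :: 'k::field gmap)"
proof
  fix X Y Z f g assume "quasi_iso Q X Z (gcomp g f)" "quasi_iso Q Y Z g" "chain_map Q X Y f"
    "bounded_complex Q X" "bounded_complex Q Y" "bounded_complex Q Z"
  then show "quasi_iso Q X Y f" by - (erule (4) quasi_iso_cancel)
next
  fix W Y f W' t assume "chain_map Q W Y f" "quasi_iso Q W' Y t" "bounded_complex Q W" "bounded_complex Q W'" "bounded_complex Q Y"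
  then show "\<exists>V w h. bounded_complex Q V \<and> quasi_iso Q V W w \<and> chain_map Q V W' h \<and> homotopic Q V Y (gcomp f w) (gcomp t h)"
    by (rule ore_complexes[OF fin])
next
  fix W Y f g Y' t assume "chain_map Q W Y f" "chain_map Q W Y g" "quasi_iso Q Y Y' t" "homotopic Q W Y' (gcomp t f) (gcomp t g)"
    "bounded_complex Q W" "bounded_complex Q Y" "bounded_complex Q Y'"
  then show "\<exists>V w. bounded_complex Q V \<and> quasi_iso Q V W w \<and> homotopic Q V Y (gcomp f w) (gcomp g w)"
    by (rule cancel_complexes[OF fin])
qed (auto intro: chain_map_id chain_map_comp homotopic_refl homotopic_sym homotopic_trans homotopic_comp_left homotopic_comp_right
    qi_chain quasi_iso_id quasi_iso_comp quasi_iso_homotopic simp: gcomp_assoc)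

section \<open>Categories and isomorphisms\<close>

locale plain_category =
  fixes T :: "('o, 'm) tricat"
  assumes id_in: "X \<in> Ob T \<Longrightarrow> Idn T X \<in> Hom T X X"
    and cmp_in: "X \<in> Ob T \<Longrightarrow> Y \<in> Ob T \<Longrightarrow> Z \<in> Ob T \<Longrightarrow> f \<in> Hom T X Y \<Longrightarrow> g \<in> Hom T Y Z \<Longrightarrow> Cmp T X Y Z g f \<in> Hom T X Z"
    and id_left: "X \<in> Ob T \<Longrightarrow> Y \<in> Ob T \<Longrightarrow> f \<in> Hom T X Y \<Longrightarrow> Cmp T X Y Y (Idn T Y) f = f"
    and id_right: "X \<in> Ob T \<Longrightarrow> Y \<in> Ob T \<Longrightarrow> f \<in> Hom T X Y \<Longrightarrow> Cmp T X X Y f (Idn T X) = f"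
    and cmp_assoc: "X \<in> Ob T \<Longrightarrow> Y \<in> Ob T \<Longrightarrow> Z \<in> Ob T \<Longrightarrow> U \<in> Ob T \<Longrightarrow>
      f \<in> Hom T X Y \<Longrightarrow> g \<in> Hom T Y Z \<Longrightarrow> h \<in> Hom T Z U \<Longrightarrow>
      Cmp T X Y U (Cmp T Y Z U h g) f = Cmp T X Z U h (Cmp T X Y Z g f)"
begin

lemma isoI:
  assumes "f \<in> Hom T X Y" "g \<in> Hom T Y X" "Cmp T X Y X g f = Idn T X" "Cmp T Y X Y f g = Idn T Y"
  shows "iso_obj T X Y"
  using assms unfolding iso_obj_def is_iso_def by blast

lemma isoE:
  assumes "iso_obj T X Y"
  obtains f g where "f \<in> Hom T X Y" "g \<in> Hom T Y X" "Cmp T X Y X g f = Idn T X" "Cmp T Y X Y f g = Idn T Y"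
  using assms unfolding iso_obj_def is_iso_def by blast

lemma iso_refl: "X \<in> Ob T \<Longrightarrow> iso_obj T X X"
  by (rule isoI[of "Idn T X" _ _ "Idn T X"]) (auto simp: id_in id_left)

lemma iso_sym: "iso_obj T X Y \<Longrightarrow> iso_obj T Y X"
  by (elim isoE) (rule isoI)

lemma is_iso_comp:
  assumes "is_iso T X Y f" "is_iso T Y Z f'" and X: "X \<in> Ob T" and Y: "Y \<in> Ob T" and Z: "Z \<in> Ob T"
  shows "is_iso T X Z (Cmp T X Y Z f' f)"
proof -
  from assms(1) obtain g where f: "f \<in> Hom T X Y" "g \<in> Hom T Y X" "Cmp T X Y X g f = Idn T X" "Cmp T Y X Y f g = Idn T Y"
    unfolding is_iso_def by blast
  from assms(2) obtain g' where f': "f' \<in> Hom T Y Z" "g' \<in> Hom T Z Y" "Cmp T Y Z Y g' f' = Idn T Y" "Cmp T Z Y Z f' g' = Idn T Z"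
    unfolding is_iso_def by blast
  show ?thesis unfolding is_iso_def
  proof (intro conjI bexI)
    show in1: "Cmp T X Y Z f' f \<in> Hom T X Z" and in2: "Cmp T Z Y X g g' \<in> Hom T Z X"
      using f f' X Y Z cmp_in by auto
    have "Cmp T X Z X (Cmp T Z Y X g g') (Cmp T X Y Z f' f) = Cmp T X Y X g (Cmp T X Z Y g' (Cmp T X Y Z f' f))"
      using f f' X Y Z in1 by (intro cmp_assoc)
    also have "Cmp T X Z Y g' (Cmp T X Y Z f' f) = f"
      using f f' X Y Z cmp_assoc[of X Y Z Y f f' g'] id_left by simp
    finally show "Cmp T X Z X (Cmp T Z Y X g g') (Cmp T X Y Z f' f) = Idn T X" using f by simp
    have "Cmp T Z X Z (Cmp T X Y Z f' f) (Cmp T Z Y X g g') = Cmp T Z Y Z f' (Cmp T Z X Y f (Cmp T Z Y X g g'))"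
      using f f' X Y Z in2 by (intro cmp_assoc)
    also have "Cmp T Z X Y f (Cmp T Z Y X g g') = g'"
      using f f' X Y Z cmp_assoc[of Z Y X Y g' g f] id_left by simp
    finally show "Cmp T Z X Z (Cmp T X Y Z f' f) (Cmp T Z Y X g g') = Idn T Z" using f' by simp
  qed
qed

lemma iso_trans: "iso_obj T X Y \<Longrightarrow> iso_obj T Y Z \<Longrightarrow> X \<in> Ob T \<Longrightarrow> Y \<in> Ob T \<Longrightarrow> Z \<in> Ob T \<Longrightarrow> iso_obj T X Z"
  unfolding iso_obj_def using is_iso_comp by blast

lemma hom_zero_iff: "hom_zero T X Y \<longleftrightarrow> (\<exists>f. f \<in> Hom T X Y) \<and> (\<forall>f\<in>Hom T X Y. \<forall>g\<in>Hom T X Y. f = g)"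
  unfolding hom_zero_def
proof (intro iffI)
  assume *: "(\<exists>f. f \<in> Hom T X Y) \<and> (\<forall>f\<in>Hom T X Y. \<forall>g\<in>Hom T X Y. f = g)"
  then obtain f where "f \<in> Hom T X Y" by blast
  with * have "Hom T X Y = {f}" by auto
  then show "\<exists>f. Hom T X Y = {f}" ..
qed auto

lemma hom_zero_iso_source:
  assumes "hom_zero T X Y" "iso_obj T X X'" "X \<in> Ob T" "X' \<in> Ob T" "Y \<in> Ob T"
  shows "hom_zero T X' Y"
proof -
  from assms(2) obtain f g where f: "f \<in> Hom T X X'" "g \<in> Hom T X' X" "Cmp T X' X X' f g = Idn T X'"
    by (rule isoE)
  from assms(1) obtain a where a: "a \<in> Hom T X Y" and u: "\<And>b c. b \<in> Hom T X Y \<Longrightarrow> c \<in> Hom T X Y \<Longrightarrow> b = c"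
    unfolding hom_zero_iff by blast
  have "b = c" if b: "b \<in> Hom T X' Y" and c: "c \<in> Hom T X' Y" for b c
  proof -
    have "Cmp T X X' Y b f = Cmp T X X' Y c f" using u b c f assms cmp_in by blast
    then have "Cmp T X' X Y (Cmp T X X' Y b f) g = Cmp T X' X Y (Cmp T X X' Y c f) g" by simp
    then show "b = c" using b c f assms by (simp add: cmp_assoc id_right)
  qed
  moreover have "Cmp T X' X Y a g \<in> Hom T X' Y" using a f assms cmp_in by blast
  ultimately show ?thesis unfolding hom_zero_iff by blast
qed

lemma hom_zero_iso_target:
  assumes "hom_zero T X Y" "iso_obj T Y Y'" "X \<in> Ob T" "Y \<in> Ob T" "Y' \<in> Ob T"
  shows "hom_zero T X Y'"
proof -
  from assms(2) obtain f g where f: "f \<in> Hom T Y Y'" "g \<in> Hom T Y' Y" "Cmp T Y' Y Y' f g = Idn T Y'"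
    by (rule isoE)
  from assms(1) obtain a where a: "a \<in> Hom T X Y" and u: "\<And>b c. b \<in> Hom T X Y \<Longrightarrow> c \<in> Hom T X Y \<Longrightarrow> b = c"
    unfolding hom_zero_iff by blast
  have "b = c" if b: "b \<in> Hom T X Y'" and c: "c \<in> Hom T X Y'" for b c
  proof -
    have "Cmp T X Y' Y g b = Cmp T X Y' Y g c" using u b c f assms cmp_in by blast
    then have "Cmp T X Y Y' f (Cmp T X Y' Y g b) = Cmp T X Y Y' f (Cmp T X Y' Y g c)" by simp
    then show "b = c" using b c f assms by (simp add: cmp_assoc[symmetric] id_left)
  qed
  moreover have "Cmp T X Y Y' f a \<in> Hom T X Y'" using a f assms cmp_in by blast
  ultimately show ?thesis unfolding hom_zero_iff by blast
qed

text \<open>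
  Equivalences reflect the two notions in which stability conditions are formulated, the vanishing of
  \<open>Hom\<close> and isomorphy.
\<close>

lemma hom_zero_image:
  assumes "bij_betw m (Hom T X Y) (Hom T X' Y')"
  shows "hom_zero T X' Y' \<longleftrightarrow> hom_zero T X Y"
proof -
  have *: "Hom T X' Y' = m ` Hom T X Y" "inj_on m (Hom T X Y)"
    using assms by (auto simp: bij_betw_def)
  have "hom_zero T X' Y' \<longleftrightarrow> card (m ` Hom T X Y) = 1" by (simp add: hom_zero_def *(1) card_1_singleton_iff)
  also have "\<dots> \<longleftrightarrow> hom_zero T X Y" using card_image[OF *(2)] by (simp add: hom_zero_def card_1_singleton_iff)
  finally show ?thesis .
qed

lemma is_iso_image:
  assumes m: "\<And>X Y. X \<in> Ob T \<Longrightarrow> Y \<in> Ob T \<Longrightarrow> bij_betw (m X Y) (Hom T X Y) (Hom T (t X) (t Y))"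
    and m_id: "\<And>X. X \<in> Ob T \<Longrightarrow> m X X (Idn T X) = Idn T (t X)"
    and m_cmp: "\<And>X Y Z f g. X \<in> Ob T \<Longrightarrow> Y \<in> Ob T \<Longrightarrow> Z \<in> Ob T \<Longrightarrow> f \<in> Hom T X Y \<Longrightarrow> g \<in> Hom T Y Z \<Longrightarrow>
      m X Z (Cmp T X Y Z g f) = Cmp T (t X) (t Y) (t Z) (m Y Z g) (m X Y f)"
    and X: "X \<in> Ob T" and Y: "Y \<in> Ob T" and f: "f \<in> Hom T X Y"
  shows "is_iso T (t X) (t Y) (m X Y f) \<longleftrightarrow> is_iso T X Y f"
proof
  have m_in: "m X Y f \<in> Hom T (t X) (t Y)" if "X \<in> Ob T" "Y \<in> Ob T" "f \<in> Hom T X Y" for X Y f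
    using m[OF that(1,2)] that(3) by (auto simp: bij_betw_def)
  assume "is_iso T X Y f"
  then obtain g where g: "g \<in> Hom T Y X" "Cmp T X Y X g f = Idn T X" "Cmp T Y X Y f g = Idn T Y" unfolding is_iso_def by blast
  show "is_iso T (t X) (t Y) (m X Y f)" unfolding is_iso_def
  proof (intro conjI bexI[OF _ m_in[OF Y X g(1)]] m_in X Y f)
    show "Cmp T (t X) (t Y) (t X) (m Y X g) (m X Y f) = Idn T (t X)" using m_cmp[OF X Y X f g(1)] m_id[OF X] g(2) by simp
    show "Cmp T (t Y) (t X) (t Y) (m X Y f) (m Y X g) = Idn T (t Y)" using m_cmp[OF Y X Y g(1) f] m_id[OF Y] g(3) by simp
  qed
next
  assume "is_iso T (t X) (t Y) (m X Y f)"
  then obtain g' where g': "g' \<in> Hom T (t Y) (t X)"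
    "Cmp T (t X) (t Y) (t X) g' (m X Y f) = Idn T (t X)" "Cmp T (t Y) (t X) (t Y) (m X Y f) g' = Idn T (t Y)" unfolding is_iso_def by blast
  obtain g where g: "g \<in> Hom T Y X" "m Y X g = g'"
    using g'(1) m[OF Y X] unfolding bij_betw_def by (metis imageE)
  have inj: "inj_on (m X X) (Hom T X X)" "inj_on (m Y Y) (Hom T Y Y)"
    using m[OF X X] m[OF Y Y] by (auto simp: bij_betw_def)
  show "is_iso T X Y f" unfolding is_iso_def
  proof (intro conjI bexI[OF _ g(1)] f)
    show "Cmp T X Y X g f = Idn T X"
      by (rule inj_onD[OF inj(1)]) (use f g g' X Y m_cmp m_id cmp_in id_in in auto)
    show "Cmp T Y X Y f g = Idn T Y"
      by (rule inj_onD[OF inj(2)]) (use f g g' X Y m_cmp m_id cmp_in id_in in auto)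
  qed
qed

lemma iso_obj_image:
  assumes m: "\<And>X Y. X \<in> Ob T \<Longrightarrow> Y \<in> Ob T \<Longrightarrow> bij_betw (m X Y) (Hom T X Y) (Hom T (t X) (t Y))"
    and m_id: "\<And>X. X \<in> Ob T \<Longrightarrow> m X X (Idn T X) = Idn T (t X)"
    and m_cmp: "\<And>X Y Z f g. X \<in> Ob T \<Longrightarrow> Y \<in> Ob T \<Longrightarrow> Z \<in> Ob T \<Longrightarrow> f \<in> Hom T X Y \<Longrightarrow> g \<in> Hom T Y Z \<Longrightarrow>
      m X Z (Cmp T X Y Z g f) = Cmp T (t X) (t Y) (t Z) (m Y Z g) (m X Y f)"
    and X: "X \<in> Ob T" and Y: "Y \<in> Ob T"
  shows "iso_obj T (t X) (t Y) \<longleftrightarrow> iso_obj T X Y"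
proof -
  have "iso_obj T (t X) (t Y) \<longleftrightarrow> (\<exists>f\<in>Hom T X Y. is_iso T (t X) (t Y) (m X Y f))"
    using m[OF X Y] unfolding iso_obj_def bij_betw_def by (metis imageE imageI is_iso_def)
  also have "\<dots> \<longleftrightarrow> (\<exists>f\<in>Hom T X Y. is_iso T X Y f)"
    using is_iso_image[of m t, OF m m_id m_cmp X Y] by blast
  also have "\<dots> \<longleftrightarrow> iso_obj T X Y" unfolding iso_obj_def is_iso_def by blast
  finally show ?thesis .
qed


end

context plain_category begin

lemma is_isoE:
  assumes "is_iso T X Y f"
  obtains g where "f \<in> Hom T X Y" "g \<in> Hom T Y X" "Cmp T X Y X g f = Idn T X" "Cmp T Y X Y f g = Idn T Y"
  using assms unfolding is_iso_def by blast

lemma is_iso_obj: "is_iso T X Y f \<Longrightarrow> iso_obj T X Y"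
  by (auto simp: iso_obj_def)

lemma is_iso_id: "X \<in> Ob T \<Longrightarrow> is_iso T X X (Idn T X)"
  by (auto simp: is_iso_def id_in id_left)

lemma is_iso_cancel:
  assumes "is_iso T Y D b" "W \<in> Ob T" "Y \<in> Ob T" "D \<in> Ob T" "p \<in> Hom T W Y" "q \<in> Hom T W Y" "Cmp T W Y D b p = Cmp T W Y D b q"
  shows "p = q"
proof -
  from assms(1) obtain b' where b: "b \<in> Hom T Y D" "b' \<in> Hom T D Y" "Cmp T Y D Y b' b = Idn T Y" by (rule is_isoE)
  have "r = Cmp T W D Y b' (Cmp T W Y D b r)" if "r \<in> Hom T W Y" for r
    using cmp_assoc[OF assms(2,3,4,3) that b(1,2)] b(3) id_left[OF assms(2,3) that] by simp
  with assms(5-7) show ?thesis by metis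
qed

context
  fixes X Y C D a b f u W
  assumes o: "X \<in> Ob T" "Y \<in> Ob T" "C \<in> Ob T" "D \<in> Ob T" "W \<in> Ob T"
    and a: "is_iso T X C a" and b: "is_iso T Y D b" and f: "f \<in> Hom T X Y" and u: "u \<in> Hom T C D"
    and sq: "Cmp T X Y D b f = Cmp T X C D u a"
begin

text \<open>
  A distinguished triangle is only isomorphic to that of a cone, so exactness has to be carried along isomorphisms.
\<close>

lemma transport_square: assumes y: "y \<in> Hom T W X" shows "Cmp T W Y D b (Cmp T W X Y f y) = Cmp T W C D u (Cmp T W X C a y)"
proof -
  have a_in: "a \<in> Hom T X C" and b_in: "b \<in> Hom T Y D" using a b by (auto simp: is_iso_def)
  show ?thesis
    using cmp_assoc[OF o(5,1,2,4) y f b_in] cmp_assoc[OF o(5,1,3,4) y a_in u] sq by simp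
qed

lemma transport_lift:
  assumes lift: "\<And>x. x \<in> Hom T W D \<Longrightarrow> \<exists>y\<in>Hom T W C. Cmp T W C D u y = x" and x: "x \<in> Hom T W Y"
  shows "\<exists>y\<in>Hom T W X. Cmp T W X Y f y = x"
proof -
  from a obtain a' where a': "a \<in> Hom T X C" "a' \<in> Hom T C X" "Cmp T C X C a a' = Idn T C" by (rule is_isoE)
  have b_in: "b \<in> Hom T Y D" using b by (auto simp: is_iso_def)
  from lift[OF cmp_in[OF o(5,2,4) x b_in]] obtain y' where y': "y' \<in> Hom T W C" "Cmp T W C D u y' = Cmp T W Y D b x" by blast
  define y where "y = Cmp T W C X a' y'"
  have y: "y \<in> Hom T W X" unfolding y_def by (rule cmp_in[OF o(5,3,1) y'(1) a'(2)])
  have "Cmp T W X C a y = y'"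
    using cmp_assoc[OF o(5,3,1,3) y'(1) a'(2,1)] a'(3) id_left[OF o(5,3) y'(1)] by (simp add: y_def)
  then have "Cmp T W Y D b (Cmp T W X Y f y) = Cmp T W Y D b x" using transport_square[OF y] y'(2) by simp
  then have "Cmp T W X Y f y = x" by (rule is_iso_cancel[OF b o(5,2,4) cmp_in[OF o(5,1,2) y f] x])
  with y show ?thesis by blast
qed

lemma transport_mono:
  assumes mono: "\<And>y y'. y \<in> Hom T W C \<Longrightarrow> y' \<in> Hom T W C \<Longrightarrow> Cmp T W C D u y = Cmp T W C D u y' \<Longrightarrow> y = y'"
    and y: "y \<in> Hom T W X" "y' \<in> Hom T W X" and eq: "Cmp T W X Y f y = Cmp T W X Y f y'"
  shows "y = y'"
proof -
  have a_in: "a \<in> Hom T X C" using a by (auto simp: is_iso_def)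
  have "Cmp T W X C a y = Cmp T W X C a y'"
    by (rule mono) (use transport_square[OF y(1)] transport_square[OF y(2)] eq cmp_in[OF o(5,1,3) _ a_in] y in auto)
  then show ?thesis by (rule is_iso_cancel[OF a o(5,1,3) y])
qed

lemma transport_ext:
  assumes ext: "\<And>x. x \<in> Hom T C W \<Longrightarrow> \<exists>y\<in>Hom T D W. Cmp T C D W y u = x" and x: "x \<in> Hom T X W"
  shows "\<exists>y\<in>Hom T Y W. Cmp T X Y W y f = x"
proof -
  from a obtain a' where a': "a \<in> Hom T X C" "a' \<in> Hom T C X" "Cmp T X C X a' a = Idn T X" by (rule is_isoE)
  have b_in: "b \<in> Hom T Y D" using b by (auto simp: is_iso_def)
  from ext[OF cmp_in[OF o(3,1,5) a'(2) x]] obtain y' where y': "y' \<in> Hom T D W" "Cmp T C D W y' u = Cmp T C X W x a'" by blast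
  have "Cmp T X Y W (Cmp T Y D W y' b) f = Cmp T X D W y' (Cmp T X Y D b f)"
    by (rule cmp_assoc[OF o(1,2,4,5) f b_in y'(1)])
  also have "\<dots> = Cmp T X C W (Cmp T C D W y' u) a" unfolding sq by (rule cmp_assoc[OF o(1,3,4,5) a'(1) u y'(1), symmetric])
  also have "\<dots> = x" unfolding y'(2)
    using cmp_assoc[OF o(1,3,1,5) a'(1,2) x] a'(3) id_right[OF o(1,5) x] by simp
  finally show ?thesis using cmp_in[OF o(2,4,5) b_in y'(1)] by blast
qed

end

end

section \<open>Harder--Narasimhan filtrations\<close>

text \<open>
  The part of the axioms of a triangulated category on which Harder--Narasimhan theory rests.  There is no
  addition of morphisms: \<open>tri_mono\<close> states injectivity, rather than the triviality of a kernel, and vanishing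
  is expressed by \<^const>\<open>hom_zero\<close>.
\<close>

locale tri_category = plain_category T for T :: "('o, 'm) tricat" +
  assumes zero_endo: "X \<in> Ob T \<Longrightarrow> hom_zero T X X \<Longrightarrow> zero_obj T X"
    and sh_ob: "X \<in> Ob T \<Longrightarrow> Sh T X \<in> Ob T"
    and sh_hom_zero: "X \<in> Ob T \<Longrightarrow> Y \<in> Ob T \<Longrightarrow> hom_zero T X Y \<Longrightarrow> hom_zero T (Sh T X) (Sh T Y)"
    and sh_iso: "X \<in> Ob T \<Longrightarrow> Y \<in> Ob T \<Longrightarrow> iso_obj T (Sh T X) (Sh T Y) \<longleftrightarrow> iso_obj T X Y"
    and tri_in: "(X, Y, Z, f, g, h) \<in> Tri T \<Longrightarrow> X \<in> Ob T \<and> Y \<in> Ob T \<and> Z \<in> Ob T \<and> f \<in> Hom T X Y \<and> g \<in> Hom T Y Z"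
    and tri_lift: "(X, Y, Z, f, g, h) \<in> Tri T \<Longrightarrow> W \<in> Ob T \<Longrightarrow> hom_zero T W Z \<Longrightarrow> x \<in> Hom T W Y \<Longrightarrow>
      \<exists>y\<in>Hom T W X. Cmp T W X Y f y = x"
    and tri_mono: "(X, Y, Z, f, g, h) \<in> Tri T \<Longrightarrow> W \<in> Ob T \<Longrightarrow> hom_zero T (Sh T W) Z \<Longrightarrow> y \<in> Hom T W X \<Longrightarrow> y' \<in> Hom T W X \<Longrightarrow>
      Cmp T W X Y f y = Cmp T W X Y f y' \<Longrightarrow> y = y'"
    and tri_ext: "(X, Y, Z, f, g, h) \<in> Tri T \<Longrightarrow> B \<in> Ob T \<Longrightarrow> hom_zero T X B \<Longrightarrow> x \<in> Hom T Y B \<Longrightarrow>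
      \<exists>y\<in>Hom T Z B. Cmp T Y Z B y g = x"
    and tri_zero: "(X, Y, Z, f, g, h) \<in> Tri T \<Longrightarrow> zero_obj T X \<Longrightarrow> iso_obj T Y Z"
    and tri_iso: "(X, Y, Z, f, g, h) \<in> Tri T \<Longrightarrow> Y' \<in> Ob T \<Longrightarrow> iso_obj T Y Y' \<Longrightarrow> \<exists>f g h. (X, Y', Z, f, g, h) \<in> Tri T"
    and tri_id: "E \<in> Ob T \<Longrightarrow> \<exists>X f g h. zero_obj T X \<and> (X, E, E, f, g, h) \<in> Tri T"
begin

lemma zero_objD: "zero_obj T X \<Longrightarrow> X \<in> Ob T" "zero_obj T X \<Longrightarrow> Y \<in> Ob T \<Longrightarrow> hom_zero T X Y"
    "zero_obj T X \<Longrightarrow> Y \<in> Ob T \<Longrightarrow> hom_zero T Y X"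
  by (auto simp: zero_obj_def)

lemma zero_obj_iso: "zero_obj T X \<Longrightarrow> iso_obj T X Y \<Longrightarrow> Y \<in> Ob T \<Longrightarrow> zero_obj T Y"
  by (meson hom_zero_iso_source hom_zero_iso_target zero_endo zero_objD)

lemma zero_objs_iso:
  assumes X: "zero_obj T X" and Y: "zero_obj T Y"
  shows "iso_obj T X Y"
proof -
  note o = zero_objD(1)[OF X] zero_objD(1)[OF Y]
  obtain f where f: "f \<in> Hom T X Y" using zero_objD(2)[OF X o(2)] unfolding hom_zero_iff by blast
  obtain g where g: "g \<in> Hom T Y X" using zero_objD(2)[OF Y o(1)] unfolding hom_zero_iff by blast
  show ?thesis
  proof (rule isoI[OF f g])
    show "Cmp T X Y X g f = Idn T X" using zero_objD(2)[OF X o(1)] o f g cmp_in id_in unfolding hom_zero_iff by blast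
    show "Cmp T Y X Y f g = Idn T Y" using zero_objD(2)[OF Y o(2)] o f g cmp_in id_in unfolding hom_zero_iff by blast
  qed
qed

subsection \<open>Filtrations\<close>

definition filt :: "(nat \<Rightarrow> 'o) \<Rightarrow> (nat \<Rightarrow> 'o) \<Rightarrow> nat \<Rightarrow> bool" where
  "filt G A n \<longleftrightarrow> zero_obj T (G 0) \<and> (\<forall>i<n. \<exists>f g h. (G i, G (Suc i), A i, f, g, h) \<in> Tri T)"

lemma filt_ob: assumes "filt G A n" shows "i \<le> n \<Longrightarrow> G i \<in> Ob T" "i < n \<Longrightarrow> A i \<in> Ob T"
proof -
  show "i < n \<Longrightarrow> A i \<in> Ob T" using assms tri_in unfolding filt_def by blast
  show "G i \<in> Ob T" if "i \<le> n"
  proof (cases i)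
    case 0
    then show ?thesis using assms zero_objD(1) by (simp add: filt_def)
  next
    case (Suc j)
    then have "j < n" using that by simp
    then obtain f g h where "(G j, G (Suc j), A j, f, g, h) \<in> Tri T" using assms unfolding filt_def by blast
    then show ?thesis using tri_in Suc by blast
  qed
qed

lemma filt_SucE:
  assumes "filt G A (Suc n)"
  obtains f g h where "filt G A n" "(G n, G (Suc n), A n, f, g, h) \<in> Tri T"
  using assms unfolding filt_def by (meson lessI less_SucI)

text \<open>
  Vanishing spreads along the triangles of a filtration, in either variable.
\<close>

lemma hom_zero_to_filt:
  assumes W: "W \<in> Ob T" shows "filt G A n \<Longrightarrow> (\<And>i. i < n \<Longrightarrow> hom_zero T W (A i)) \<Longrightarrow> hom_zero T W (G n)"
proof (induction n)
  case 0
  then show ?case using W zero_objD by (auto simp: filt_def)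
next
  case (Suc n)
  from Suc.prems(1) obtain f g h where F: "filt G A n" and t: "(G n, G (Suc n), A n, f, g, h) \<in> Tri T" by (rule filt_SucE)
  note o = tri_in[OF t]
  have IH: "hom_zero T W (G n)" using Suc.IH[OF F] Suc.prems(2) by simp
  then obtain a where a: "a \<in> Hom T W (G n)" unfolding hom_zero_iff by blast
  have "x = y" if "x \<in> Hom T W (G (Suc n))" "y \<in> Hom T W (G (Suc n))" for x y
    using tri_lift[OF t W Suc.prems(2)[OF lessI] that(1)] tri_lift[OF t W Suc.prems(2)[OF lessI] that(2)] IH
    unfolding hom_zero_iff by metis
  moreover have "Cmp T W (G n) (G (Suc n)) f a \<in> Hom T W (G (Suc n))" using o W a cmp_in by blast
  ultimately show ?case unfolding hom_zero_iff by blast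
qed

lemma hom_zero_from_filt:
  assumes B: "B \<in> Ob T" shows "filt G A n \<Longrightarrow> (\<And>i. i < n \<Longrightarrow> hom_zero T (A i) B) \<Longrightarrow> hom_zero T (G n) B"
proof (induction n)
  case 0
  then show ?case using B zero_objD by (auto simp: filt_def)
next
  case (Suc n)
  from Suc.prems(1) obtain f g h where F: "filt G A n" and t: "(G n, G (Suc n), A n, f, g, h) \<in> Tri T" by (rule filt_SucE)
  note o = tri_in[OF t]
  have IH: "hom_zero T (G n) B" using Suc.IH[OF F] Suc.prems(2) by simp
  have hA: "hom_zero T (A n) B" using Suc.prems(2) by simp
  then obtain a where a: "a \<in> Hom T (A n) B" unfolding hom_zero_iff by blast
  have "x = y" if "x \<in> Hom T (G (Suc n)) B" "y \<in> Hom T (G (Suc n)) B" for x y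
    using tri_ext[OF t B IH that(1)] tri_ext[OF t B IH that(2)] hA unfolding hom_zero_iff by metis
  moreover have "Cmp T (G (Suc n)) (A n) B a g \<in> Hom T (G (Suc n)) B" using o B a cmp_in by blast
  ultimately show ?case unfolding hom_zero_iff by blast
qed

lemma filt_first: "filt G A n \<Longrightarrow> 0 < n \<Longrightarrow> iso_obj T (G 1) (A 0)"
  unfolding filt_def using tri_zero by fastforce

text \<open>
  The inclusion of the first step is composed of the maps \<open>G i \<rightarrow> G (i + 1)\<close>, whose cones are the factors \<open>A i\<close>.  Maps
  from \<open>W[1]\<close> to the factors are the obstruction to injectivity on \<open>Hom(W, \<cdot>)\<close>, maps from \<open>W\<close> that to surjectivity.
\<close>

lemma filt_inclusion:
  "0 < n \<Longrightarrow> filt G A n \<Longrightarrow> \<exists>a\<in>Hom T (G 1) (G n). \<forall>W\<in>Ob T.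
     ((\<forall>i. 0 < i \<and> i < n \<longrightarrow> hom_zero T (Sh T W) (A i)) \<longrightarrow> inj_on (Cmp T W (G 1) (G n) a) (Hom T W (G 1))) \<and>
     ((\<forall>i. 0 < i \<and> i < n \<longrightarrow> hom_zero T W (A i)) \<longrightarrow> Hom T W (G n) \<subseteq> Cmp T W (G 1) (G n) a ` Hom T W (G 1))"
proof (induction n rule: nat_induct_non_zero)
  case 1
  then have G: "G 1 \<in> Ob T" using filt_ob(1) by blast
  have "Cmp T W (G 1) (G 1) (Idn T (G 1)) y = y" if "W \<in> Ob T" "y \<in> Hom T W (G 1)" for W y
    by (rule id_left[OF that(1) G that(2)])
  then show ?case using id_in[OF G] by (intro bexI[of _ "Idn T (G 1)"]) (auto simp: inj_on_def image_iff)
next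
  case (Suc n)
  from Suc.prems(1) obtain f g h where F: "filt G A n" and t: "(G n, G (Suc n), A n, f, g, h) \<in> Tri T" by (rule filt_SucE)
  have G1: "G 1 \<in> Ob T" using filt_ob(1)[OF F] Suc.hyps by simp
  note o = tri_in[OF t]
  from Suc.IH[OF F] obtain a where a: "a \<in> Hom T (G 1) (G n)" and IH: "\<forall>W\<in>Ob T.
     ((\<forall>i. 0 < i \<and> i < n \<longrightarrow> hom_zero T (Sh T W) (A i)) \<longrightarrow> inj_on (Cmp T W (G 1) (G n) a) (Hom T W (G 1))) \<and>
     ((\<forall>i. 0 < i \<and> i < n \<longrightarrow> hom_zero T W (A i)) \<longrightarrow> Hom T W (G n) \<subseteq> Cmp T W (G 1) (G n) a ` Hom T W (G 1))" by (rule bexE)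
  define b where "b = Cmp T (G 1) (G n) (G (Suc n)) f a"
  have b: "b \<in> Hom T (G 1) (G (Suc n))" unfolding b_def using o a G1 cmp_in by blast
  have bc: "Cmp T W (G 1) (G (Suc n)) b y = Cmp T W (G n) (G (Suc n)) f (Cmp T W (G 1) (G n) a y)"
    if "W \<in> Ob T" "y \<in> Hom T W (G 1)" for W y
    unfolding b_def using that o a G1 by (intro cmp_assoc) auto
  show ?case
  proof (intro bexI[OF _ b] ballI conjI impI inj_onI subsetI)
    fix W y y' assume W: "W \<in> Ob T" and v: "\<forall>i. 0 < i \<and> i < Suc n \<longrightarrow> hom_zero T (Sh T W) (A i)"
      and y: "y \<in> Hom T W (G 1)" and y': "y' \<in> Hom T W (G 1)" and eq: "Cmp T W (G 1) (G (Suc n)) b y = Cmp T W (G 1) (G (Suc n)) b y'"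
    have "Cmp T W (G 1) (G n) a y = Cmp T W (G 1) (G n) a y'"
    proof (rule tri_mono[OF t W])
      show "hom_zero T (Sh T W) (A n)" using v Suc.hyps by simp
    qed (use y y' eq W o G1 a bc cmp_in in auto)
    moreover have "inj_on (Cmp T W (G 1) (G n) a) (Hom T W (G 1))"
      using IH[rule_format, OF W, THEN conjunct1] v by simp
    ultimately show "y = y'" using y y' by (metis inj_onD)
  next
    fix W x assume W: "W \<in> Ob T" and v: "\<forall>i. 0 < i \<and> i < Suc n \<longrightarrow> hom_zero T W (A i)" and x: "x \<in> Hom T W (G (Suc n))"
    from tri_lift[OF t W _ x] v Suc.hyps obtain z where z: "z \<in> Hom T W (G n)" "Cmp T W (G n) (G (Suc n)) f z = x" by blast
    have "Hom T W (G n) \<subseteq> Cmp T W (G 1) (G n) a ` Hom T W (G 1)"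
      using IH[rule_format, OF W, THEN conjunct2] v by simp
    with z(1) obtain y where "y \<in> Hom T W (G 1)" "z = Cmp T W (G 1) (G n) a y" by blast
    with z(2) bc[OF W] show "x \<in> Cmp T W (G 1) (G (Suc n)) b ` Hom T W (G 1)" by auto
  qed
qed

lemma hn_filtration_iff:
  "hn_filtration T P E n \<phi> \<longleftrightarrow> (\<forall>i j. i < j \<and> j < n \<longrightarrow> \<phi> j < \<phi> i) \<and>
     (\<exists>G A. filt G A n \<and> G n = E \<and> (\<forall>i<n. A i \<in> P (\<phi> i) \<and> \<not> zero_obj T (A i)))"
  unfolding hn_filtration_def filt_def by blast

subsection \<open>Central charges\<close>

text \<open>
  An isomorphic object can be substituted in the middle of a triangle, here \<open>X \<rightarrow> E \<rightarrow> E\<close>, without changing the other two.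
\<close>

lemma charge_iso:
  assumes Z: "central_charge T Z" and i: "iso_obj T E E'" and E: "E \<in> Ob T" and E': "E' \<in> Ob T"
  shows "Z E = Z E'"
proof -
  obtain X f g h where t: "(X, E, E, f, g, h) \<in> Tri T" using tri_id[OF E] by blast
  from tri_iso[OF t E' i] obtain f' g' h' where t': "(X, E', E, f', g', h') \<in> Tri T" by blast
  have "Z E = Z X + Z E" "Z E' = Z X + Z E" using Z t t' unfolding central_charge_def by blast+
  then show ?thesis by simp
qed

lemma charge_zero: assumes Z: "central_charge T Z" and X: "zero_obj T X" shows "Z X = 0"
proof -
  obtain Y f g h where Y: "zero_obj T Y" "(Y, X, X, f, g, h) \<in> Tri T" using tri_id[OF zero_objD(1)[OF X]] by blast
  have "Z X = Z Y + Z X" using Z Y(2) unfolding central_charge_def by blast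
  moreover have "Z Y = Z X" using charge_iso[OF Z zero_objs_iso[OF Y(1) X]] zero_objD(1) X Y(1) by blast
  ultimately show "Z X = 0" by simp
qed

lemma charge_filt: assumes Z: "central_charge T Z" shows "filt G A n \<Longrightarrow> Z (G n) = (\<Sum>i<n. Z (A i))"
proof (induction n)
  case 0
  then show ?case using charge_zero[OF Z] by (simp add: filt_def)
next
  case (Suc n)
  from Suc.prems obtain f g h where F: "filt G A n" and t: "(G n, G (Suc n), A n, f, g, h) \<in> Tri T" by (rule filt_SucE)
  have "Z (G (Suc n)) = Z (G n) + Z (A n)" using Z t unfolding central_charge_def by blast
  then show ?case using Suc.IH[OF F] by simp
qed

subsection \<open>Uniqueness of the slicing\<close>

text \<open>
  The axioms of a slicing which govern its Harder--Narasimhan filtrations.  They are carried over by automorphisms with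
  little effort, as they do not speak of direct sums.
\<close>

definition weak_slicing :: "(real \<Rightarrow> 'o set) \<Rightarrow> bool" where
  "weak_slicing P \<longleftrightarrow>
     (\<forall>\<phi>. P \<phi> \<subseteq> Ob T \<and> (\<forall>X\<in>P \<phi>. \<forall>Y\<in>Ob T. iso_obj T X Y \<longrightarrow> Y \<in> P \<phi>) \<and> (\<forall>X. zero_obj T X \<longrightarrow> X \<in> P \<phi>)) \<and>
     (\<forall>\<phi>. P (\<phi> + 1) = ess_image T (Sh T) (P \<phi>)) \<and>
     (\<forall>\<phi> \<psi>. \<phi> > \<psi> \<longrightarrow> (\<forall>A\<in>P \<phi>. \<forall>B\<in>P \<psi>. hom_zero T A B)) \<and>
     (\<forall>E\<in>Ob T. \<exists>n \<phi>. hn_filtration T P E n \<phi>)"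

lemma slicing_weak: "slicing T P \<Longrightarrow> weak_slicing P"
  unfolding slicing_def weak_slicing_def additive_subcat_def by blast

definition phases :: "('o \<Rightarrow> complex) \<Rightarrow> (real \<Rightarrow> 'o set) \<Rightarrow> bool" where
  "phases Z P \<longleftrightarrow> (\<forall>\<phi>. \<forall>E\<in>P \<phi>. \<not> zero_obj T E \<longrightarrow> (\<exists>m>0. Z E = of_real m * exp (\<i> * of_real (pi * \<phi>))))"

context
  fixes P assumes P: "weak_slicing P"
begin

lemma P_ob: "X \<in> P \<phi> \<Longrightarrow> X \<in> Ob T"
  and P_iso: "X \<in> P \<phi> \<Longrightarrow> iso_obj T X Y \<Longrightarrow> Y \<in> Ob T \<Longrightarrow> Y \<in> P \<phi>"
  and P_zero: "zero_obj T X \<Longrightarrow> X \<in> P \<phi>"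
  and P_shift: "P (\<phi> + 1) = ess_image T (Sh T) (P \<phi>)"
  and P_hom: "\<psi> < \<phi> \<Longrightarrow> A \<in> P \<phi> \<Longrightarrow> B \<in> P \<psi> \<Longrightarrow> hom_zero T A B"
  and P_hn: "E \<in> Ob T \<Longrightarrow> \<exists>n \<phi>. hn_filtration T P E n \<phi>"
  using P unfolding weak_slicing_def by blast+

lemma P_Sh: "X \<in> P \<phi> \<Longrightarrow> Sh T X \<in> P (\<phi> + 1)"
  unfolding P_shift ess_image_def using P_ob sh_ob iso_refl by blast

lemma P_Sh_iff: assumes X: "X \<in> Ob T" shows "Sh T X \<in> P (\<phi> + 1) \<longleftrightarrow> X \<in> P \<phi>"
proof
  assume "Sh T X \<in> P (\<phi> + 1)"
  then obtain Y where Y: "Y \<in> P \<phi>" "iso_obj T (Sh T Y) (Sh T X)" unfolding P_shift ess_image_def by blast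
  then show "X \<in> P \<phi>" using sh_iso[of Y X] P_ob P_iso X by blast
qed (rule P_Sh)

lemma hom_zero_Sh: "W \<in> P \<psi> \<Longrightarrow> A \<in> P \<phi> \<Longrightarrow> \<phi> < \<psi> + 1 \<Longrightarrow> hom_zero T (Sh T W) A"
  using P_hom[OF _ P_Sh] by blast

lemma heart_ob: "X \<in> heart T P \<Longrightarrow> X \<in> Ob T" by (simp add: heart_def)

text \<open>
  Write \<open>A\<close> as the shift of some \<open>B\<close> of phase at most \<open>0\<close>; the objects of the heart have no maps to \<open>B\<close>.
\<close>

lemma hom_zero_Sh_heart:
  assumes X: "X \<in> heart T P" and A: "A \<in> P \<phi>" and \<phi>: "\<phi> \<le> 1"
  shows "hom_zero T (Sh T X) A"
proof -
  from A have "A \<in> P (\<phi> - 1 + 1)" by simp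
  then obtain B where B: "B \<in> P (\<phi> - 1)" "iso_obj T (Sh T B) A" unfolding P_shift ess_image_def by blast
  from X obtain n \<psi> where "hn_filtration T P X n \<psi>" and \<psi>: "\<forall>i<n. 0 < \<psi> i" unfolding heart_def by blast
  then obtain G C where F: "filt G C n" "G n = X" "\<forall>i<n. C i \<in> P (\<psi> i)" unfolding hn_filtration_iff by blast
  have "hom_zero T (C i) B" if "i < n" for i
    by (rule P_hom[OF _ _ B(1), of "\<psi> i"]) (use that F(3) \<psi> \<phi> in \<open>auto intro: le_less_trans\<close>)
  from hom_zero_from_filt[OF P_ob[OF B(1)] F(1) this] have "hom_zero T X B" using F(2) by simp
  then have "hom_zero T (Sh T X) (Sh T B)" using sh_hom_zero heart_ob[OF X] P_ob[OF B(1)] by blast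
  then show ?thesis using hom_zero_iso_target B P_ob A heart_ob[OF X] sh_ob by blast
qed

lemma semistable_in_heart:
  assumes E: "E \<in> P \<phi>" and \<phi>: "0 < \<phi>" "\<phi> \<le> 1" and nz: "\<not> zero_obj T E"
  shows "E \<in> heart T P"
proof -
  obtain X f g h where X: "zero_obj T X" and t: "(X, E, E, f, g, h) \<in> Tri T" using tri_id[OF P_ob[OF E]] by blast
  define G where "G i = (if i = (0::nat) then X else E)" for i
  have "filt G (\<lambda>_. E) 1" unfolding filt_def using X t by (auto simp: G_def)
  then have "hn_filtration T P E 1 (\<lambda>_. \<phi>)" unfolding hn_filtration_iff
    by (intro conjI exI[of _ G] exI[of _ "\<lambda>_. E"]) (use E nz in \<open>auto simp: G_def\<close>)
  then show ?thesis unfolding heart_def using \<phi> P_ob[OF E] by (intro CollectI conjI exI[of _ 1] exI[of _ "\<lambda>_. \<phi>"]) auto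
qed

text \<open>
  The first step \<open>G 1\<close> is semistable of the largest phase, and objects whose shifts have no maps to the factors see it as a
  subobject of \<open>E\<close>.
\<close>

lemma hn_first:
  assumes H: "hn_filtration T P E n \<phi>" and nz: "\<not> zero_obj T E"
  obtains G A a where "0 < n" "filt G A n" "G n = E" "\<And>i. i < n \<Longrightarrow> A i \<in> P (\<phi> i)"
    "G 1 \<in> P (\<phi> 0)" "\<not> zero_obj T (G 1)" "\<And>i. i < n \<Longrightarrow> \<not> zero_obj T (A i)"
    "\<And>i. i < n \<Longrightarrow> \<phi> i \<le> \<phi> 0" "\<And>i. 0 < i \<Longrightarrow> i < n \<Longrightarrow> \<phi> i < \<phi> 0" "a \<in> Hom T (G 1) E"
    "\<And>W. W \<in> Ob T \<Longrightarrow> (\<And>i. i < n \<Longrightarrow> hom_zero T (Sh T W) (A i)) \<Longrightarrow> inj_on (Cmp T W (G 1) E a) (Hom T W (G 1))"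
proof -
  from H obtain G A where dec: "\<forall>i j. i < j \<and> j < n \<longrightarrow> \<phi> j < \<phi> i" and F: "filt G A n" "G n = E" and A: "\<forall>i<n. A i \<in> P (\<phi> i) \<and> \<not> zero_obj T (A i)"
    unfolding hn_filtration_iff by blast
  have n: "0 < n" using F nz by (cases n) (auto simp: filt_def)
  have i: "iso_obj T (G 1) (A 0)" by (rule filt_first[OF F(1) n])
  have G1: "G 1 \<in> Ob T" and A0: "A 0 \<in> Ob T" using filt_ob[OF F(1)] n by auto
  have 1: "G 1 \<in> P (\<phi> 0)" using A n P_iso[OF _ iso_sym[OF i] G1] by blast
  have 2: "\<not> zero_obj T (G 1)" using A n zero_obj_iso[OF _ i A0] by blast
  have 3: "\<phi> i \<le> \<phi> 0" if "i < n" for i using dec that by (cases "i = 0") (auto intro: less_imp_le)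
  from filt_inclusion[OF n F(1)] obtain a where a: "a \<in> Hom T (G 1) E"
    and inj: "\<And>W. W \<in> Ob T \<Longrightarrow> (\<And>i. i < n \<Longrightarrow> hom_zero T (Sh T W) (A i)) \<Longrightarrow> inj_on (Cmp T W (G 1) E a) (Hom T W (G 1))"
    unfolding F(2) by auto
  show ?thesis by (rule that[OF n F _ 1 2 _ 3 _ a inj]) (use A dec n in blast)+
qed

text \<open>
  Under a map which is injective on \<open>Hom(W, W)\<close>, the identity and the zero map of \<open>W\<close> have different images.
\<close>

lemma endo_nonzero:
  assumes W: "W \<in> Ob T" and nz: "\<not> zero_obj T W" and E: "E \<in> Ob T" and a: "a \<in> Hom T W E" and h: "hom_zero T W E"
    and inj: "inj_on (Cmp T W W E a) (Hom T W W)"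
  shows False
proof -
  have "y = y'" if "y \<in> Hom T W W" "y' \<in> Hom T W W" for y y'
    using inj_onD[OF inj _ that] h that cmp_in[OF W W E _ a] unfolding hom_zero_iff by blast
  then have "hom_zero T W W" unfolding hom_zero_iff using id_in[OF W] by blast
  then show False using zero_endo[OF W] nz by blast
qed

text \<open>
  If the largest phase of \<open>E\<close> exceeded all phases of \<open>E'\<close>, then the inclusion of the first step would be zero.
\<close>

lemma top_phase_le:
  assumes H: "hn_filtration T P E n \<phi>" and H': "hn_filtration T P E' n' \<phi>'" and i: "iso_obj T E E'" and nz: "\<not> zero_obj T E"
    and E: "E \<in> Ob T" and E': "E' \<in> Ob T"
  shows "\<phi> 0 \<le> \<phi>' 0"
proof (rule ccontr)
  assume lt: "\<not> \<phi> 0 \<le> \<phi>' 0"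
  have nz': "\<not> zero_obj T E'" using nz zero_obj_iso[OF _ iso_sym[OF i] E] by blast
  from H nz obtain G A a where *: "filt G A n" "0 < n" "\<And>i. i < n \<Longrightarrow> A i \<in> P (\<phi> i)" "G 1 \<in> P (\<phi> 0)" "\<not> zero_obj T (G 1)"
    "\<And>i. i < n \<Longrightarrow> \<phi> i \<le> \<phi> 0" "a \<in> Hom T (G 1) E" and
    inj: "\<And>W. W \<in> Ob T \<Longrightarrow> (\<And>i. i < n \<Longrightarrow> hom_zero T (Sh T W) (A i)) \<Longrightarrow> inj_on (Cmp T W (G 1) E a) (Hom T W (G 1))"
    by (rule hn_first) blast
  from H' nz' obtain G' A' where **: "filt G' A' n'" "G' n' = E'" "\<And>i. i < n' \<Longrightarrow> A' i \<in> P (\<phi>' i)" "\<And>i. i < n' \<Longrightarrow> \<phi>' i \<le> \<phi>' 0"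
    by (rule hn_first) blast
  have G1: "G 1 \<in> Ob T" by (rule P_ob[OF *(4)])
  have "hom_zero T (G 1) (A' i)" if "i < n'" for i
    using P_hom[OF _ *(4) **(3)[OF that]] **(4)[OF that] lt by simp
  from hom_zero_to_filt[OF G1 **(1) this] have "hom_zero T (G 1) E'" using **(2) by simp
  then have "hom_zero T (G 1) E" using hom_zero_iso_target[OF _ iso_sym[OF i] G1 E' E] by blast
  moreover have "\<phi> i < \<phi> 0 + 1" if "i < n" for i using *(6)[OF that] by linarith
  ultimately show False
    by - (erule endo_nonzero[OF G1 *(5) E *(7)], rule inj[OF G1 hom_zero_Sh[OF *(4) *(3)]])
qed

text \<open>
  The first step represents the maps from the semistable objects of its phase; this determines it, as for any
  representing object.
\<close>

lemma first_step_unique: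
  assumes F: "0 < n" "filt G A n" "\<And>i. i < n \<Longrightarrow> A i \<in> P (\<phi> i)" "\<And>i. 0 < i \<Longrightarrow> i < n \<Longrightarrow> \<phi> i < \<theta>" "G 1 \<in> P \<theta>"
    and F': "0 < n'" "filt G' A' n'" "\<And>i. i < n' \<Longrightarrow> A' i \<in> P (\<phi>' i)" "\<And>i. 0 < i \<Longrightarrow> i < n' \<Longrightarrow> \<phi>' i < \<theta>" "G' 1 \<in> P \<theta>"
    and iso: "iso_obj T (G n) (G' n')"
  shows "iso_obj T (G 1) (G' 1)"
proof -
  define X where "X = G 1" define Y where "Y = G' 1" define E where "E = G n" define E' where "E' = G' n'"
  have ob: "X \<in> Ob T" "Y \<in> Ob T" "E \<in> Ob T" "E' \<in> Ob T"
    using filt_ob(1)[OF F(2)] filt_ob(1)[OF F'(2)] F(1) F'(1) by (auto simp: X_def Y_def E_def E'_def)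
  have XY: "X \<in> P \<theta>" "Y \<in> P \<theta>" using F F' by (simp_all add: X_def Y_def)
  have hz: "hom_zero T W (A i) \<and> hom_zero T (Sh T W) (A i)" if "W \<in> P \<theta>" "0 < i" "i < n" for W i
    using P_hom[OF F(4)[OF that(2,3)] that(1) F(3)[OF that(3)]] hom_zero_Sh[OF that(1) F(3)[OF that(3)]] F(4)[OF that(2,3)] by simp
  have hz': "hom_zero T W (A' i) \<and> hom_zero T (Sh T W) (A' i)" if "W \<in> P \<theta>" "0 < i" "i < n'" for W i
    using P_hom[OF F'(4)[OF that(2,3)] that(1) F'(3)[OF that(3)]] hom_zero_Sh[OF that(1) F'(3)[OF that(3)]] F'(4)[OF that(2,3)] by simp
  from filt_inclusion[OF F(1,2)] obtain a where a: "a \<in> Hom T X E"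
    and a_inj: "\<And>W. W \<in> P \<theta> \<Longrightarrow> inj_on (Cmp T W X E a) (Hom T W X)"
    and a_surj: "\<And>W. W \<in> P \<theta> \<Longrightarrow> Hom T W E \<subseteq> Cmp T W X E a ` Hom T W X"
    unfolding X_def E_def using hz P_ob by auto
  from filt_inclusion[OF F'(1,2)] obtain b where b: "b \<in> Hom T Y E'"
    and b_inj: "\<And>W. W \<in> P \<theta> \<Longrightarrow> inj_on (Cmp T W Y E' b) (Hom T W Y)"
    and b_surj: "\<And>W. W \<in> P \<theta> \<Longrightarrow> Hom T W E' \<subseteq> Cmp T W Y E' b ` Hom T W Y"
    unfolding Y_def E'_def using hz' P_ob by auto
  from iso obtain u v where u: "u \<in> Hom T E E'" "v \<in> Hom T E' E" "Cmp T E E' E v u = Idn T E" "Cmp T E' E E' u v = Idn T E'"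
    unfolding E_def E'_def by (rule isoE)
  obtain p where p: "p \<in> Hom T X Y" "Cmp T X Y E' b p = Cmp T X E E' u a" using b_surj[OF XY(1)] cmp_in[OF ob(1,3,4) a u(1)] by (metis imageE subsetD)
  obtain q where q: "q \<in> Hom T Y X" "Cmp T Y X E a q = Cmp T Y E' E v b" using a_surj[OF XY(2)] cmp_in[OF ob(2,4,3) b u(2)] by (metis imageE subsetD)
  note [simp] = ob a b u(1,2) p(1) q(1) cmp_in id_in
  have "Cmp T X X E a (Cmp T X Y X q p) = Cmp T X Y E (Cmp T Y X E a q) p" by (simp add: cmp_assoc)
  also have "\<dots> = Cmp T X E' E v (Cmp T X Y E' b p)" unfolding q(2) by (rule cmp_assoc) auto
  also have "\<dots> = Cmp T X E E (Cmp T E E' E v u) a" unfolding p(2) by (rule cmp_assoc[symmetric]) auto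
  also have "\<dots> = Cmp T X X E a (Idn T X)" unfolding u(3) by (simp add: id_left id_right)
  finally have "Cmp T X X E a (Cmp T X Y X q p) = Cmp T X X E a (Idn T X)" .
  from inj_onD[OF a_inj[OF XY(1)] this cmp_in[OF ob(1,2,1) p(1) q(1)] id_in[OF ob(1)]] have 1: "Cmp T X Y X q p = Idn T X" .
  have "Cmp T Y Y E' b (Cmp T Y X Y p q) = Cmp T Y X E' (Cmp T X Y E' b p) q" by (simp add: cmp_assoc)
  also have "\<dots> = Cmp T Y E E' u (Cmp T Y X E a q)" unfolding p(2) by (rule cmp_assoc) auto
  also have "\<dots> = Cmp T Y E' E' (Cmp T E' E E' u v) b" unfolding q(2) by (rule cmp_assoc[symmetric]) auto
  also have "\<dots> = Cmp T Y Y E' b (Idn T Y)" unfolding u(4) by (simp add: id_left id_right)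
  finally have "Cmp T Y Y E' b (Cmp T Y X Y p q) = Cmp T Y Y E' b (Idn T Y)" .
  from inj_onD[OF b_inj[OF XY(2)] this cmp_in[OF ob(2,1,2) q(1) p(1)] id_in[OF ob(2)]] have 2: "Cmp T Y X Y p q = Idn T Y" .
  show ?thesis using isoI[OF p(1) q(1) 1 2] by (simp add: X_def Y_def)
qed

end

end

lemma Im_phase: "Im (of_real m * exp (\<i> * of_real (pi * \<psi>)) * exp (- \<i> * of_real (pi * \<phi>))) = m * sin (pi * (\<psi> - \<phi>))"
proof -
  have "exp (\<i> * of_real (pi * \<psi>)) * exp (- \<i> * of_real (pi * \<phi>)) = exp (\<i> * of_real (pi * (\<psi> - \<phi>)))"
    by (simp add: exp_add[symmetric] algebra_simps)
  then show ?thesis by (simp add: mult.assoc Im_exp)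
qed

text \<open>
  After a rotation by \<open>- \<phi>\<close> all summands lie in the closed lower half plane, so that the sum does as well, and it is
  real only if all of them are.
\<close>

lemma phase_sum:
  fixes z :: "nat \<Rightarrow> complex"
  assumes z: "\<And>i. i < n \<Longrightarrow> \<exists>m>0. z i = of_real m * exp (\<i> * of_real (pi * \<psi> i))"
    and \<psi>: "\<And>i. i < n \<Longrightarrow> 0 < \<psi> i" "\<And>i. i < n \<Longrightarrow> \<psi> i \<le> \<phi>" and \<phi>: "0 < \<phi>" "\<phi> \<le> 1"
    and s: "(\<Sum>i<n. z i) = of_real m * exp (\<i> * of_real (pi * \<theta>))" and m: "m > 0" and \<theta>: "\<theta> \<le> 1"
  shows "\<theta> \<le> \<phi>" and "\<theta> = \<phi> \<Longrightarrow> i < n \<Longrightarrow> \<psi> i = \<phi>"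
proof -
  from z obtain r where r: "\<And>i. i < n \<Longrightarrow> r i > 0 \<and> z i = of_real (r i) * exp (\<i> * of_real (pi * \<psi> i))" by metis
  have "m * sin (pi * (\<theta> - \<phi>)) = Im ((\<Sum>i<n. z i) * exp (- \<i> * of_real (pi * \<phi>)))"
    unfolding s Im_phase ..
  also have "\<dots> = (\<Sum>i<n. r i * sin (pi * (\<psi> i - \<phi>)))"
    unfolding sum_distrib_right Im_sum using r Im_phase by (intro sum.cong) auto
  finally have e: "m * sin (pi * (\<theta> - \<phi>)) = (\<Sum>i<n. r i * sin (pi * (\<psi> i - \<phi>)))" .
  have neg: "sin (pi * (\<psi> i - \<phi>)) \<le> 0" "\<psi> i < \<phi> \<Longrightarrow> sin (pi * (\<psi> i - \<phi>)) < 0" if i: "i < n" for i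
  proof -
    have s: "sin (pi * (\<psi> i - \<phi>)) = - sin (pi * (\<phi> - \<psi> i))" by (metis minus_diff_eq mult_minus_right sin_minus)
    have b: "0 \<le> pi * (\<phi> - \<psi> i)" "pi * (\<phi> - \<psi> i) < pi" using \<psi>[OF i] \<phi> by auto
    then show "sin (pi * (\<psi> i - \<phi>)) \<le> 0" unfolding s using sin_ge_zero[of "pi * (\<phi> - \<psi> i)"] by simp
    show "\<psi> i < \<phi> \<Longrightarrow> sin (pi * (\<psi> i - \<phi>)) < 0" unfolding s using b sin_gt_zero[of "pi * (\<phi> - \<psi> i)"] by simp
  qed
  have le: "r i * sin (pi * (\<psi> i - \<phi>)) \<le> 0" if "i < n" for i using neg(1)[OF that] r[OF that] by (simp add: mult_nonneg_nonpos)
  have "sin (pi * (\<theta> - \<phi>)) \<le> 0"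
    using sum_nonpos[of "{..<n}" "\<lambda>i. r i * sin (pi * (\<psi> i - \<phi>))"] le m unfolding e[symmetric] by (simp add: mult_le_0_iff)
  moreover have "sin (pi * (\<theta> - \<phi>)) > 0" if "\<phi> < \<theta>"
    using that \<theta> \<phi> by (intro sin_gt_zero) auto
  ultimately show "\<theta> \<le> \<phi>" by (meson not_less)
  show "\<psi> i = \<phi>" if "\<theta> = \<phi>" and i: "i < n"
  proof (rule ccontr)
    assume "\<psi> i \<noteq> \<phi>"
    then have "r i * sin (pi * (\<psi> i - \<phi>)) < 0" using \<psi>[OF i] neg(2)[OF i] r[OF i] by (simp add: mult_pos_neg)
    then have "(\<Sum>i<n. r i * sin (pi * (\<psi> i - \<phi>))) < (\<Sum>i<n. 0)" using le i by (intro sum_strict_mono_ex1) auto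
    then show False unfolding e[symmetric] using that by simp
  qed
qed

context tri_category begin

text \<open>
  The uniqueness of the slicing with given heart and central charge, on the phases of the heart.  The subobjects
  in the abelian category of the heart do not appear: injectivity on \<open>Hom(W, \<cdot>)\<close> takes their place, which spares the
  octahedral axiom.
\<close>

lemma semistable_unique:
  assumes P: "weak_slicing P" and P': "weak_slicing P'" and Z: "central_charge T Z" and pP: "phases Z P" and pP': "phases Z P'"
    and heart: "heart T P = heart T P'" and \<phi>: "0 < \<phi>" "\<phi> \<le> 1" and E: "E \<in> P \<phi>"
  shows "E \<in> P' \<phi>"
proof (cases "zero_obj T E")
  case True
  then show ?thesis by (rule P_zero[OF P'])
next
  case nz: False
  have Eo: "E \<in> Ob T" by (rule P_ob[OF P E])
  have "E \<in> heart T P'" using semistable_in_heart[OF P E \<phi> nz] heart by simp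
  then obtain n \<chi> where H: "hn_filtration T P' E n \<chi>" and \<chi>: "\<And>i. i < n \<Longrightarrow> 0 < \<chi> i \<and> \<chi> i \<le> 1" unfolding heart_def by blast
  from P' H nz obtain G A a where n: "0 < n" and F: "filt G A n" "G n = E" and A: "\<And>i. i < n \<Longrightarrow> A i \<in> P' (\<chi> i)" "\<And>i. i < n \<Longrightarrow> \<not> zero_obj T (A i)"
    and G: "G 1 \<in> P' (\<chi> 0)" "\<not> zero_obj T (G 1)" and le: "\<And>i. i < n \<Longrightarrow> \<chi> i \<le> \<chi> 0" "\<And>i. 0 < i \<Longrightarrow> i < n \<Longrightarrow> \<chi> i < \<chi> 0" and a: "a \<in> Hom T (G 1) E"
    and inj: "\<And>W. W \<in> Ob T \<Longrightarrow> (\<And>i. i < n \<Longrightarrow> hom_zero T (Sh T W) (A i)) \<Longrightarrow> inj_on (Cmp T W (G 1) E a) (Hom T W (G 1))"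
    by (rule hn_first) blast
  define X where "X = G 1"
  have X: "X \<in> P' (\<chi> 0)" "\<not> zero_obj T X" "X \<in> Ob T" using G P_ob[OF P'] by (auto simp: X_def)
  have "X \<in> heart T P'" using semistable_in_heart[OF P' X(1)] \<chi>[OF n] X(2) by simp
  then have "X \<in> heart T P" using heart by simp
  then obtain m \<psi> where H': "hn_filtration T P X m \<psi>" and \<psi>: "\<And>i. i < m \<Longrightarrow> 0 < \<psi> i \<and> \<psi> i \<le> 1" unfolding heart_def by blast
  from P H' X(2) obtain K B b where m: "0 < m" and F': "filt K B m" "K m = X" and B: "\<And>i. i < m \<Longrightarrow> B i \<in> P (\<psi> i)" "\<And>i. i < m \<Longrightarrow> \<not> zero_obj T (B i)"
    and K: "K 1 \<in> P (\<psi> 0)" "\<not> zero_obj T (K 1)" and le': "\<And>i. i < m \<Longrightarrow> \<psi> i \<le> \<psi> 0" and b: "b \<in> Hom T (K 1) X"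
    and inj': "\<And>W. W \<in> Ob T \<Longrightarrow> (\<And>i. i < m \<Longrightarrow> hom_zero T (Sh T W) (B i)) \<Longrightarrow> inj_on (Cmp T W (K 1) X b) (Hom T W (K 1))"
    by (rule hn_first) blast
  define W where "W = K 1"
  have W: "W \<in> P (\<psi> 0)" "\<not> zero_obj T W" "W \<in> Ob T" using K P_ob[OF P] by (auto simp: W_def)
  have "W \<in> heart T P'" using semistable_in_heart[OF P W(1)] \<psi>[OF m] W(2) heart by simp
  \<comment> \<open>the filtrations of \<open>E\<close> for \<open>P'\<close> (phases \<open>\<chi>\<close>) and of its first step \<open>X\<close> for \<open>P\<close> (phases \<open>\<psi>\<close>) are now in place\<close>
  have lt': "\<psi> i < \<psi> 0 + 1" if "i < m" for i using le'[OF that] by linarith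
  \<comment> \<open>otherwise the destabilizing subobject of the first step maps to zero in \<open>E\<close>\<close>
  have "\<psi> 0 \<le> \<phi>"
  proof (rule ccontr)
    assume "\<not> \<psi> 0 \<le> \<phi>"
    then have hz: "hom_zero T W E" using P_hom[OF P _ W(1) E] by simp
    have ab: "Cmp T W X E a b \<in> Hom T W E" using cmp_in[OF W(3) X(3) Eo] a b by (simp add: X_def W_def)
    have inj_a: "inj_on (Cmp T W X E a) (Hom T W X)" unfolding X_def
      by (rule inj[OF W(3) hom_zero_Sh_heart[OF P' \<open>W \<in> heart T P'\<close> A(1)]]) (use \<chi> in blast)+
    have inj_b: "inj_on (Cmp T W W X b) (Hom T W W)"
      using inj'[OF W(3) hom_zero_Sh[OF P W(1) B(1) lt']] unfolding W_def by simp
    have ab_eq: "Cmp T W W E (Cmp T W X E a b) y = Cmp T W X E a (Cmp T W W X b y)" "Cmp T W W X b y \<in> Hom T W X"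
      if "y \<in> Hom T W W" for y
      using cmp_assoc[OF W(3) W(3) X(3) Eo that, of b a] cmp_in[OF W(3) W(3) X(3) that, of b] a b by (simp_all add: X_def W_def)
    have "inj_on (Cmp T W W E (Cmp T W X E a b)) (Hom T W W)"
      by (rule inj_onI) (use ab_eq inj_onD[OF inj_a] inj_onD[OF inj_b] in metis)
    then show False by (rule endo_nonzero[OF P W(3,2) Eo ab hz])
  qed
  have \<psi>\<phi>: "\<psi> i \<le> \<phi>" if "i < m" for i using le'[OF that] \<open>\<psi> 0 \<le> \<phi>\<close> by simp
  from pP' X(1,2) obtain r where r: "r > 0" "Z X = of_real r * exp (\<i> * of_real (pi * \<chi> 0))" unfolding phases_def by blast
  have ZX: "(\<Sum>i<m. Z (B i)) = of_real r * exp (\<i> * of_real (pi * \<chi> 0))" using charge_filt[OF Z F'(1)] F'(2) r(2) by simp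
  have "\<chi> 0 \<le> \<phi>"
    by (rule phase_sum(1)[OF _ _ \<psi>\<phi> \<phi> ZX r(1)]) (use B pP \<psi> \<chi>[OF n] in \<open>auto simp: phases_def\<close>)
  then have \<chi>\<phi>: "\<chi> i \<le> \<phi>" if "i < n" for i using le(1)[OF that] by simp
  from pP E nz obtain r' where r': "r' > 0" "Z E = of_real r' * exp (\<i> * of_real (pi * \<phi>))" unfolding phases_def by blast
  have ZE: "(\<Sum>i<n. Z (A i)) = of_real r' * exp (\<i> * of_real (pi * \<phi>))" using charge_filt[OF Z F(1)] F(2) r'(2) by simp
  have all: "\<chi> i = \<phi>" if "i < n" for i
    by (rule phase_sum(2)[OF _ _ \<chi>\<phi> \<phi> ZE r'(1) \<phi>(2) refl that]) (use A pP' \<chi> in \<open>auto simp: phases_def\<close>)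
  have "n = 1"
  proof (rule ccontr)
    assume "n \<noteq> 1"
    then have "1 < n" using n by simp
    then show False using le(2)[of 1] all[of 1] all[OF n] by simp
  qed
  then show "E \<in> P' \<phi>" using G(1) F(2) all[OF n] by simp
qed

text \<open>
  The shift moves every phase to \<open>(0, 1]\<close>, and \<open>P (\<phi> + 1)\<close> and \<open>P \<phi>\<close> determine one another.
\<close>

lemma weak_slicing_eqI:
  assumes P: "weak_slicing P" and P': "weak_slicing P'" and eq: "\<And>\<phi>. 0 < \<phi> \<Longrightarrow> \<phi> \<le> 1 \<Longrightarrow> P \<phi> = P' \<phi>"
  shows "P = P'"
proof
  fix \<phi> :: real
  have down: "P x = P' x" if "P (x + 1) = P' (x + 1)" for x
    using P_Sh_iff[OF P, of _ x] P_Sh_iff[OF P', of _ x] that P_ob[OF P, of _ x] P_ob[OF P', of _ x] by blast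
  have up: "P (x + 1) = P' (x + 1)" if "P x = P' x" for x
    unfolding P_shift[OF P] P_shift[OF P'] that ..
  \<comment> \<open>\<open>\<lceil>\<phi>\<rceil> - 1\<close> and not \<open>\<lfloor>\<phi>\<rfloor>\<close>, as the phases of the heart are those in \<open>(0, 1]\<close>\<close>
  define k where "k = \<lceil>\<phi>\<rceil> - 1"
  define \<psi> where "\<psi> = \<phi> - of_int k"
  have \<psi>: "0 < \<psi>" "\<psi> \<le> 1" unfolding \<psi>_def k_def by linarith+
  have "P (\<psi> + of_int k) = P' (\<psi> + of_int k)"
  proof (induction k rule: int_induct[where k=0])
    case base
    then show ?case using eq[OF \<psi>] by simp
  next
    case (step1 i)
    then show ?case using up[of "\<psi> + of_int i"] by (simp add: add.assoc)
  next
    case (step2 i)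
    then show ?case using down[of "\<psi> + of_int (i - 1)"] by (simp add: add.assoc)
  qed
  then show "P \<phi> = P' \<phi>" by (simp add: \<psi>_def)
qed

end

section \<open>Stability conditions invariant under an automorphism\<close>

text \<open>
  Strictness is what makes the image of a filtration a filtration again, with the images of the terms as its terms.
\<close>

locale tri_automorphism = tri_category T for T :: "('o, 'm) tricat" +
  fixes F :: "('o, 'm) endofunctor"
  assumes F_ob: "bij_betw (fob F) (Ob T) (Ob T)"
    and F_hom: "X \<in> Ob T \<Longrightarrow> Y \<in> Ob T \<Longrightarrow> bij_betw (fmor F X Y) (Hom T X Y) (Hom T (fob F X) (fob F Y))"
    and F_id: "X \<in> Ob T \<Longrightarrow> fmor F X X (Idn T X) = Idn T (fob F X)"
    and F_cmp: "X \<in> Ob T \<Longrightarrow> Y \<in> Ob T \<Longrightarrow> Z \<in> Ob T \<Longrightarrow> f \<in> Hom T X Y \<Longrightarrow> g \<in> Hom T Y Z \<Longrightarrow>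
      fmor F X Z (Cmp T X Y Z g f) = Cmp T (fob F X) (fob F Y) (fob F Z) (fmor F Y Z g) (fmor F X Y f)"
    and F_sh: "fob F (Sh T X) = Sh T (fob F X)"
    and F_shm: "X \<in> Ob T \<Longrightarrow> Y \<in> Ob T \<Longrightarrow> f \<in> Hom T X Y \<Longrightarrow>
      fmor F (Sh T X) (Sh T Y) (ShM T X Y f) = ShM T (fob F X) (fob F Y) (fmor F X Y f)"
    and shm_in: "X \<in> Ob T \<Longrightarrow> Y \<in> Ob T \<Longrightarrow> f \<in> Hom T X Y \<Longrightarrow> ShM T X Y f \<in> Hom T (Sh T X) (Sh T Y)"
    and tri_third: "(X, Y, Z, f, g, h) \<in> Tri T \<Longrightarrow> h \<in> Hom T Z (Sh T X)"
    and F_tri: "(X, Y, Z, f, g, h) \<in> Tri T \<Longrightarrow>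
      (fob F X, fob F Y, fob F Z, fmor F X Y f, fmor F Y Z g, fmor F Z (Sh T X) h) \<in> Tri T"
    and F_tri_reflect: "(fob F X, fob F Y, fob F Z, f, g, h) \<in> Tri T \<Longrightarrow> X \<in> Ob T \<Longrightarrow> Y \<in> Ob T \<Longrightarrow> Z \<in> Ob T \<Longrightarrow>
      \<exists>f g h. (X, Y, Z, f, g, h) \<in> Tri T"
begin

lemma F_in: "X \<in> Ob T \<Longrightarrow> fob F X \<in> Ob T"
  using F_ob by (auto simp: bij_betw_def)

lemma F_surj: "X \<in> Ob T \<Longrightarrow> \<exists>Y\<in>Ob T. fob F Y = X"
  using F_ob unfolding bij_betw_def by (metis imageE)

lemma fmor_in: "X \<in> Ob T \<Longrightarrow> Y \<in> Ob T \<Longrightarrow> f \<in> Hom T X Y \<Longrightarrow> fmor F X Y f \<in> Hom T (fob F X) (fob F Y)"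
  using F_hom by (auto simp: bij_betw_def)

lemma hom_zero_F: "X \<in> Ob T \<Longrightarrow> Y \<in> Ob T \<Longrightarrow> hom_zero T (fob F X) (fob F Y) \<longleftrightarrow> hom_zero T X Y"
  by (rule hom_zero_image[OF F_hom])

lemma zero_F: assumes "X \<in> Ob T" shows "zero_obj T (fob F X) \<longleftrightarrow> zero_obj T X"
  using hom_zero_F[OF assms assms] zero_endo[OF assms] zero_endo[OF F_in[OF assms]] zero_objD assms F_in[OF assms] by blast

lemma iso_F: "X \<in> Ob T \<Longrightarrow> Y \<in> Ob T \<Longrightarrow> iso_obj T (fob F X) (fob F Y) \<longleftrightarrow> iso_obj T X Y"
  by (rule iso_obj_image[of "fmor F" "fob F", OF F_hom F_id F_cmp])

lemma filt_F: assumes "\<And>i. G i \<in> Ob T" "\<And>i. A i \<in> Ob T"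
  shows "filt (\<lambda>i. fob F (G i)) (\<lambda>i. fob F (A i)) n \<longleftrightarrow> filt G A n"
  unfolding filt_def using assms F_tri F_tri_reflect by (metis zero_F)

lemma filt_F': assumes "filt G A n" shows "filt (\<lambda>i. fob F (G i)) (\<lambda>i. fob F (A i)) n"
  using assms F_tri unfolding filt_def by (metis zero_F zero_objD(1))

abbreviation FP :: "(real \<Rightarrow> 'o set) \<Rightarrow> real \<Rightarrow> 'o set" where
  "FP P \<equiv> \<lambda>\<phi>. ess_image T (fob F) (P \<phi>)"

lemma in_FP: assumes P: "weak_slicing P" and X: "X \<in> Ob T" shows "fob F X \<in> FP P \<phi> \<longleftrightarrow> X \<in> P \<phi>"
  unfolding ess_image_def using P_ob[OF P] P_iso[OF P] X iso_F F_in iso_refl by blast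

lemma hn_F: assumes P: "weak_slicing P" and H: "hn_filtration T P E n \<phi>" shows "hn_filtration T (FP P) (fob F E) n \<phi>"
proof -
  from H obtain G A where dec: "\<forall>i j. i < j \<and> j < n \<longrightarrow> \<phi> j < \<phi> i" and F: "filt G A n" "G n = E" and A: "\<forall>i<n. A i \<in> P (\<phi> i) \<and> \<not> zero_obj T (A i)"
    unfolding hn_filtration_iff by blast
  show ?thesis unfolding hn_filtration_iff
    by (intro conjI exI[of _ "\<lambda>i. fob F (G i)"] exI[of _ "\<lambda>i. fob F (A i)"])
      (use dec F A filt_F'[OF F(1)] filt_ob(2)[OF F(1)] in \<open>auto simp: in_FP[OF P] zero_F\<close>)
qed

text \<open>
  To go back from a filtration for \<open>F P\<close> to one for \<open>P\<close>, choose preimages of all its terms.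
\<close>

lemma heart_F: assumes P: "weak_slicing P" shows "heart T (FP P) = ess_image T (fob F) (heart T P)"
proof (intro equalityI subsetI)
  fix X assume "X \<in> heart T (FP P)"
  then obtain n \<phi> where X: "X \<in> Ob T" and H: "hn_filtration T (FP P) X n \<phi>" and \<phi>: "\<forall>i<n. 0 < \<phi> i \<and> \<phi> i \<le> 1" unfolding heart_def by blast
  from H obtain G A where dec: "\<forall>i j. i < j \<and> j < n \<longrightarrow> \<phi> j < \<phi> i" and F: "filt G A n" "G n = X" and A: "\<forall>i<n. A i \<in> FP P (\<phi> i) \<and> \<not> zero_obj T (A i)"
    unfolding hn_filtration_iff by blast
  \<comment> \<open>any value in \<open>Ob T\<close> will do outside the range of the filtration, where \<open>G\<close> and \<open>A\<close> are arbitrary\<close>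
  define r where "r Y = (SOME Y0. Y0 \<in> Ob T \<and> (Y \<in> Ob T \<longrightarrow> fob F Y0 = Y))" for Y
  have r: "r Y \<in> Ob T \<and> (Y \<in> Ob T \<longrightarrow> fob F (r Y) = Y)" for Y
    unfolding r_def by (rule someI_ex) (use F_surj[of Y] X in blast)
  have eq: "filt (\<lambda>i. fob F (r (G i))) (\<lambda>i. fob F (r (A i))) n \<longleftrightarrow> filt G A n"
    unfolding filt_def
  proof (intro conj_cong all_cong1 imp_cong refl)
    show "zero_obj T (fob F (r (G 0))) = zero_obj T (G 0)" using r filt_ob(1)[OF F(1), of 0] by auto
    fix i assume "i < n"
    then show "(\<exists>f g h. (fob F (r (G i)), fob F (r (G (Suc i))), fob F (r (A i)), f, g, h) \<in> Tri T) = (\<exists>f g h. (G i, G (Suc i), A i, f, g, h) \<in> Tri T)"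
      using r filt_ob[OF F(1)] by simp
  qed
  have F': "filt (\<lambda>i. r (G i)) (\<lambda>i. r (A i)) n"
    using F(1) filt_F[OF conjunct1[OF r] conjunct1[OF r], of G A n] unfolding eq by simp
  have A': "A i \<in> Ob T" if "i < n" for i by (rule filt_ob(2)[OF F(1) that])
  have "\<forall>i<n. r (A i) \<in> P (\<phi> i) \<and> \<not> zero_obj T (r (A i))"
    using A A' r by (metis in_FP[OF P] zero_F)
  then have "hn_filtration T P (r X) n \<phi>" unfolding hn_filtration_iff
    by (intro conjI exI[of _ "\<lambda>i. r (G i)"] exI[of _ "\<lambda>i. r (A i)"]) (use dec F F' in auto)
  then have "r X \<in> heart T P" unfolding heart_def using r \<phi> by blast
  then show "X \<in> ess_image T (fob F) (heart T P)" unfolding ess_image_def using r X iso_refl by (intro CollectI conjI bexI[of _ "r X"]) auto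
next
  fix X assume "X \<in> ess_image T (fob F) (heart T P)"
  then obtain Y n \<phi> where X: "X \<in> Ob T" and Y: "Y \<in> Ob T" "iso_obj T (fob F Y) X" and H: "hn_filtration T P Y n \<phi>" and \<phi>: "\<forall>i<n. 0 < \<phi> i \<and> \<phi> i \<le> 1"
    unfolding ess_image_def heart_def by blast
  from hn_F[OF P H] obtain G A where dec: "\<forall>i j. i < j \<and> j < n \<longrightarrow> \<phi> j < \<phi> i" and F: "filt G A n" "G n = fob F Y" and A: "\<forall>i<n. A i \<in> FP P (\<phi> i) \<and> \<not> zero_obj T (A i)"
    unfolding hn_filtration_iff by blast
  \<comment> \<open>replace the last term by the isomorphic object \<open>X\<close>\<close>
  have "filt (G(n := X)) A n"
  proof (cases n)
    case 0
    then show ?thesis using F X Y zero_obj_iso by (simp add: filt_def)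
  next
    case (Suc m)
    from F(1)[unfolded Suc] obtain f g h where F': "filt G A m" "(G m, G (Suc m), A m, f, g, h) \<in> Tri T" by (rule filt_SucE)
    have "\<exists>f g h. (G m, X, A m, f, g, h) \<in> Tri T" using tri_iso[OF F'(2) X] Y(2) F(2) Suc by simp
    with F' show ?thesis unfolding filt_def Suc by (auto simp: less_Suc_eq)
  qed
  then have "hn_filtration T (FP P) X n \<phi>" unfolding hn_filtration_iff
    by (intro conjI exI[of _ "G(n := X)"] exI[of _ A]) (use dec A in auto)
  then show "X \<in> heart T (FP P)" unfolding heart_def using X \<phi> by blast
qed

lemma weak_slicing_F: assumes P: "weak_slicing P" shows "weak_slicing (FP P)"
  unfolding weak_slicing_def
proof (intro conjI allI ballI impI)
  fix \<phi> \<psi> :: real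
  show "FP P \<phi> \<subseteq> Ob T" by (auto simp: ess_image_def)
  show "Y \<in> FP P \<phi>" if "X \<in> FP P \<phi>" "Y \<in> Ob T" "iso_obj T X Y" for X Y
    using that iso_trans F_in P_ob[OF P] unfolding ess_image_def by blast
  show "X \<in> FP P \<phi>" if z: "zero_obj T X" for X
  proof -
    obtain X0 where X0: "X0 \<in> Ob T" "fob F X0 = X" using F_surj zero_objD(1)[OF z] by blast
    then show ?thesis using in_FP[OF P X0(1)] P_zero[OF P] zero_F[OF X0(1)] z by simp
  qed
  show "FP P (\<phi> + 1) = ess_image T (Sh T) (FP P \<phi>)"
  proof (intro equalityI subsetI)
    fix X assume "X \<in> FP P (\<phi> + 1)"
    then obtain Y Y0 where X: "X \<in> Ob T" and Y: "Y \<in> Ob T" "iso_obj T (fob F Y) X" and Y0: "Y0 \<in> P \<phi>" "iso_obj T (Sh T Y0) Y"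
      unfolding ess_image_def P_shift[OF P] by blast
    have o: "Y0 \<in> Ob T" "Sh T Y0 \<in> Ob T" "fob F Y0 \<in> Ob T" "fob F Y \<in> Ob T" using P_ob[OF P Y0(1)] sh_ob F_in Y by auto
    have "iso_obj T (Sh T (fob F Y0)) (fob F Y)" using iso_F[OF o(2) Y(1)] Y0(2) by (simp add: F_sh)
    then have "iso_obj T (Sh T (fob F Y0)) X" using Y(2) iso_trans o X sh_ob by blast
    then show "X \<in> ess_image T (Sh T) (FP P \<phi>)" using in_FP[OF P o(1)] Y0(1) X unfolding ess_image_def[of T "Sh T"] by blast
  next
    fix X assume "X \<in> ess_image T (Sh T) (FP P \<phi>)"
    then obtain W Y0 where X: "X \<in> Ob T" and W: "W \<in> Ob T" "iso_obj T (Sh T W) X" and Y0: "Y0 \<in> P \<phi>" "iso_obj T (fob F Y0) W"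
      unfolding ess_image_def by blast
    have o: "Y0 \<in> Ob T" "Sh T Y0 \<in> Ob T" "fob F Y0 \<in> Ob T" "Sh T W \<in> Ob T" using P_ob[OF P Y0(1)] sh_ob F_in W by auto
    have "iso_obj T (fob F (Sh T Y0)) (Sh T W)" using sh_iso[OF o(3) W(1)] Y0(2) by (simp add: F_sh)
    then have "iso_obj T (fob F (Sh T Y0)) X" using W(2) iso_trans o X F_in by blast
    then show "X \<in> FP P (\<phi> + 1)" using P_Sh[OF P Y0(1)] X unfolding ess_image_def by blast
  qed
  show "hom_zero T A B" if "\<psi> < \<phi>" "A \<in> FP P \<phi>" "B \<in> FP P \<psi>" for A B
  proof -
    from that obtain A0 B0 where A: "A \<in> Ob T" "A0 \<in> P \<phi>" "iso_obj T (fob F A0) A" and B: "B \<in> Ob T" "B0 \<in> P \<psi>" "iso_obj T (fob F B0) B"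
      unfolding ess_image_def by blast
    have o: "A0 \<in> Ob T" "B0 \<in> Ob T" using P_ob[OF P] A B by auto
    have "hom_zero T (fob F A0) (fob F B0)" using P_hom[OF P that(1) A(2) B(2)] hom_zero_F[OF o] by simp
    then show ?thesis using hom_zero_iso_source[OF hom_zero_iso_target] A B o F_in by blast
  qed
  fix E assume E: "E \<in> Ob T"
  then obtain E0 where "E0 \<in> Ob T" "fob F E0 = E" using F_surj by blast
  then show "\<exists>n \<phi>. hn_filtration T (FP P) E n \<phi>" using P_hn[OF P] hn_F[OF P] by blast
qed

lemma phases_F:
  assumes P: "weak_slicing P" and Z: "central_charge T Z" and p: "phases Z P" and ZF: "\<forall>M\<in>Ob T. Z (fob F M) = Z M"
  shows "phases Z (FP P)"
  unfolding phases_def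
proof (intro allI ballI impI)
  fix \<phi> E assume "E \<in> FP P \<phi>" and nz: "\<not> zero_obj T E"
  then obtain E0 where E: "E \<in> Ob T" "E0 \<in> P \<phi>" "iso_obj T (fob F E0) E" unfolding ess_image_def by blast
  have o: "E0 \<in> Ob T" using P_ob[OF P E(2)] .
  have "Z E = Z E0" using charge_iso[OF Z E(3) F_in[OF o] E(1)] ZF o by simp
  moreover have "\<not> zero_obj T E0" using nz zero_obj_iso[OF _ E(3,1)] zero_F[OF o] by blast
  ultimately show "\<exists>m>0. Z E = of_real m * exp (\<i> * of_real (pi * \<phi>))" using p E(2) unfolding phases_def by auto
qed

lemma auto_equivalence_F: "auto_equivalence T F"
  unfolding auto_equivalence_def
proof (intro conjI)
  show "is_functor T F" unfolding is_functor_def using F_in F_id fmor_in F_cmp by blast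
  show "\<forall>X\<in>Ob T. \<forall>Y\<in>Ob T. bij_betw (fmor F X Y) (Hom T X Y) (Hom T (fob F X) (fob F Y))" using F_hom by blast
  show "\<forall>Y\<in>Ob T. \<exists>X\<in>Ob T. iso_obj T (fob F X) Y" using F_surj iso_refl by metis
  have i: "is_iso T X X (Idn T X)" if "X \<in> Ob T" for X using that id_in id_left by (auto simp: is_iso_def)
  show "is_triangulated T F" unfolding is_triangulated_def
  proof (intro exI[of _ "\<lambda>X. Idn T (Sh T (fob F X))"] conjI ballI allI impI)
    fix X assume X: "X \<in> Ob T"
    then show "is_iso T (fob F (Sh T X)) (Sh T (fob F X)) (Idn T (Sh T (fob F X)))" using i F_sh F_in sh_ob by simp
    fix Y f assume Y: "Y \<in> Ob T" and f: "f \<in> Hom T X Y"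
    have "fmor F (Sh T X) (Sh T Y) (ShM T X Y f) \<in> Hom T (Sh T (fob F X)) (Sh T (fob F Y))"
      using fmor_in[OF sh_ob[OF X] sh_ob[OF Y] shm_in[OF X Y f]] by (simp add: F_sh)
    then show "Cmp T (fob F (Sh T X)) (fob F (Sh T Y)) (Sh T (fob F Y)) (Idn T (Sh T (fob F Y))) (fmor F (Sh T X) (Sh T Y) (ShM T X Y f)) =
      Cmp T (fob F (Sh T X)) (Sh T (fob F X)) (Sh T (fob F Y)) (ShM T (fob F X) (fob F Y) (fmor F X Y f)) (Idn T (Sh T (fob F X)))"
      using X Y f F_in sh_ob by (simp add: F_sh id_left id_right F_shm)
  next
    fix X Y Z f g h assume t: "(X, Y, Z, f, g, h) \<in> Tri T"
    have o: "X \<in> Ob T" "Z \<in> Ob T" using tri_in[OF t] by auto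
    have "fmor F Z (Sh T X) h \<in> Hom T (fob F Z) (Sh T (fob F X))"
      using fmor_in[OF o(2) sh_ob[OF o(1)] tri_third[OF t]] by (simp add: F_sh)
    then show "(fob F X, fob F Y, fob F Z, fmor F X Y f, fmor F Y Z g,
        Cmp T (fob F Z) (fob F (Sh T X)) (Sh T (fob F X)) (Idn T (Sh T (fob F X))) (fmor F Z (Sh T X) h)) \<in> Tri T"
      using F_tri[OF t] o F_in sh_ob by (simp add: F_sh id_left)
  qed
qed

lemma some_preimage:
  assumes X: "X \<in> Ob T"
  defines "Y \<equiv> SOME Y. Y \<in> Ob T \<and> iso_obj T (fob F Y) X"
  shows "Y \<in> Ob T" "iso_obj T (fob F Y) X"
proof -
  have "\<exists>Y. Y \<in> Ob T \<and> iso_obj T (fob F Y) X" using F_surj[OF X] iso_refl[OF X] by auto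
  from someI_ex[OF this] show "Y \<in> Ob T" "iso_obj T (fob F Y) X" unfolding Y_def by auto
qed

lemma FStab_imp_gepner: assumes "\<sigma> \<in> FStab T F" shows "gepner_type T F 0 \<sigma>"
proof -
  obtain Z P where \<sigma>: "\<sigma> = (Z, P)" by (cases \<sigma>)
  have S: "(Z, P) \<in> Stab T" and heart: "ess_image T (fob F) (heart T P) = heart T P" and ZF: "\<forall>M\<in>Ob T. Z (fob F M) = Z M"
    using assms unfolding FStab_def \<sigma> by auto
  have Z: "central_charge T Z" and P: "weak_slicing P" and p: "phases Z P"
    using S slicing_weak unfolding Stab_def phases_def by auto
  note P' = weak_slicing_F[OF P] and p' = phases_F[OF P Z p ZF]
  have h: "heart T P = heart T (FP P)" unfolding heart_F[OF P] heart ..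
  have "FP P = P"
    by (rule weak_slicing_eqI[OF P' P])
      (intro equalityI subsetI, erule (2) semistable_unique[OF P' P Z p' p h[symmetric]], erule (2) semistable_unique[OF P P' Z p p' h])
  moreover have "(if X \<in> Ob T then Z (SOME Y. Y \<in> Ob T \<and> iso_obj T (fob F Y) X) else 0) = Z X" for X
  proof (cases "X \<in> Ob T")
    case True
    then show ?thesis using some_preimage[OF True] ZF charge_iso[OF Z some_preimage(2)[OF True]] F_in by simp
  next
    case False
    then show ?thesis using Z by (simp add: central_charge_def)
  qed
  ultimately show ?thesis unfolding gepner_type_def \<sigma> using S auto_equivalence_F
    by (simp add: functor_action_def scalar_action_def)
qed

text \<open>
  Compare the Harder--Narasimhan filtrations of \<open>M\<close> and \<open>F M\<close>.  The largest phases give \<open>Re s = 0\<close>, and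
  the central charges of the first steps give \<open>Im s = 0\<close>.
\<close>

lemma gepner_imp_FStab:
  assumes g: "gepner_type T F s \<sigma>" and M: "M \<in> Ob T" "\<not> zero_obj T M" "iso_obj T (fob F M) M"
  shows "\<sigma> \<in> FStab T F"
proof -
  obtain Z P where \<sigma>: "\<sigma> = (Z, P)" by (cases \<sigma>)
  have S: "(Z, P) \<in> Stab T" and a: "functor_action T F (Z, P) = scalar_action s (Z, P)"
    using g unfolding gepner_type_def \<sigma> by auto
  have Z: "central_charge T Z" and P: "weak_slicing P" and p: "phases Z P"
    using S slicing_weak unfolding Stab_def phases_def by auto
  have FPs: "FP P \<phi> = P (\<phi> + Re s)" for \<phi> using a unfolding functor_action_def scalar_action_def by (auto dest: fun_cong)
  have Zs: "Z (SOME Y. Y \<in> Ob T \<and> iso_obj T (fob F Y) X) = Z X * exp (- \<i> * of_real pi * s)" if "X \<in> Ob T" for X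
    using a that unfolding functor_action_def scalar_action_def by (auto dest!: fun_cong[where x=X])
  \<comment> \<open>the chosen preimage of \<open>F M'\<close> is isomorphic to \<open>M'\<close>, so the choice disappears\<close>
  have Zs': "Z M' = Z (fob F M') * exp (- \<i> * of_real pi * s)" if o: "M' \<in> Ob T" for M'
  proof -
    note y = some_preimage[OF F_in[OF o]]
    from y have "iso_obj T (SOME Y. Y \<in> Ob T \<and> iso_obj T (fob F Y) (fob F M')) M'" using iso_F[OF y(1) o] by simp
    from charge_iso[OF Z this y(1) o] Zs[OF F_in[OF o]] show ?thesis by simp
  qed
  obtain n \<phi> where H: "hn_filtration T P M n \<phi>" using P_hn[OF P M(1)] by blast
  have "hn_filtration T (\<lambda>x. P (x + Re s)) (fob F M) n \<phi>" using hn_F[OF P H] unfolding FPs .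
  then have H': "hn_filtration T P (fob F M) n (\<lambda>i. \<phi> i + Re s)" unfolding hn_filtration_def by simp
  have nzF: "\<not> zero_obj T (fob F M)" using zero_F[OF M(1)] M(2) by simp
  have Re: "Re s = 0"
    using top_phase_le[OF P H H' iso_sym[OF M(3)] M(2,1) F_in[OF M(1)]] top_phase_le[OF P H' H M(3) nzF F_in[OF M(1)] M(1)] by simp
  \<comment> \<open>from here on \<open>F\<close> preserves the slicing, and the first step of \<open>F M\<close> is the image of that of \<open>M\<close>\<close>
  then have FP: "FP P = P" using FPs by auto
  from P H M(2) obtain G A where n: "0 < n" and Fl: "filt G A n" "G n = M" and A: "\<And>i. i < n \<Longrightarrow> A i \<in> P (\<phi> i)"
    and G: "G 1 \<in> P (\<phi> 0)" "\<not> zero_obj T (G 1)" and le: "\<And>i. 0 < i \<Longrightarrow> i < n \<Longrightarrow> \<phi> i < \<phi> 0"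
    by (rule hn_first) blast
  have Go: "G 1 \<in> Ob T" by (rule P_ob[OF P G(1)])
  have A': "fob F (A i) \<in> P (\<phi> i)" if "i < n" for i
    using in_FP[OF P filt_ob(2)[OF Fl(1) that], of "\<phi> i"] A[OF that] fun_cong[OF FP] by simp
  have G': "fob F (G 1) \<in> P (\<phi> 0)" using in_FP[OF P Go, of "\<phi> 0"] G(1) fun_cong[OF FP] by simp
  have "iso_obj T (fob F (G n)) (G n)" using M(3) Fl(2) by simp
  from first_step_unique[OF P n filt_F'[OF Fl(1)] A' le G' n Fl(1) A le G(1) this]
  have "iso_obj T (fob F (G 1)) (G 1)" by simp
  then have "Z (fob F (G 1)) = Z (G 1)" using charge_iso[OF Z _ F_in[OF Go] Go] by blast
  moreover have "Z (G 1) \<noteq> 0" using p G unfolding phases_def by fastforce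
  ultimately have e: "exp (- \<i> * of_real pi * s) = 1" using Zs'[OF Go] by simp
  then have "norm (exp (- \<i> * of_real pi * s)) = 1" by simp
  then have "exp (pi * Im s) = 1" by (simp add: norm_exp_eq_Re)
  then have "Im s = 0" by simp
  have "\<forall>M\<in>Ob T. Z (fob F M) = Z M" using Zs' e by simp
  moreover have "ess_image T (fob F) (heart T P) = heart T P" unfolding heart_F[OF P, symmetric] FP ..
  ultimately show ?thesis unfolding FStab_def \<sigma> using S by simp
qed

lemma trivial_FStab:
  assumes S: "\<sigma> \<in> Stab T" and z: "\<And>X. X \<in> Ob T \<Longrightarrow> zero_obj T X"
  shows "\<sigma> \<in> FStab T F"
proof -
  obtain Z P where \<sigma>: "\<sigma> = (Z, P)" by (cases \<sigma>)
  have Z: "central_charge T Z" using S unfolding Stab_def \<sigma> by auto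
  have "X \<in> heart T P" if X: "X \<in> Ob T" for X
  proof -
    have "hn_filtration T P X 0 (\<lambda>_. 0)" unfolding hn_filtration_iff
      by (intro conjI exI[of _ "\<lambda>_. X"]) (auto simp: filt_def z[OF X])
    then show ?thesis unfolding heart_def using X by blast
  qed
  then have h: "heart T P = Ob T" by (auto simp: heart_def)
  have "ess_image T (fob F) (Ob T) = Ob T" unfolding ess_image_def using F_surj iso_refl by blast
  moreover have "\<forall>M\<in>Ob T. Z (fob F M) = Z M" using charge_zero[OF Z z] F_in by simp
  ultimately show ?thesis unfolding FStab_def \<sigma> using S h by (simp add: \<sigma>)
qed

end

section \<open>The derived category\<close>

locale derived =
  fixes Q :: "('v, 'e) pre_digraph" and T :: "(('v, 'e, 'k::field) cpx, ('v, 'e, 'k) roof set) tricat"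
  assumes fin: "finite (verts Q)" and T: "T = derived_category Q"
begin

sublocale fractions "bounded_complex Q :: ('v, 'e, 'k) cpx \<Rightarrow> bool" "chain_map Q" "homotopic Q" "quasi_iso Q" gcomp gid
  by (rule fractions_complexes[OF fin])

sublocale sh: fractions_automorphism "bounded_complex Q :: ('v, 'e, 'k) cpx \<Rightarrow> bool" "chain_map Q" "homotopic Q" "quasi_iso Q" gcomp gid
  shift_cpx shift_gmap
proof
  show "bij (shift_cpx :: ('v, 'e, 'k) cpx \<Rightarrow> _)" by (rule bijI'; metis shift_unshift_cpx)
  show "bij (shift_gmap :: 'k gmap \<Rightarrow> _)" by (rule bijI'; metis shift_unshift_gmap)
qed (auto simp: shift_gmap_gcomp chain_map_shift_iff quasi_iso_shift_iff intro: homotopic_shift homotopic_unshift)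

lemma roofs_rfs: "roofs Q X Y = rfs X Y" by (simp add: roofs_def rfs_def)
lemma roof_rel_rel: "roof_rel Q X Y = rel X Y" by (simp add: roof_rel_def rel_def roofs_rfs)
lemma map_class_arr: "map_class Q X Y f = arr X Y f" by (simp add: map_class_def cls_def roof_rel_rel)
lemma roof_comp_rcomp: "roof_comp Q X Y Z b a = rcomp X Y Z b a" by (simp add: roof_comp_def rcomp_def roof_rel_rel)

lemma T_simps [simp]: "Ob T = {C. bounded_complex Q C}" "Hom T X Y = hom X Y" "Idn T X = arr X X gid"
    "Cmp T X Y Z = rcomp X Y Z" "Sh T = shift_cpx" "ShM T X Y a = sh.rmap ` a"
  by (auto simp: T derived_category_def roof_category_def Let_def roofs_rfs roof_rel_rel map_class_arr roof_comp_rcomp sh.rmap_def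
      intro!: ext)

lemma Tri_iff: "(X, Y, Z, f, g, h) \<in> Tri T \<longleftrightarrow>
   bounded_complex Q X \<and> bounded_complex Q Y \<and> bounded_complex Q Z \<and> f \<in> hom X Y \<and> g \<in> hom Y Z \<and> h \<in> hom Z (shift_cpx X) \<and>
   (\<exists>C D u a b c. bounded_complex Q C \<and> bounded_complex Q D \<and> chain_map Q C D u \<and>
        is_iso T X C a \<and> is_iso T Y D b \<and> is_iso T Z (cone C D u) c \<and>
        rcomp X Y D b f = rcomp X C D (arr C D u) a \<and>
        rcomp Y Z (cone C D u) c g = rcomp Y D (cone C D u) (arr D (cone C D u) cone_in) b \<and>
        rcomp Z (shift_cpx X) (shift_cpx C) (sh.rmap ` a) h =
          rcomp Z (cone C D u) (shift_cpx C) (arr (cone C D u) (shift_cpx C) cone_out) c)"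
proof -
  have i: "is_iso T A B x \<longleftrightarrow> is_iso (roof_category Q) A B x" for A B x
    by (simp add: is_iso_def T derived_category_def Let_def)
  show ?thesis unfolding i
    by (simp add: T derived_category_def Let_def)
     (simp add: roof_category_def roofs_rfs roof_rel_rel map_class_arr roof_comp_rcomp sh.rmap_def)
qed

sublocale cat: plain_category T
  by unfold_locales (auto simp: arr_in_hom chain_map_id rcomp_in_hom rcomp_id_left rcomp_id_right rcomp_assoc)

lemma qis_is_iso: "bounded_complex Q X \<Longrightarrow> bounded_complex Q Y \<Longrightarrow> quasi_iso Q X Y s \<Longrightarrow> is_iso T X Y (arr X Y s)"
  unfolding is_iso_def using qis_inverse[of X Y s]
  by (auto simp: arr_in_hom qi_chain intro!: bexI[of _ "cls Y X X s gid"] cls_in_hom chain_map_id)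

subsection \<open>Zero objects\<close>

lemma gcomp_0 [simp]: "gcomp 0 f = 0" by (intro ext) (simp add: gcomp_def)

lemma gcomp_chain_0: "chain_map Q C D f \<Longrightarrow> bounded_complex Q C \<Longrightarrow> gcomp f 0 = 0"
  by (intro ext) (simp add: gcomp_def chain_0[of Q C D f])

lemma hom_zeroD: "hom_zero T X Y \<Longrightarrow> a \<in> hom X Y \<Longrightarrow> b \<in> hom X Y \<Longrightarrow> a = b"
  by (auto simp: hom_zero_def)

lemma cls_zero:
  assumes "bounded_complex Q X" "bounded_complex Q Y" "bounded_complex Q W" "quasi_iso Q W X s"
  shows "cls X Y W s 0 = arr X Y 0"
  using cls_refine[of X Y X gid 0 W s] assms by (simp add: chain_map_zero quasi_iso_id)

lemma acyclic_if_hom_zero: assumes X: "bounded_complex Q X" and h: "hom_zero T X X" shows "acyclic_cpx X"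
proof -
  have "arr X X gid = arr X X 0"
    by (rule hom_zeroD[OF h]) (simp_all add: arr_in_hom X chain_map_id chain_map_zero)
  then obtain V w where "bounded_complex Q V" "quasi_iso Q V X w" "homotopic Q V X (gcomp gid w) (gcomp 0 w)"
    using cls_same_denominator_iff[of X X X gid gid 0] X quasi_iso_id chain_map_id chain_map_zero by blast
  then show ?thesis using acyclic_if_null[of Q V X w] X by simp
qed

text \<open>
  In the absence of an addition on \<open>Hom\<close>, the zero morphisms are those represented by the zero maps; a morphism to or
  from \<open>X\<close> equals its composite with the identity of \<open>X\<close>, which is zero.
\<close>

lemma zero_obj_if_id_zero: assumes X: "bounded_complex Q X" and id: "arr X X gid = arr X X 0" shows "zero_obj T X"
proof -
  have "hom X Y = {arr X Y 0} \<and> hom Y X = {arr Y X 0}" if Y: "bounded_complex Q Y" for Y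
  proof -
    have "a = arr X Y 0" if a: "a \<in> hom X Y" for a
    proof -
      from a obtain W s f where W: "a = cls X Y W s f" "bounded_complex Q W" "quasi_iso Q W X s" "chain_map Q W Y f" by (rule homE)
      have "a = rcomp X X Y a (arr X X 0)" using rcomp_id_right[OF X Y a] id by simp
      also have "\<dots> = cls X Y X (gcomp gid gid) (gcomp f 0)" unfolding W(1)
        by (rule rcomp_cls) (use W X Y in \<open>auto simp: quasi_iso_id chain_map_zero gcomp_chain_0[OF qi_chain[OF W(3)]] homotopic_refl\<close>)
      finally show ?thesis using gcomp_chain_0[OF W(4,2)] by simp
    qed
    moreover have "a = arr Y X 0" if a: "a \<in> hom Y X" for a
    proof -
      from a obtain W s f where W: "a = cls Y X W s f" "bounded_complex Q W" "quasi_iso Q W Y s" "chain_map Q W X f" by (rule homE)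
      have "a = rcomp Y X X (arr X X 0) a" using rcomp_id_left[OF Y X a] id by simp
      also have "\<dots> = cls Y X W s (gcomp 0 f)" unfolding W(1)
        by (rule rcomp_arr) (use W X Y in \<open>auto simp: chain_map_zero\<close>)
      finally show ?thesis using cls_zero[OF Y X W(2,3)] by simp
    qed
    ultimately show ?thesis using arr_in_hom[OF X Y chain_map_zero[OF Y]] arr_in_hom[OF Y X chain_map_zero[OF X]] by blast
  qed
  then show ?thesis unfolding zero_obj_def hom_zero_def using X by auto
qed

lemma zero_obj_if_hom_zero: assumes X: "bounded_complex Q X" and h: "hom_zero T X X" shows "zero_obj T X"
  by (rule zero_obj_if_id_zero[OF X], rule hom_zeroD[OF h]) (simp_all add: arr_in_hom X chain_map_id chain_map_zero)

lemma zero_obj_if_trivial: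
  assumes X: "bounded_complex Q X" and z: "\<And>n. mcar (cob X n) \<subseteq> {0}"
  shows "zero_obj T X"
proof (rule zero_obj_if_id_zero[OF X])
  have "homotopic Q X X gid 0"
    by (rule homotopicI[where h="\<lambda>n x. 0"]) (use z in \<open>auto simp: module_hom_zero cpx_fd[OF X] gid_def d_zero[OF X]\<close>)
  then show "arr X X gid = arr X X 0"
    by (intro cls_cong X quasi_iso_id chain_map_id chain_map_zero homotopic_refl)
qed

subsection \<open>Exactness for cones\<close>

context
  fixes C D :: "('v, 'e, 'k) cpx" and u
  assumes C: "bounded_complex Q C" and D: "bounded_complex Q D" and u: "chain_map Q C D u"
begin

lemma cone_ob: "bounded_complex Q (cone C D u)" by (rule bounded_cone[OF fin C D u])

text \<open>
  Exactness of \<open>Hom(W, C) \<rightarrow> Hom(W, D) \<rightarrow> Hom(W, cone u)\<close>: refine the denominator until the composite with the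
  cone is null-homotopic.
\<close>

lemma cone_lift:
  assumes W: "bounded_complex Q W" and hz: "hom_zero T W (cone C D u)" and x: "x \<in> hom W D"
  shows "\<exists>y\<in>hom W C. rcomp W C D (arr C D u) y = x"
proof -
  from x obtain V s f where x: "x = cls W D V s f" and V: "bounded_complex Q V" "quasi_iso Q V W s" "chain_map Q V D f" by (rule homE)
  have ci: "chain_map Q V (cone C D u) (gcomp cone_in f)" by (rule chain_map_comp[OF V(3) chain_cone_in[OF fin C D u]])
  have "cls W (cone C D u) V s (gcomp cone_in f) = cls W (cone C D u) V s 0"
    using hz cls_in_hom[OF W cone_ob V(1,2) ci] cls_in_hom[OF W cone_ob V(1,2) chain_map_zero[OF cone_ob]] unfolding hom_zero_def by auto
  then obtain V' w where V': "bounded_complex Q V'" "quasi_iso Q V' V w" "homotopic Q V' (cone C D u) (gcomp (gcomp cone_in f) w) (gcomp 0 w)"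
    using cls_same_denominator_iff[OF W cone_ob V(1,2) ci chain_map_zero[OF cone_ob]] by blast
  have fw: "chain_map Q V' D (gcomp f w)" by (rule chain_map_comp[OF qi_chain[OF V'(2)] V(3)])
  obtain g where g: "chain_map Q V' C g" "homotopic Q V' D (gcomp f w) (gcomp u g)"
    using lift_to_source[OF fin C D u fw] V'(3) by (auto simp: gcomp_assoc)
  have sw: "quasi_iso Q V' W (gcomp s w)" by (rule quasi_iso_comp[OF V'(2) V(2) V'(1) V(1) W])
  have "rcomp W C D (arr C D u) (cls W C V' (gcomp s w) g) = cls W D V' (gcomp s w) (gcomp u g)"
    by (rule rcomp_arr[OF W C D V'(1) sw g(1) u])
  also have "\<dots> = cls W D V' (gcomp s w) (gcomp f w)"
    by (rule cls_cong[OF W D V'(1) sw chain_map_comp[OF g(1) u] qi_chain[OF sw] fw homotopic_refl[OF V'(1) W] homotopic_sym[OF D g(2)]])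
  also have "\<dots> = x" unfolding x by (rule cls_refine[OF W D V V'(1,2)])
  finally show ?thesis using cls_in_hom[OF W C V'(1) sw g(1)] by blast
qed

text \<open>
  Over a common denominator, a homotopy between the two composites with \<open>u\<close> is a map from the shift of \<open>W\<close> to the cone,
  which vanishes by hypothesis; its first component is the difference of the two maps.
\<close>

lemma cone_mono:
  assumes W: "bounded_complex Q W" and hz: "hom_zero T (shift_cpx W) (cone C D u)" and y: "y \<in> hom W C" and y': "y' \<in> hom W C"
    and eq: "rcomp W C D (arr C D u) y = rcomp W C D (arr C D u) y'"
  shows "y = y'"
proof -
  from common_denominator[OF W C C y y'] obtain V s f f' where V: "bounded_complex Q V" "quasi_iso Q V W s" "chain_map Q V C f" "chain_map Q V C f'"
    and y: "y = cls W C V s f" "y' = cls W C V s f'" .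
  have "cls W D V s (gcomp u f) = cls W D V s (gcomp u f')"
    using eq unfolding y rcomp_arr[OF W C D V(1,2,3) u] rcomp_arr[OF W C D V(1,2,4) u] .
  then obtain V1 w where V1: "bounded_complex Q V1" "quasi_iso Q V1 V w" "homotopic Q V1 D (gcomp (gcomp u f) w) (gcomp (gcomp u f') w)"
    using cls_same_denominator_iff[OF W D V(1,2) chain_map_comp[OF V(3) u] chain_map_comp[OF V(4) u]] by blast
  have fw: "chain_map Q V1 C (gcomp f w)" "chain_map Q V1 C (gcomp f' w)" using V V1 by (auto intro: chain_map_comp qi_chain)
  have sw: "quasi_iso Q V1 W (gcomp s w)" by (rule quasi_iso_comp[OF V1(2) V(2) V1(1) V(1) W])
  obtain k where k: "chain_map Q (shift_cpx V1) (cone C D u) k" "gcomp cone_out k = shift_gmap (gcomp f w - gcomp f' w)"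
    using lift_to_cone[OF fin C D u V1(1) fw] V1(3) by (auto simp: gcomp_assoc)
  have q: "quasi_iso Q (shift_cpx V1) (shift_cpx W) (shift_gmap (gcomp s w))" by (simp add: quasi_iso_shift_iff V1 W sw)
  note sW = bounded_shift[OF W] and sV1 = bounded_shift[OF V1(1)]
  have "cls (shift_cpx W) (cone C D u) (shift_cpx V1) (shift_gmap (gcomp s w)) k = cls (shift_cpx W) (cone C D u) (shift_cpx V1) (shift_gmap (gcomp s w)) 0"
    using hz cls_in_hom[OF sW cone_ob sV1 q k(1)] cls_in_hom[OF sW cone_ob sV1 q chain_map_zero[OF cone_ob]] unfolding hom_zero_def by auto
  then obtain V2' w2' where V2': "bounded_complex Q V2'" "quasi_iso Q V2' (shift_cpx V1) w2'" "homotopic Q V2' (cone C D u) (gcomp k w2') (gcomp 0 w2')"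
    using cls_same_denominator_iff[OF sW cone_ob sV1 q k(1) chain_map_zero[OF cone_ob]] by blast
  obtain V2 where V2: "V2' = shift_cpx V2" by (rule sh.t_surj)
  obtain w2 where w2: "w2' = shift_gmap w2" by (rule sh.m_surj)
  have V2b: "bounded_complex Q V2" "quasi_iso Q V2 V1 w2" using V2' V1 by (auto simp: V2 w2 quasi_iso_shift_iff)
  have co: "chain_map Q (cone C D u) (shift_cpx C) cone_out" by (rule chain_cone_out[OF fin C D u])
  have "homotopic Q V2' (shift_cpx C) (gcomp cone_out (gcomp k w2')) (gcomp cone_out 0)"
    by (rule homotopic_comp_left[OF cone_ob _ co _ _ V2'(1)]) (use V2' chain_map_comp[OF qi_chain[OF V2'(2)] k(1)] chain_map_zero[OF cone_ob] in auto)
  then have "homotopic Q (shift_cpx V2) (shift_cpx C) (shift_gmap (gcomp (gcomp f w - gcomp f' w) w2)) (shift_gmap 0)"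
    unfolding gcomp_assoc[symmetric] k(2) gcomp_chain_0[OF co cone_ob] unfolding V2 w2 shift_gmap_gcomp
    by (simp add: shift_gmap_def zero_fun_def)
  from homotopic_unshift[OF V2b(1) C this] have "homotopic Q V2 C (gcomp (gcomp f w - gcomp f' w) w2) 0" .
  moreover have "gcomp (gcomp f w - gcomp f' w) w2 = gcomp f (gcomp w w2) - gcomp f' (gcomp w w2)" by (intro ext) (simp add: gcomp_def)
  ultimately have "homotopic Q V2 C (gcomp f (gcomp w w2)) (gcomp f' (gcomp w w2))" by (simp add: homotopic_diff_zero)
  moreover have "quasi_iso Q V2 V (gcomp w w2)" by (rule quasi_iso_comp[OF V2b(2) V1(2) V2b(1) V1(1) V(1)])
  ultimately show ?thesis unfolding y using cls_same_denominator_iff[OF W C V] V2b(1) by blast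
qed

text \<open>
  The denominator \<open>s : V \<rightarrow> D\<close> is on the wrong side for an extension to \<open>cone u\<close>.  So \<open>u\<close> is pulled back along \<open>s\<close> to some
  \<open>q : A \<rightarrow> V\<close>, the numerator is extended to \<open>cone q\<close>, and the five lemma identifies the two cones.
\<close>

lemma cone_ext:
  assumes B: "bounded_complex Q B" and hz: "hom_zero T C B" and x: "x \<in> hom D B"
  shows "\<exists>y\<in>hom (cone C D u) B. rcomp D (cone C D u) B y (arr D (cone C D u) cone_in) = x"
proof -
  from x obtain V s f where x: "x = cls D B V s f" and V: "bounded_complex Q V" "quasi_iso Q V D s" "chain_map Q V B f" by (rule homE)
  from ore[OF u V(2) C V(1) D] obtain V1 p h where V1: "bounded_complex Q V1" "quasi_iso Q V1 C p" "chain_map Q V1 V h" "homotopic Q V1 D (gcomp u p) (gcomp s h)" by blast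
  have fh: "chain_map Q V1 B (gcomp f h)" by (rule chain_map_comp[OF V1(3) V(3)])
  have "cls C B V1 p (gcomp f h) = cls C B V1 p 0"
    using hz cls_in_hom[OF C B V1(1,2) fh] cls_in_hom[OF C B V1(1,2) chain_map_zero[OF B]] unfolding hom_zero_def by auto
  then obtain A w where A: "bounded_complex Q A" "quasi_iso Q A V1 w" "homotopic Q A B (gcomp (gcomp f h) w) (gcomp 0 w)"
    using cls_same_denominator_iff[OF C B V1(1,2) fh chain_map_zero[OF B]] by blast
  define q where "q = gcomp h w"
  have q: "chain_map Q A V q" unfolding q_def by (rule chain_map_comp[OF qi_chain[OF A(2)] V1(3)])
  have p: "quasi_iso Q A C (gcomp p w)" by (rule quasi_iso_comp[OF A(2) V1(2) A(1) V1(1) C])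
  have sq: "homotopic Q A D (gcomp u (gcomp p w)) (gcomp s q)"
    using homotopic_comp_right[OF V1(4) qi_chain[OF A(2)]] by (simp add: q_def gcomp_assoc)
  have fq: "homotopic Q A B (gcomp f q) 0" using A(3) by (simp add: q_def gcomp_assoc)
  from extend_to_cone[OF fin A(1) V(1) q V(3) B fq] obtain k where
    k: "chain_map Q (cone A V q) B k" "gcomp k cone_in = f" by blast
  from cone_quasi_iso[OF fin C D u A(1) V(1) q p V(2) sq] obtain S where
    S: "quasi_iso Q (cone A V q) (cone C D u) S" "gcomp S cone_in = gcomp cone_in s" by blast
  have E: "bounded_complex Q (cone A V q)" by (rule bounded_cone[OF fin A(1) V(1) q])
  have ci: "chain_map Q V (cone A V q) cone_in" by (rule chain_cone_in[OF fin A(1) V(1) q])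
  have ci': "chain_map Q D (cone C D u) cone_in" by (rule chain_cone_in[OF fin C D u])
  have "homotopic Q V (cone C D u) (gcomp cone_in s) (gcomp S cone_in)"
    unfolding S(2) by (rule homotopic_refl[OF V(1) cone_ob])
  from rcomp_cls[OF D cone_ob B D quasi_iso_id[OF D] ci' E S(1) k(1) V(1,2) ci this]
  have "rcomp D (cone C D u) B (cls (cone C D u) B (cone A V q) S k) (arr D (cone C D u) cone_in) = x"
    by (simp add: k(2) x)
  then show ?thesis using cls_in_hom[OF cone_ob B E S(1) k(1)] by blast
qed

text \<open>
  A zero object is acyclic, and then the inclusion into the cone is a quasi-isomorphism.
\<close>

lemma cone_zero: assumes "zero_obj T C" shows "is_iso T D (cone C D u) (arr D (cone C D u) cone_in)"
proof -
  have "acyclic_cpx C" using assms acyclic_if_hom_zero[OF C] C by (simp add: zero_obj_def)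
  from quasi_iso_cone_in[OF fin C D u this] show ?thesis by (rule qis_is_iso[OF D cone_ob])
qed

end

end

context derived begin

lemma TriE:
  assumes "(X, Y, Z, f, g, h) \<in> Tri T"
  obtains C D u a b c where "bounded_complex Q X" "bounded_complex Q Y" "bounded_complex Q Z"
    "f \<in> hom X Y" "g \<in> hom Y Z" "h \<in> hom Z (shift_cpx X)"
    "bounded_complex Q C" "bounded_complex Q D" "chain_map Q C D u"
    "is_iso T X C a" "is_iso T Y D b" "is_iso T Z (cone C D u) c"
    "rcomp X Y D b f = rcomp X C D (arr C D u) a"
    "rcomp Y Z (cone C D u) c g = rcomp Y D (cone C D u) (arr D (cone C D u) cone_in) b"
    "rcomp Z (shift_cpx X) (shift_cpx C) (sh.rmap ` a) h =
          rcomp Z (cone C D u) (shift_cpx C) (arr (cone C D u) (shift_cpx C) cone_out) c"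
  using assms unfolding Tri_iff by blast

lemma sh_functor:
  shows "X \<in> Ob T \<Longrightarrow> Y \<in> Ob T \<Longrightarrow> bij_betw ((`) sh.rmap) (Hom T X Y) (Hom T (shift_cpx X) (shift_cpx Y))"
    and "X \<in> Ob T \<Longrightarrow> sh.rmap ` Idn T X = Idn T (shift_cpx X)"
    and "X \<in> Ob T \<Longrightarrow> Y \<in> Ob T \<Longrightarrow> Z \<in> Ob T \<Longrightarrow> x \<in> Hom T X Y \<Longrightarrow> y \<in> Hom T Y Z \<Longrightarrow>
      sh.rmap ` Cmp T X Y Z y x = Cmp T (shift_cpx X) (shift_cpx Y) (shift_cpx Z) (sh.rmap ` y) (sh.rmap ` x)"
  by (simp_all add: sh.rmap_hom sh.rmap_arr sh.rmap_rcomp)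

lemma Tri_iso_middle:
  assumes t: "(X, Y, Z, f, g, h) \<in> Tri T" and Y': "bounded_complex Q Y'" and i: "iso_obj T Y Y'"
  shows "\<exists>f g h. (X, Y', Z, f, g, h) \<in> Tri T"
proof -
  from t obtain C D u a b c where o: "bounded_complex Q X" "bounded_complex Q Y" "bounded_complex Q Z"
    and fgh: "f \<in> hom X Y" "g \<in> hom Y Z" "h \<in> hom Z (shift_cpx X)"
    and CD: "bounded_complex Q C" "bounded_complex Q D" "chain_map Q C D u"
    and iso: "is_iso T X C a" "is_iso T Y D b" "is_iso T Z (cone C D u) c"
    and eq: "rcomp X Y D b f = rcomp X C D (arr C D u) a"
    "rcomp Y Z (cone C D u) c g = rcomp Y D (cone C D u) (arr D (cone C D u) cone_in) b"
    "rcomp Z (shift_cpx X) (shift_cpx C) (sh.rmap ` a) h =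
          rcomp Z (cone C D u) (shift_cpx C) (arr (cone C D u) (shift_cpx C) cone_out) c" by (rule TriE)
  from i obtain e e' where e: "e \<in> hom Y Y'" "e' \<in> hom Y' Y" "rcomp Y Y' Y e' e = arr Y Y gid" "rcomp Y' Y Y' e e' = arr Y' Y' gid"
    by (rule cat.isoE) simp
  note N = cone_ob[OF CD]
  have in1: "b \<in> hom Y D" "c \<in> hom Z (cone C D u)" "arr D (cone C D u) cone_in \<in> hom D (cone C D u)"
    using iso CD N chain_cone_in[OF fin CD] by (auto simp: is_iso_def intro: arr_in_hom)
  have e'_iso: "is_iso T Y' Y e'" using e by (auto simp: is_iso_def)
  show ?thesis unfolding Tri_iff
  proof (intro exI conjI)
    show "rcomp X Y Y' e f \<in> hom X Y'" by (rule rcomp_in_hom[OF o(1,2) Y' fgh(1) e(1)])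
    show "rcomp Y' Y Z g e' \<in> hom Y' Z" by (rule rcomp_in_hom[OF Y' o(2,3) e(2) fgh(2)])
    show "is_iso T Y' D (rcomp Y' Y D b e')" using cat.is_iso_comp[OF e'_iso iso(2)] Y' o(2) CD(2) by simp
    have "rcomp X Y' Y e' (rcomp X Y Y' e f) = rcomp X Y Y (rcomp Y Y' Y e' e) f"
      by (rule rcomp_assoc[symmetric, OF o(1,2) Y' o(2) fgh(1) e(1,2)])
    also have "\<dots> = f" unfolding e(3) by (rule rcomp_id_left[OF o(1,2) fgh(1)])
    finally have "rcomp X Y' D (rcomp Y' Y D b e') (rcomp X Y Y' e f) = rcomp X Y D b f"
      using rcomp_assoc[OF o(1) Y' o(2) CD(2) rcomp_in_hom[OF o(1,2) Y' fgh(1) e(1)] e(2) in1(1)] by simp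
    then show "rcomp X Y' D (rcomp Y' Y D b e') (rcomp X Y Y' e f) = rcomp X C D (arr C D u) a" using eq(1) by simp
    have "rcomp Y' Z (cone C D u) c (rcomp Y' Y Z g e') = rcomp Y' Y (cone C D u) (rcomp Y Z (cone C D u) c g) e'"
      by (rule rcomp_assoc[symmetric, OF Y' o(2,3) N e(2) fgh(2) in1(2)])
    also have "\<dots> = rcomp Y' D (cone C D u) (arr D (cone C D u) cone_in) (rcomp Y' Y D b e')"
      unfolding eq(2) by (rule rcomp_assoc[OF Y' o(2) CD(2) N e(2) in1(1,3)])
    finally show "rcomp Y' Z (cone C D u) c (rcomp Y' Y Z g e') = rcomp Y' D (cone C D u) (arr D (cone C D u) cone_in) (rcomp Y' Y D b e')" .
  qed (use o Y' CD fgh iso eq in auto)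
qed

lemma Tri_id:
  assumes E: "bounded_complex Q E"
  shows "\<exists>X f g h. zero_obj T X \<and> (X, E, E, f, g, h) \<in> Tri T"
proof -
  let ?O = "zero_cpx :: ('v, 'e, 'k) cpx"
  have O: "bounded_complex Q ?O" by (rule bounded_zero_cpx)
  have u: "chain_map Q ?O E 0" by (rule chain_map_zero[OF E])
  note N = cone_ob[OF O E u]
  let ?N = "cone ?O E 0"
  have zO: "zero_obj T ?O" by (rule zero_obj_if_trivial[OF O]) (simp add: zero_cpx_def)
  \<comment> \<open>the triangle is that of \<open>0 \<rightarrow> E\<close>, with \<open>E\<close> in place of the isomorphic cone\<close>
  define c where "c = arr E ?N cone_in"
  have c: "is_iso T E ?N c" unfolding c_def by (rule cone_zero[OF O E u zO])
  have ci: "c \<in> hom E ?N" using c by (simp add: is_iso_def)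
  have co: "arr ?N (shift_cpx ?O) cone_out \<in> hom ?N (shift_cpx ?O)"
    by (rule arr_in_hom[OF N bounded_shift[OF O] chain_cone_out[OF fin O E u]])
  define h where "h = rcomp E ?N (shift_cpx ?O) (arr ?N (shift_cpx ?O) cone_out) c"
  have h: "h \<in> hom E (shift_cpx ?O)" unfolding h_def by (rule rcomp_in_hom[OF E N bounded_shift[OF O] ci co])
  have idE: "arr E E gid \<in> hom E E" "is_iso T E E (arr E E gid)"
    using cat.id_in[of E] cat.is_iso_id[of E] E by auto
  have idO: "is_iso T ?O ?O (arr ?O ?O gid)" using cat.is_iso_id[of ?O] O by simp
  have ue: "arr ?O E 0 \<in> hom ?O E" by (rule arr_in_hom[OF O E u])
  have "(?O, E, E, arr ?O E 0, arr E E gid, h) \<in> Tri T" unfolding Tri_iff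
  proof (intro exI conjI)
    show "rcomp ?O E E (arr E E gid) (arr ?O E 0) = rcomp ?O ?O E (arr ?O E 0) (arr ?O ?O gid)"
      by (simp add: rcomp_id_left[OF O E ue] rcomp_id_right[OF O E ue])
    show "rcomp E E ?N c (arr E E gid) = rcomp E E ?N (arr E ?N cone_in) (arr E E gid)" by (simp add: c_def)
    show "rcomp E (shift_cpx ?O) (shift_cpx ?O) (sh.rmap ` arr ?O ?O gid) h = rcomp E ?N (shift_cpx ?O) (arr ?N (shift_cpx ?O) cone_out) c"
      unfolding sh.rmap_arr[OF O O] shift_gmap_gid rcomp_id_left[OF E bounded_shift[OF O] h] by (rule h_def)
  qed (use O E u idE idO c ue h in auto)
  with zO show ?thesis by blast
qed

sublocale tri: tri_category T
proof
  fix X assume "X \<in> Ob T" "hom_zero T X X"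
  then show "zero_obj T X" by (simp add: zero_obj_if_hom_zero)
next
  fix X assume "X \<in> Ob T"
  then show "Sh T X \<in> Ob T" by simp
next
  fix X Y assume o: "X \<in> Ob T" "Y \<in> Ob T"
  show "iso_obj T (Sh T X) (Sh T Y) \<longleftrightarrow> iso_obj T X Y"
    using cat.iso_obj_image[of "\<lambda>_ _. (`) sh.rmap" shift_cpx, OF sh_functor o] by simp
  assume "hom_zero T X Y"
  then show "hom_zero T (Sh T X) (Sh T Y)" using cat.hom_zero_image[OF sh_functor(1)[OF o]] by simp
next
  fix X Y Z f g h assume t: "(X, Y, Z, f, g, h) \<in> Tri T"
  then obtain C D u a b c where o: "bounded_complex Q X" "bounded_complex Q Y" "bounded_complex Q Z"
    and fgh: "f \<in> hom X Y" "g \<in> hom Y Z" "h \<in> hom Z (shift_cpx X)"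
    and CD: "bounded_complex Q C" "bounded_complex Q D" "chain_map Q C D u"
    and iso: "is_iso T X C a" "is_iso T Y D b" "is_iso T Z (cone C D u) c"
    and eq: "rcomp X Y D b f = rcomp X C D (arr C D u) a"
    "rcomp Y Z (cone C D u) c g = rcomp Y D (cone C D u) (arr D (cone C D u) cone_in) b" by (rule TriE)
  note N = cone_ob[OF CD]
  have O: "X \<in> Ob T" "Y \<in> Ob T" "Z \<in> Ob T" "C \<in> Ob T" "D \<in> Ob T" "cone C D u \<in> Ob T" using o CD N by auto
  have fg: "f \<in> Hom T X Y" "g \<in> Hom T Y Z" "arr C D u \<in> Hom T C D" "arr D (cone C D u) cone_in \<in> Hom T D (cone C D u)"
    using fgh arr_in_hom[OF CD] arr_in_hom[OF CD(2) N chain_cone_in[OF fin CD]] by auto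
  have sq: "Cmp T X Y D b f = Cmp T X C D (arr C D u) a"
    "Cmp T Y Z (cone C D u) c g = Cmp T Y D (cone C D u) (arr D (cone C D u) cone_in) b" using eq by simp_all
  show "X \<in> Ob T \<and> Y \<in> Ob T \<and> Z \<in> Ob T \<and> f \<in> Hom T X Y \<and> g \<in> Hom T Y Z" using o fgh by simp
  show "\<exists>y\<in>Hom T W X. Cmp T W X Y f y = x" if W: "W \<in> Ob T" and hz: "hom_zero T W Z" and x: "x \<in> Hom T W Y" for W x
  proof (rule cat.transport_lift[OF O(1,2,4,5) W iso(1,2) fg(1,3) sq(1) _ x])
    have hz': "hom_zero T W (cone C D u)" by (rule cat.hom_zero_iso_target[OF hz cat.is_iso_obj[OF iso(3)] W O(3,6)])
    fix x assume "x \<in> Hom T W D"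
    then show "\<exists>y\<in>Hom T W C. Cmp T W C D (arr C D u) y = x" using cone_lift[OF CD _ hz', of x] W by simp
  qed
  show "y = y'" if W: "W \<in> Ob T" and hz: "hom_zero T (Sh T W) Z" and y: "y \<in> Hom T W X" "y' \<in> Hom T W X" "Cmp T W X Y f y = Cmp T W X Y f y'" for W y y'
  proof (rule cat.transport_mono[OF O(1,2,4,5) W iso(1,2) fg(1,3) sq(1) _ y])
    have sW: "Sh T W \<in> Ob T" using W by simp
    have hz': "hom_zero T (shift_cpx W) (cone C D u)"
      using cat.hom_zero_iso_target[OF hz cat.is_iso_obj[OF iso(3)] sW O(3,6)] by simp
    fix y y' assume "y \<in> Hom T W C" "y' \<in> Hom T W C" "Cmp T W C D (arr C D u) y = Cmp T W C D (arr C D u) y'"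
    then show "y = y'" using cone_mono[OF CD _ hz', of y y'] W by simp
  qed
  show "\<exists>y\<in>Hom T Z B. Cmp T Y Z B y g = x" if B: "B \<in> Ob T" and hz: "hom_zero T X B" and x: "x \<in> Hom T Y B" for B x
  proof (rule cat.transport_ext[OF O(2,3,5,6) B iso(2,3) fg(2,4) sq(2) _ x])
    have hz': "hom_zero T C B" by (rule cat.hom_zero_iso_source[OF hz cat.is_iso_obj[OF iso(1)] O(1,4) B])
    fix x assume "x \<in> Hom T D B"
    then show "\<exists>y\<in>Hom T (cone C D u) B. Cmp T D (cone C D u) B y (arr D (cone C D u) cone_in) = x"
      using cone_ext[OF CD _ hz', of x] B by simp
  qed
  show "iso_obj T Y Z" if z: "zero_obj T X"
  proof -
    have "hom_zero T X X" using z O(1) by (simp add: zero_obj_def)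
    then have "hom_zero T C C"
      using cat.hom_zero_iso_source[OF _ cat.is_iso_obj[OF iso(1)] O(1,4)] cat.hom_zero_iso_target[OF _ cat.is_iso_obj[OF iso(1)] _ O(1,4)] O by blast
    then have "zero_obj T C" by (rule zero_obj_if_hom_zero[OF CD(1)])
    from cat.is_iso_obj[OF cone_zero[OF CD this]]
    show ?thesis using cat.is_iso_obj[OF iso(2)] cat.is_iso_obj[OF iso(3)] O cat.iso_trans cat.iso_sym by blast
  qed
  show "\<exists>f g h. (X, Y', Z, f, g, h) \<in> Tri T" if "Y' \<in> Ob T" "iso_obj T Y Y'" for Y'
    using Tri_iso_middle[OF t _ that(2)] that(1) by simp
next
  fix E assume "E \<in> Ob T"
  then show "\<exists>X f g h. zero_obj T X \<and> (X, E, E, f, g, h) \<in> Tri T" using Tri_id by simp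
qed

end

section \<open>Twisting along an automorphism of the path algebra\<close>

text \<open>
  Ring automorphisms which preserve the scalars as a set, but not each of them: the Frobenius is not linear.
\<close>

definition algebra_automorphism ::
    "('v, 'e) pre_digraph \<Rightarrow> (('v, 'e, 'k::field) pathfun \<Rightarrow> ('v, 'e, 'k) pathfun) \<Rightarrow> bool" where
  "algebra_automorphism Q \<phi> \<longleftrightarrow> bij \<phi> \<and> (\<forall>a. \<phi> a \<in> path_algebra Q \<longleftrightarrow> a \<in> path_algebra Q) \<and>
     (\<forall>a\<in>path_algebra Q. \<forall>b\<in>path_algebra Q. \<phi> (a + b) = \<phi> a + \<phi> b \<and> \<phi> (path_mult Q a b) = path_mult Q (\<phi> a) (\<phi> b)) \<and>
     \<phi> (path_one Q) = path_one Q \<and>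
     (\<forall>c. \<exists>c'. \<phi> (path_scalar Q c) = path_scalar Q c') \<and> (\<forall>c. \<exists>c'. \<phi> (path_scalar Q c') = path_scalar Q c)"

context
  fixes Q :: "('v, 'e) pre_digraph" and \<phi> :: "('v, 'e, 'k::field) pathfun \<Rightarrow> ('v, 'e, 'k) pathfun"
  assumes aut: "algebra_automorphism Q \<phi>"
begin

lemma aut_inv [simp]: "inv_into UNIV \<phi> (\<phi> a) = a" "\<phi> (inv_into UNIV \<phi> a) = a" "inv_into UNIV (inv_into UNIV \<phi>) = \<phi>"
proof -
  have b: "bij \<phi>" using aut by (simp add: algebra_automorphism_def)
  show "inv_into UNIV \<phi> (\<phi> a) = a" "\<phi> (inv_into UNIV \<phi> a) = a"
    using b by (auto simp: bij_def surj_f_inv_f)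
  show "inv_into UNIV (inv_into UNIV \<phi>) = \<phi>" by (rule inv_inv_eq[OF b])
qed

lemma aut_inv_in [simp]: "inv_into UNIV \<phi> a \<in> path_algebra Q \<longleftrightarrow> a \<in> path_algebra Q"
  using aut unfolding algebra_automorphism_def by (metis aut_inv(2))

lemma algebra_automorphism_inv: "algebra_automorphism Q (inv_into UNIV \<phi>)"
proof -
  let ?i = "inv_into UNIV \<phi>"
  have 1: "?i x = y" if "x = \<phi> y" for x y using that by simp
  have "?i (a + b) = ?i a + ?i b \<and> ?i (path_mult Q a b) = path_mult Q (?i a) (?i b)"
    if ab: "a \<in> path_algebra Q" "b \<in> path_algebra Q" for a b
  proof -
    have "?i a \<in> path_algebra Q" "?i b \<in> path_algebra Q" using ab by simp_all
    then have "\<phi> (?i a + ?i b) = a + b" "\<phi> (path_mult Q (?i a) (?i b)) = path_mult Q a b"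
      using aut unfolding algebra_automorphism_def by simp_all
    then show ?thesis using 1 by metis
  qed
  moreover have "?i (path_one Q) = path_one Q" using aut by (intro 1) (simp add: algebra_automorphism_def)
  moreover have "\<exists>c'. ?i (path_scalar Q c) = path_scalar Q c'" "\<exists>c'. ?i (path_scalar Q c') = path_scalar Q c" for c
    using aut 1 unfolding algebra_automorphism_def by metis+
  moreover have "bij ?i" using aut bij_imp_bij_inv unfolding algebra_automorphism_def by blast
  ultimately show ?thesis unfolding algebra_automorphism_def by simp
qed

lemma mcar_twist [simp]: "mcar (twist_module \<phi> M) = mcar M" by (simp add: twist_module_def)
lemma mact_twist [simp]: "mact (twist_module \<phi> M) a = mact M (inv_into UNIV \<phi> a)" by (simp add: twist_module_def)

lemma twist_module_inv: "twist_module (inv_into UNIV \<phi>) (twist_module \<phi> M) = M"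
  by (simp add: twist_module_def)

lemma module_hom_twist: "module_hom Q (twist_module \<phi> M) (twist_module \<phi> N) f \<longleftrightarrow> module_hom Q M N f"
proof -
  have "(\<forall>a\<in>path_algebra Q. R (inv_into UNIV \<phi> a)) \<longleftrightarrow> (\<forall>a\<in>path_algebra Q. R a)" for R
    by (metis aut_inv(1) aut_inv_in)
  from this[of "\<lambda>a. \<forall>x\<in>mcar M. f (mact M a x) = mact N a (f x)"] show ?thesis
    unfolding module_hom_def by simp
qed

lemma fd_module_twist: assumes M: "fd_module Q M" shows "fd_module Q (twist_module \<phi> M)"
proof -
  let ?i = "inv_into UNIV \<phi>"
  have i: "?i (a + b) = ?i a + ?i b" "?i (path_mult Q a b) = path_mult Q (?i a) (?i b)" if "a \<in> path_algebra Q" "b \<in> path_algebra Q" for a b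
    using that algebra_automorphism_inv unfolding algebra_automorphism_def by blast+
  have one: "?i (path_one Q) = path_one Q" using algebra_automorphism_inv unfolding algebra_automorphism_def by blast
  obtain B where B: "finite B" "B \<subseteq> mcar M" "\<forall>x\<in>mcar M. \<exists>c. x = (\<Sum>b\<in>B. mact M (path_scalar Q (c b)) b)"
    using M unfolding fd_module_def by blast
  obtain \<tau> where \<tau>: "\<And>c. ?i (path_scalar Q (\<tau> c)) = path_scalar Q c"
    using algebra_automorphism_inv unfolding algebra_automorphism_def by metis
  have "\<forall>x\<in>mcar M. \<exists>c. x = (\<Sum>b\<in>B. mact M (?i (path_scalar Q (c b))) b)"
  proof
    fix x assume "x \<in> mcar M"
    then obtain c where "x = (\<Sum>b\<in>B. mact M (path_scalar Q (c b)) b)" using B(3) by blast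
    then show "\<exists>c. x = (\<Sum>b\<in>B. mact M (?i (path_scalar Q (c b))) b)"
      by (intro exI[of _ "\<lambda>b. \<tau> (c b)"]) (simp add: \<tau>)
  qed
  then have "\<exists>B. finite B \<and> B \<subseteq> mcar M \<and> (\<forall>x\<in>mcar M. \<exists>c. x = (\<Sum>b\<in>B. mact M (?i (path_scalar Q (c b))) b))" using B by blast
  then show ?thesis using M unfolding fd_module_def by (simp add: i one)
qed

lemma cob_twist [simp]: "cob (twist_cpx \<phi> C) n = twist_module \<phi> (cob C n)" by (simp add: twist_cpx_def)
lemma cdf_twist [simp]: "cdf (twist_cpx \<phi> C) = cdf C" by (simp add: twist_cpx_def)

lemma twist_cpx_inv: "twist_cpx (inv_into UNIV \<phi>) (twist_cpx \<phi> C) = C"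
  by (simp add: twist_cpx_def twist_module_inv)

lemma bounded_twist: "bounded_complex Q C \<Longrightarrow> bounded_complex Q (twist_cpx \<phi> C)"
  unfolding bounded_complex_def by (simp add: module_hom_twist fd_module_twist)

lemma chain_map_twist: "chain_map Q (twist_cpx \<phi> C) (twist_cpx \<phi> D) f \<longleftrightarrow> chain_map Q C D f"
  unfolding chain_map_def by (simp add: module_hom_twist)

lemma homotopic_twist: "homotopic Q (twist_cpx \<phi> C) (twist_cpx \<phi> D) f g \<longleftrightarrow> homotopic Q C D f g"
  unfolding homotopic_def by (simp add: module_hom_twist)

lemma quasi_iso_twist: "quasi_iso Q (twist_cpx \<phi> C) (twist_cpx \<phi> D) f \<longleftrightarrow> quasi_iso Q C D f"
  unfolding quasi_iso_def by (simp add: chain_map_twist cocycles_def coboundaries_def)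

lemma twist_shift: "twist_cpx \<phi> (shift_cpx C) = shift_cpx (twist_cpx \<phi> C)"
  by (simp add: twist_cpx_def shift_cpx_def)

lemma twist_cone: "twist_cpx \<phi> (cone C D f) = cone (twist_cpx \<phi> C) (twist_cpx \<phi> D) f"
  by (simp add: twist_cpx_def cone_def sum_module_def twist_module_def)

end

locale twisted_derived = derived Q T for Q :: "('v, 'e) pre_digraph" and T :: "(('v, 'e, 'k::field) cpx, ('v, 'e, 'k) roof set) tricat" +
  fixes \<phi> :: "('v, 'e, 'k) pathfun \<Rightarrow> ('v, 'e, 'k) pathfun"
  assumes aut: "algebra_automorphism Q \<phi>"
begin

lemma twist_cpx_inv2: "twist_cpx \<phi> (twist_cpx (inv_into UNIV \<phi>) C) = C"
  using twist_cpx_inv[OF algebra_automorphism_inv[OF aut], of C] by (simp add: aut_inv(3)[OF aut])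

lemma bounded_twist_iff: "bounded_complex Q (twist_cpx \<phi> C) \<longleftrightarrow> bounded_complex Q C"
  using bounded_twist[OF aut, of C] bounded_twist[OF algebra_automorphism_inv[OF aut], of "twist_cpx \<phi> C"]
  by (auto simp: twist_cpx_inv[OF aut])

sublocale tw: fractions_automorphism "bounded_complex Q :: ('v, 'e, 'k) cpx \<Rightarrow> bool" "chain_map Q" "homotopic Q" "quasi_iso Q" gcomp gid
  "twist_cpx \<phi>" "\<lambda>f. f"
proof
  show "bij (twist_cpx \<phi>)" by (rule bijI'; metis twist_cpx_inv[OF aut] twist_cpx_inv2)
  show "bij (\<lambda>f :: 'k gmap. f)" using bij_id by (simp add: id_def)
qed (auto simp: bounded_twist_iff chain_map_twist[OF aut] homotopic_twist[OF aut] quasi_iso_twist[OF aut])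

definition twist_functor :: "(('v, 'e, 'k) cpx, ('v, 'e, 'k) roof set) endofunctor" where
  "twist_functor = \<lparr>fob = twist_cpx \<phi>, fmor = (\<lambda>X Y a. (\<lambda>(W, s, f). (twist_cpx \<phi> W, s, f)) ` a)\<rparr>"

lemma twist_functor_simps [simp]: "fob twist_functor = twist_cpx \<phi>" "fmor twist_functor X Y = (`) tw.rmap"
  by (simp_all add: twist_functor_def tw.rmap_def)

lemma tw_functor:
  shows "X \<in> Ob T \<Longrightarrow> Y \<in> Ob T \<Longrightarrow> bij_betw ((`) tw.rmap) (Hom T X Y) (Hom T (twist_cpx \<phi> X) (twist_cpx \<phi> Y))"
    and "X \<in> Ob T \<Longrightarrow> tw.rmap ` Idn T X = Idn T (twist_cpx \<phi> X)"
    and "X \<in> Ob T \<Longrightarrow> Y \<in> Ob T \<Longrightarrow> Z \<in> Ob T \<Longrightarrow> x \<in> Hom T X Y \<Longrightarrow> y \<in> Hom T Y Z \<Longrightarrow>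
      tw.rmap ` Cmp T X Y Z y x = Cmp T (twist_cpx \<phi> X) (twist_cpx \<phi> Y) (twist_cpx \<phi> Z) (tw.rmap ` y) (tw.rmap ` x)"
  by (simp_all add: tw.rmap_hom tw.rmap_arr tw.rmap_rcomp)

lemma tw_sh: "tw.rmap ` sh.rmap ` a = sh.rmap ` tw.rmap ` a"
  by (force simp: image_image tw.rmap_def sh.rmap_def twist_shift[OF aut] split: prod.splits intro!: image_cong)

text \<open>
  Twisting commutes with cones, so that the model of a triangle is twisted along with it.
\<close>

lemma twist_Tri:
  assumes t: "(X, Y, Z, f, g, h) \<in> Tri T"
  shows "(twist_cpx \<phi> X, twist_cpx \<phi> Y, twist_cpx \<phi> Z, tw.rmap ` f, tw.rmap ` g, tw.rmap ` h) \<in> Tri T"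
proof -
  from t obtain C D u a b c where o: "bounded_complex Q X" "bounded_complex Q Y" "bounded_complex Q Z"
    and fgh: "f \<in> hom X Y" "g \<in> hom Y Z" "h \<in> hom Z (shift_cpx X)"
    and CD: "bounded_complex Q C" "bounded_complex Q D" "chain_map Q C D u"
    and iso: "is_iso T X C a" "is_iso T Y D b" "is_iso T Z (cone C D u) c"
    and eq: "rcomp X Y D b f = rcomp X C D (arr C D u) a"
    "rcomp Y Z (cone C D u) c g = rcomp Y D (cone C D u) (arr D (cone C D u) cone_in) b"
    "rcomp Z (shift_cpx X) (shift_cpx C) (sh.rmap ` a) h =
          rcomp Z (cone C D u) (shift_cpx C) (arr (cone C D u) (shift_cpx C) cone_out) c" by (rule TriE)
  note N = cone_ob[OF CD]
  let ?t = "twist_cpx \<phi>"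
  have in1: "a \<in> hom X C" "b \<in> hom Y D" "c \<in> hom Z (cone C D u)" using iso by (auto simp: is_iso_def)
  have in2: "arr C D u \<in> hom C D" "arr D (cone C D u) cone_in \<in> hom D (cone C D u)"
      "arr (cone C D u) (shift_cpx C) cone_out \<in> hom (cone C D u) (shift_cpx C)" "sh.rmap ` a \<in> hom (shift_cpx X) (shift_cpx C)"
    using CD N chain_cone_in[OF fin CD] chain_cone_out[OF fin CD] sh.rmap_hom[OF o(1) CD(1)] in1(1)
    by (auto simp: bij_betw_def intro!: arr_in_hom)
  have tin: "tw.rmap ` x \<in> hom (?t A) (?t B)" if "bounded_complex Q A" "bounded_complex Q B" "x \<in> hom A B" for A B x
    using tw.rmap_hom[OF that(1,2)] that(3) by (auto simp: bij_betw_def)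
  have tiso: "is_iso T (?t A) (?t B) (tw.rmap ` x)" if "bounded_complex Q A" "bounded_complex Q B" "is_iso T A B x" for A B x
    using cat.is_iso_image[of "\<lambda>_ _. (`) tw.rmap" ?t, OF tw_functor, of A B x] that by (auto simp: is_iso_def[of T A B x])
  show ?thesis unfolding Tri_iff
  proof (intro conjI exI)
    show "is_iso T (?t X) (?t C) (tw.rmap ` a)" "is_iso T (?t Y) (?t D) (tw.rmap ` b)" using tiso iso o CD by auto
    show "is_iso T (?t Z) (cone (?t C) (?t D) u) (tw.rmap ` c)" using tiso[OF o(3) N iso(3)] by (simp add: twist_cone[OF aut])
    show "chain_map Q (?t C) (?t D) u" using CD(3) by (simp add: chain_map_twist[OF aut])
    show "rcomp (?t X) (?t Y) (?t D) (tw.rmap ` b) (tw.rmap ` f) = rcomp (?t X) (?t C) (?t D) (arr (?t C) (?t D) u) (tw.rmap ` a)"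
      using arg_cong[OF eq(1), of "(`) tw.rmap"]
      by (simp only: tw.rmap_rcomp[OF o(1,2) CD(2) fgh(1) in1(2)] tw.rmap_rcomp[OF o(1) CD(1,2) in1(1) in2(1)] tw.rmap_arr[OF CD(1,2)])
    show "rcomp (?t Y) (?t Z) (cone (?t C) (?t D) u) (tw.rmap ` c) (tw.rmap ` g) =
        rcomp (?t Y) (?t D) (cone (?t C) (?t D) u) (arr (?t D) (cone (?t C) (?t D) u) cone_in) (tw.rmap ` b)"
      using arg_cong[OF eq(2), of "(`) tw.rmap"]
      by (simp only: tw.rmap_rcomp[OF o(2,3) N fgh(2) in1(3)] tw.rmap_rcomp[OF o(2) CD(2) N in1(2) in2(2)] tw.rmap_arr[OF CD(2) N] twist_cone[OF aut])
    show "rcomp (?t Z) (shift_cpx (?t X)) (shift_cpx (?t C)) (sh.rmap ` tw.rmap ` a) (tw.rmap ` h) =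
          rcomp (?t Z) (cone (?t C) (?t D) u) (shift_cpx (?t C)) (arr (cone (?t C) (?t D) u) (shift_cpx (?t C)) cone_out) (tw.rmap ` c)"
      using arg_cong[OF eq(3), of "(`) tw.rmap"]
      by (simp only: tw.rmap_rcomp[OF o(3) bounded_shift[OF o(1)] bounded_shift[OF CD(1)] fgh(3) in2(4)]
          tw.rmap_rcomp[OF o(3) N bounded_shift[OF CD(1)] in1(3) in2(3)] tw.rmap_arr[OF N bounded_shift[OF CD(1)]]
          twist_cone[OF aut] twist_shift[OF aut] tw_sh)
    show "tw.rmap ` h \<in> hom (?t Z) (shift_cpx (?t X))"
      using tin[OF o(3) bounded_shift[OF o(1)] fgh(3)] by (simp add: twist_shift[OF aut])
  qed (use o CD fgh tin in \<open>auto simp: bounded_twist_iff\<close>)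
qed

end

sublocale twisted_derived \<subseteq> tri_automorphism T twist_functor
proof
  \<comment> \<open>twisting back is of the same kind, which shows that triangles are reflected as well\<close>
  interpret twi: twisted_derived Q T "inv_into UNIV \<phi>"
    by unfold_locales (rule algebra_automorphism_inv[OF aut])
  show "bij_betw (fob twist_functor) (Ob T) (Ob T)"
    by (rule bij_betwI[where g="twist_cpx (inv_into UNIV \<phi>)"])
      (auto simp: bounded_twist_iff twi.bounded_twist_iff twist_cpx_inv[OF aut] twist_cpx_inv2)
  fix X Y Z assume o: "X \<in> Ob T" "Y \<in> Ob T" "Z \<in> Ob T"
  fix f g h assume "(fob twist_functor X, fob twist_functor Y, fob twist_functor Z, f, g, h) \<in> Tri T"
  from twi.twist_Tri[OF this] show "\<exists>f g h. (X, Y, Z, f, g, h) \<in> Tri T"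
    by (auto simp: twist_cpx_inv[OF aut])
next
  fix X Y assume o: "X \<in> Ob T" "Y \<in> Ob T"
  show "bij_betw (fmor twist_functor X Y) (Hom T X Y) (Hom T (fob twist_functor X) (fob twist_functor Y))"
    using tw_functor(1)[OF o] by simp
  fix a assume a: "a \<in> Hom T X Y"
  show "ShM T X Y a \<in> Hom T (Sh T X) (Sh T Y)" using sh_functor(1)[OF o] a by (auto simp: bij_betw_def)
  show "fmor twist_functor (Sh T X) (Sh T Y) (ShM T X Y a) = ShM T (fob twist_functor X) (fob twist_functor Y) (fmor twist_functor X Y a)"
    by (simp add: tw_sh)
next
  fix X Y Z a b assume "X \<in> Ob T" "Y \<in> Ob T" "Z \<in> Ob T" "a \<in> Hom T X Y" "b \<in> Hom T Y Z"
  then show "fmor twist_functor X Z (Cmp T X Y Z b a) =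
    Cmp T (fob twist_functor X) (fob twist_functor Y) (fob twist_functor Z) (fmor twist_functor Y Z b) (fmor twist_functor X Y a)"
    using tw_functor(3)[of X Y Z a b] by simp
next
  fix X Y Z f g h assume t: "(X, Y, Z, f, g, h) \<in> Tri T"
  then show "h \<in> Hom T Z (Sh T X)" by (auto simp: Tri_iff)
  show "(fob twist_functor X, fob twist_functor Y, fob twist_functor Z, fmor twist_functor X Y f, fmor twist_functor Y Z g,
     fmor twist_functor Z (Sh T X) h) \<in> Tri T" using twist_Tri[OF t] by simp
qed (use tw_functor(2) in \<open>simp_all add: twist_shift[OF aut]\<close>)

section \<open>The Frobenius automorphism of the path algebra\<close>

text \<open>
  For a prime \<open>r\<close> dividing the order of the additive group, let \<open>H\<close> be a subgroup of order \<open>r\<close>, by Sylow's theorem.  Adding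
  \<open>x \<in> H\<close> permutes \<open>H\<close>, and comparing the sums of all elements shows \<open>r x = 0\<close>; hence \<open>r\<close> is the characteristic.
\<close>

lemma finite_field_card:
  "\<exists>n. card (UNIV :: 'f::{field,finite} set) = CHAR('f) ^ n"
proof -
  let ?N = "card (UNIV :: 'f set)" and ?p = "CHAR('f)"
  have p: "prime ?p" by (rule prime_CHAR_semidom) (simp add: finite_imp_CHAR_pos)
  have N: "?N \<noteq> 0" by simp
  have only: "r = ?p" if r: "prime r" "r dvd ?N" for r
  proof -
    let ?G = "\<lparr>carrier = UNIV :: 'f set, monoid.mult = (+), one = 0\<rparr>"
    have G: "group ?G"
    proof (rule groupI)
      fix x :: 'f
      show "\<exists>y\<in>carrier ?G. y \<otimes>\<^bsub>?G\<^esub> x = \<one>\<^bsub>?G\<^esub>" by (rule bexI[of _ "- x"]) auto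
    qed (auto simp: add.assoc)
    have "Coset.order ?G = r ^ 1 * (?N div r)" using r(2) by (simp add: Coset.order_def)
    from sylow_thm[OF r(1) G this] obtain H where H: "subgroup H ?G" "card H = r" by auto
    have "1 < card H" using H(2) prime_gt_1_nat[OF r(1)] by simp
    then obtain x where x: "x \<in> H" "x \<noteq> 0"
      by (metis One_nat_def Suc_lessD card.empty card_le_Suc0_iff_eq finite leD zero_less_one card_gt_0_iff)
    have add: "h + x \<in> H" if "h \<in> H" for h using subgroup.m_closed[OF H(1) that x(1)] by simp
    have inj: "inj_on (\<lambda>h. h + x) H" by (simp add: inj_on_def)
    have "(\<lambda>h. h + x) ` H = H" by (rule card_subset_eq) (use add card_image[OF inj] in auto)
    then have "(\<Sum>h\<in>H. h) = (\<Sum>h\<in>H. h + x)" using sum.reindex[OF inj, of "\<lambda>h. h"] by simp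
    also have "\<dots> = (\<Sum>h\<in>H. h) + of_nat (card H) * x" by (simp add: sum.distrib)
    finally have "of_nat r = (0 :: 'f)" using x(2) H(2) by simp
    then have "?p dvd r" by (simp add: of_nat_eq_0_iff_char_dvd)
    then show "r = ?p" using p r(1) primes_dvd_imp_eq by metis
  qed
  obtain m where m: "?N = ?p ^ multiplicity ?p ?N * m" "\<not> ?p dvd m"
    using multiplicity_decompose'[OF N, of ?p] p by (metis not_prime_unit)
  have "m = 1"
  proof (rule ccontr)
    assume "m \<noteq> 1"
    then obtain r where r: "prime r" "r dvd m" using prime_factor_nat[of m] by blast
    then have "r dvd ?N" using m(1) by (metis dvd_mult)
    with only[OF r(1)] r(2) m(2) show False by simp
  qed
  with m(1) show ?thesis by auto
qed

context
  fixes q :: nat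
  assumes q: "q = card (UNIV :: 'f::{field,finite} set)"
begin

lemma frob_sum: "(\<Sum>i\<in>I. x i) ^ q = (\<Sum>i\<in>I. (x i :: 'f alg_closure) ^ q)"
proof -
  obtain n where n: "q = CHAR('f) ^ n" using finite_field_card[where 'f='f] q by auto
  have "prime (CHAR('f))" by (rule prime_CHAR_semidom) (simp add: finite_imp_CHAR_pos)
  then show ?thesis using freshmans_dream_sum'[where 'a="'f alg_closure", of q n x I] n by simp
qed

lemma q_pos: "0 < q" unfolding q by (rule finite_UNIV_card_ge_0) simp

lemma frob_add: "(x + y :: 'f alg_closure) ^ q = x ^ q + y ^ q"
  using frob_sum[of "\<lambda>b. if b then x else y" "UNIV :: bool set"] by (simp add: UNIV_bool add.commute)

lemma frob_inj: "(x :: 'f alg_closure) ^ q = y ^ q \<longleftrightarrow> x = y"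
proof
  assume *: "x ^ q = y ^ q"
  have "x ^ q = (x - y) ^ q + y ^ q" using frob_add[of "x - y" y] by simp
  with * have "(x - y) ^ q = 0" by simp
  then show "x = y" by simp
qed simp

lemma frob_surj: "\<exists>x. x ^ q = (y :: 'f alg_closure)"
  by (rule nth_root_exists[OF q_pos])

end

lemma path_end_simp: "path_end Q (u, p) = (if p = [] then u else head Q (last p))"
  by (simp add: path_end_def pre_digraph.awalk_verts_conv)

lemma quiver_automorphism_inv:
  assumes "quiver_automorphism Q \<iota>\<^sub>v \<iota>\<^sub>e"
  shows "quiver_automorphism Q (inv_into UNIV \<iota>\<^sub>v) (inv_into UNIV \<iota>\<^sub>e)"
proof -
  have v: "\<iota>\<^sub>v permutes verts Q" and e: "\<iota>\<^sub>e permutes arcs Q"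
    and h: "\<And>x. x \<in> arcs Q \<Longrightarrow> tail Q (\<iota>\<^sub>e x) = \<iota>\<^sub>v (tail Q x) \<and> head Q (\<iota>\<^sub>e x) = \<iota>\<^sub>v (head Q x)"
    using assms unfolding quiver_automorphism_def by auto
  have "tail Q (inv_into UNIV \<iota>\<^sub>e x) = inv_into UNIV \<iota>\<^sub>v (tail Q x) \<and> head Q (inv_into UNIV \<iota>\<^sub>e x) = inv_into UNIV \<iota>\<^sub>v (head Q x)"
    if x: "x \<in> arcs Q" for x
  proof -
    have y: "inv_into UNIV \<iota>\<^sub>e x \<in> arcs Q" using permutes_in_image[OF permutes_inv[OF e]] x by simp
    from h[OF this] show ?thesis
      using permutes_inverses[OF v] permutes_inverses[OF e] by metis
  qed
  then show ?thesis unfolding quiver_automorphism_def using permutes_inv[OF v] permutes_inv[OF e] by blast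
qed

lemma paths_map:
  assumes a: "quiver_automorphism Q \<iota>\<^sub>v \<iota>\<^sub>e" and p: "(u, p) \<in> paths Q"
  shows "(\<iota>\<^sub>v u, map \<iota>\<^sub>e p) \<in> paths Q"
proof -
  have v: "\<iota>\<^sub>v permutes verts Q" and e: "\<iota>\<^sub>e permutes arcs Q"
    and h: "\<And>x. x \<in> arcs Q \<Longrightarrow> tail Q (\<iota>\<^sub>e x) = \<iota>\<^sub>v (tail Q x) \<and> head Q (\<iota>\<^sub>e x) = \<iota>\<^sub>v (head Q x)"
    using a unfolding quiver_automorphism_def by auto
  from p obtain w where w: "u \<in> verts Q" "set p \<subseteq> arcs Q" "pre_digraph.cas Q u p w"
    by (auto simp: paths_def pre_digraph.awalk_def)
  have "pre_digraph.cas Q (\<iota>\<^sub>v u) (map \<iota>\<^sub>e p) (\<iota>\<^sub>v w)" using w(2,3)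
    by (induction p arbitrary: u) (auto simp: pre_digraph.cas.simps h)
  moreover have "\<iota>\<^sub>v u \<in> verts Q" "set (map \<iota>\<^sub>e p) \<subseteq> arcs Q"
    using w permutes_in_image[OF v] permutes_in_image[OF e] by auto
  ultimately show ?thesis by (auto simp: paths_def pre_digraph.awalk_def)
qed

lemma path_end_map:
  assumes a: "quiver_automorphism Q \<iota>\<^sub>v \<iota>\<^sub>e" and p: "(u, p) \<in> paths Q"
  shows "path_end Q (\<iota>\<^sub>v u, map \<iota>\<^sub>e p) = \<iota>\<^sub>v (path_end Q (u, p))"
proof -
  have "set p \<subseteq> arcs Q" using p by (auto simp: paths_def pre_digraph.awalk_def)
  then have "p \<noteq> [] \<Longrightarrow> last p \<in> arcs Q" using last_in_set by blast
  then show ?thesis using a by (simp add: path_end_simp last_map quiver_automorphism_def)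
qed

text \<open>
  The map \<open>x \<mapsto> x\<^sup>q\<close> is additive because \<open>q\<close> is a power of the characteristic, and bijective because the field is
  algebraically closed; and \<open>\<iota>\<close> permutes the paths, compatibly with concatenation.
\<close>

lemma frob_alg_automorphism:
  fixes Q :: "('v, 'e) pre_digraph"
  assumes a: "quiver_automorphism Q \<iota>\<^sub>v \<iota>\<^sub>e"
  shows "algebra_automorphism Q (frob_alg \<iota>\<^sub>v \<iota>\<^sub>e :: ('v, 'e, 'f::{field,finite} alg_closure) pathfun \<Rightarrow> _)"
proof -
  define q where "q = card (UNIV :: 'f set)"
  note [simp] = q_pos[OF q_def]
  let ?F = "frob_alg \<iota>\<^sub>v \<iota>\<^sub>e :: ('v, 'e, 'f alg_closure) pathfun \<Rightarrow> _"
  let ?v = "inv_into UNIV \<iota>\<^sub>v" and ?e = "inv_into UNIV \<iota>\<^sub>e"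
  have v: "\<iota>\<^sub>v permutes verts Q" and e: "\<iota>\<^sub>e permutes arcs Q" using a unfolding quiver_automorphism_def by auto
  note ai = quiver_automorphism_inv[OF a]
  have F: "?F x (u, p) = (x (?v u, map ?e p)) ^ q" for x u p by (simp add: frob_alg_def q_def)
  have vv [simp]: "\<iota>\<^sub>v (?v u) = u" "?v (\<iota>\<^sub>v u) = u" for u using permutes_inverses[OF v] by auto
  have ee [simp]: "map \<iota>\<^sub>e (map ?e p) = p" "map ?e (map \<iota>\<^sub>e p) = p" for p
    using permutes_inverses[OF e] by (auto simp: comp_def intro: map_idI)
  have "x = y" if "?F x = ?F y" for x y :: "('v, 'e, 'f alg_closure) pathfun"
  proof (rule ext)
    fix s :: "'v \<times> 'e list" obtain u p where s: "s = (u, p)" by (cases s)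
    have "?F x (\<iota>\<^sub>v u, map \<iota>\<^sub>e p) = ?F y (\<iota>\<^sub>v u, map \<iota>\<^sub>e p)" using that by simp
    then show "x s = y s" unfolding F vv ee frob_inj[OF q_def] s .
  qed
  moreover have "\<exists>x. y = ?F x" for y :: "('v, 'e, 'f alg_closure) pathfun"
  proof -
    obtain r where r: "\<And>z. (r z :: 'f alg_closure) ^ q = z" using frob_surj[OF q_def] by metis
    have "y = ?F (\<lambda>(u, p). r (y (\<iota>\<^sub>v u, map \<iota>\<^sub>e p)))"
    proof (rule ext)
      fix s :: "'v \<times> 'e list" obtain u p where s: "s = (u, p)" by (cases s)
      show "y s = ?F (\<lambda>(u, p). r (y (\<iota>\<^sub>v u, map \<iota>\<^sub>e p))) s" unfolding s F prod.case vv ee r ..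
    qed
    then show ?thesis by blast
  qed
  ultimately have bij: "bij ?F" unfolding bij_def inj_def surj_def by blast
  let ?J = "\<lambda>(u, p). (?v u, map ?e p)"
  have Jinj: "inj ?J"
  proof (rule injI)
    fix s s' assume "?J s = ?J s'"
    then show "s = s'" by (cases s, cases s') (metis Pair_inject case_prod_conv ee(1) vv(1))
  qed
  have Jpaths: "?J s \<in> paths Q \<longleftrightarrow> s \<in> paths Q" for s
    using paths_map[OF ai, of "fst s" "snd s"] paths_map[OF a, of "?v (fst s)" "map ?e (snd s)"]
    by (cases s) (auto simp del: map_map)
  have supp: "{s. ?F x s \<noteq> 0} = ?J -` {s. x s \<noteq> 0}" for x by (auto simp: F)
  have Jsurj: "surj ?J"
  proof (rule surjI)
    fix s show "?J (\<iota>\<^sub>v (fst s), map \<iota>\<^sub>e (snd s)) = s" by (cases s) (simp del: map_map)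
  qed
  have PA: "?F x \<in> path_algebra Q \<longleftrightarrow> x \<in> path_algebra Q" for x
  proof -
    have "finite (?J -` S) \<longleftrightarrow> finite S" for S
      using finite_vimageI[OF _ Jinj] finite_vimageD[OF _ Jsurj] by blast
    moreover have "?J -` S \<subseteq> paths Q \<longleftrightarrow> S \<subseteq> paths Q" for S
    proof
      assume *: "?J -` S \<subseteq> paths Q"
      show "S \<subseteq> paths Q"
      proof
        fix s assume "s \<in> S"
        moreover obtain s0 where "s = ?J s0" using Jsurj by (metis surjE)
        ultimately show "s \<in> paths Q" using * Jpaths[of s0] by auto
      qed
    next
      assume "S \<subseteq> paths Q"
      then show "?J -` S \<subseteq> paths Q" using Jpaths by blast
    qed
    ultimately show ?thesis unfolding path_algebra_def mem_Collect_eq supp by (simp only:)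
  qed
  have add: "?F (x + y) = ?F x + ?F y" for x y
    by (rule ext) (auto simp: F frob_add[OF q_def])
  have mult: "?F (path_mult Q x y) = path_mult Q (?F x) (?F y)" if y: "y \<in> path_algebra Q" for x y
  proof (rule ext)
    fix s :: "'v \<times> 'e list" obtain u p where s: "s = (u, p)" by (cases s)
    have term_eq: "(x (path_end Q (?v u, take i (map ?e p)), drop i (map ?e p)) * y (?v u, take i (map ?e p))) ^ q =
      ?F x (path_end Q (u, take i p), drop i p) * ?F y (u, take i p)" for i
    proof (cases "y (?v u, take i (map ?e p)) = 0")
      case True
      then show ?thesis by (simp add: F take_map)
    next
      case False
      then have "(?v u, map ?e (take i p)) \<in> paths Q" using y by (auto simp: path_algebra_def take_map)
      from path_end_map[OF a this] have "?v (path_end Q (u, take i p)) = path_end Q (?v u, map ?e (take i p))"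
        unfolding vv ee by simp
      then show ?thesis by (simp add: F take_map drop_map power_mult_distrib)
    qed
    show "?F (path_mult Q x y) s = path_mult Q (?F x) (?F y) s"
      unfolding s F by (simp add: path_mult_def frob_sum[OF q_def] term_eq)
  qed
  have one: "?F (path_one Q) = path_one Q"
  proof (rule ext)
    fix s :: "'v \<times> 'e list" obtain u p where s: "s = (u, p)" by (cases s)
    show "?F (path_one Q) s = path_one Q s"
      unfolding s F by (simp add: path_one_def permutes_in_image[OF permutes_inv[OF v]])
  qed
  have scalar: "?F (path_scalar Q c) = path_scalar Q (c ^ q)" for c
  proof -
    have "?F (path_scalar Q c) s = c ^ q * ?F (path_one Q) s" for s by (cases s) (simp add: F path_scalar_def power_mult_distrib)
    then show ?thesis unfolding one by (simp add: path_scalar_def fun_eq_iff)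
  qed
  show ?thesis unfolding algebra_automorphism_def
    using bij PA add mult one scalar frob_surj[OF q_def] by metis
qed

section \<open>The sum of the simple modules\<close>

text \<open>
  The sum of the simple modules at the vertices \<open>v 0, \<dots>, v (n - 1)\<close>, on \<open>k\<^sup>n\<close>.
\<close>

definition simples :: "(nat \<Rightarrow> 'v) \<Rightarrow> nat \<Rightarrow> ('v, 'e, 'k::field) kqmod" where
  "simples v n = \<lparr>mcar = {x. \<forall>j\<ge>n. x j = 0}, mact = (\<lambda>a x j. if j < n then a (v j, []) * x j else 0)\<rparr>"

lemma fd_simples:
  assumes v: "\<And>j. j < n \<Longrightarrow> v j \<in> verts Q"
  shows "fd_module Q (simples v n :: ('v, 'e, 'k::field) kqmod)"
proof -
  let ?M = "simples v n :: ('v, 'e, 'k) kqmod"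
  define b where "b j = (\<lambda>i. if i = j then 1 else 0 :: 'k)" for j :: nat
  have inj: "inj_on b {..<n}" by (auto simp: inj_on_def b_def fun_eq_iff split: if_splits) 
  have gen: "\<exists>c. x = (\<Sum>b\<in>b ` {..<n}. mact ?M (path_scalar Q (c b)) b)" if x: "x \<in> mcar ?M" for x
  proof (rule exI[of _ "\<lambda>b. \<Sum>j<n. x j * b j"])
    have c: "(\<Sum>i<n. x i * b j i) = x j" if "j < n" for j using that by (simp add: b_def if_distrib cong: if_cong)
    \<comment> \<open>\<open>\<Sum>j<n. x j * y j\<close> recovers the coefficient \<open>x i\<close> from the unit vector \<open>y = b i\<close>\<close>
    have "(\<Sum>y\<in>b ` {..<n}. mact ?M (path_scalar Q (\<Sum>j<n. x j * y j)) y) = (\<Sum>j<n. mact ?M (path_scalar Q (x j)) (b j))"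
      unfolding sum.reindex[OF inj] by (rule sum.cong) (auto simp: c)
    also have "\<dots> = x"
    proof (rule ext)
      fix i
      have sum_apply: "(\<Sum>j<m. g j) i = (\<Sum>j<m. g j i)" for g :: "nat \<Rightarrow> nat \<Rightarrow> 'k" and m
        by (induction m) auto
      have "(\<Sum>j<n. mact ?M (path_scalar Q (x j)) (b j)) i = (\<Sum>j<n. if i = j then x j else 0)"
        unfolding sum_apply by (rule sum.cong) (auto simp: simples_def path_scalar_def path_one_def b_def v)
      also have "\<dots> = x i" using x by (auto simp: simples_def)
      finally show "(\<Sum>j<n. mact ?M (path_scalar Q (x j)) (b j)) i = x i" .
    qed
    finally show "x = (\<Sum>y\<in>b ` {..<n}. mact ?M (path_scalar Q (\<Sum>j<n. x j * y j)) y)" ..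
  qed
  have "b ` {..<n} \<subseteq> mcar ?M" by (auto simp: b_def simples_def)
  then have G: "\<exists>B. finite B \<and> B \<subseteq> mcar ?M \<and> (\<forall>x\<in>mcar ?M. \<exists>c. x = (\<Sum>b\<in>B. mact ?M (path_scalar Q (c b)) b))"
    using gen by (intro exI[of _ "b ` {..<n}"]) auto
  show ?thesis unfolding fd_module_def
    by (intro conjI G)
      (auto simp: simples_def fun_eq_iff distrib_left distrib_right path_mult_def path_one_def path_end_simp v mult.assoc)
qed

definition stalk :: "('v, 'e, 'k::field) kqmod \<Rightarrow> ('v, 'e, 'k) cpx" where
  "stalk M = \<lparr>cob = (\<lambda>n. if n = 0 then M else \<lparr>mcar = {0}, mact = (\<lambda>a x. 0)\<rparr>), cdf = (\<lambda>n x. 0)\<rparr>"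

lemma bounded_stalk:
  fixes Q :: "('v, 'e) pre_digraph" and M :: "('v, 'e, 'k::field) kqmod"
  assumes M: "fd_module Q M" shows "bounded_complex Q (stalk M)"
proof -
  have 0: "fd_module Q (\<lparr>mcar = {0}, mact = (\<lambda>a x. 0)\<rparr> :: ('v, 'e, 'k) kqmod)" by (auto simp: fd_module_def)
  have fd: "fd_module Q (cob (stalk M) n)" for n using M 0 by (simp add: stalk_def)
  have d: "cdf (stalk M) n = (\<lambda>x. 0)" for n by (simp add: stalk_def)
  have "\<forall>n. \<bar>n\<bar> > 0 \<longrightarrow> mcar (cob (stalk M) n) = {0}" by (simp add: stalk_def)
  then have "\<exists>b. \<forall>n. \<bar>n\<bar> > b \<longrightarrow> mcar (cob (stalk M) n) = {0}" by blast
  then show ?thesis unfolding bounded_complex_def d by (auto intro: fd module_hom_zero)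
qed

lemma coboundaries_no_differential:
  assumes "\<And>n x. cdf C n x = 0" "bounded_complex Q C"
  shows "coboundaries C n = {0}" "cocycles C n = mcar (cob C n)"
  using assms cpx_zero[OF assms(2)] by (auto simp: coboundaries_def cocycles_def)

lemma (in derived) stalk_nonzero:
  assumes M: "fd_module Q M" and x: "x \<in> mcar M" "x \<noteq> 0"
  shows "\<not> zero_obj T (stalk M)"
proof
  note b = bounded_stalk[OF M]
  assume "zero_obj T (stalk M)"
  then have "hom_zero T (stalk M) (stalk M)" using b by (simp add: zero_obj_def)
  from acyclic_if_hom_zero[OF b this] have a: "cocycles (stalk M) 0 \<subseteq> coboundaries (stalk M) 0"
    unfolding acyclic_cpx_def by blast
  have d: "cdf (stalk M) n y = 0" for n y by (simp add: stalk_def)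
  from a x show False unfolding coboundaries_no_differential[OF d b] by (auto simp: stalk_def)
qed

text \<open>
  The hypotheses on \<open>C\<close> allow for twists of stalk complexes, which are not literally of the form \<open>stalk N\<close>.
\<close>

lemma stalk_iso:
  assumes M: "fd_module Q M" and N: "fd_module Q N" and C: "bounded_complex Q C" "\<And>n x. cdf C n x = 0"
    "cob C 0 = N" "\<And>n. n \<noteq> 0 \<Longrightarrow> mcar (cob C n) = {0}"
    and f: "module_hom Q N M f" "bij_betw f (mcar N) (mcar M)"
  shows "quasi_iso Q C (stalk M) (\<lambda>n x. if n = 0 then f x else 0)"
proof -
  note b = bounded_stalk[OF M]
  have d: "cdf (stalk M) n y = 0" for n y by (simp add: stalk_def)
  have f0: "f 0 = 0" by (rule hom_0[OF f(1) N])
  have inj: "x = 0" if "x \<in> mcar N" "f x = 0" for x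
    using f(2) that f0 fd_zero[OF N] unfolding bij_betw_def by (metis inj_onD)
  have hom: "module_hom Q (cob C n) (cob (stalk M) n) (\<lambda>x. if n = 0 then f x else 0)" for n
    using f(1) C(3) module_hom_zero[OF cpx_fd[OF b, of n]] by (cases "n = 0") (simp_all add: stalk_def)
  have chain: "chain_map Q C (stalk M) (\<lambda>n x. if n = 0 then f x else 0)"
    unfolding chain_map_def using hom by (auto simp: C(2) d f0)
  have "\<exists>x\<in>mcar (cob C n). y - (if n = 0 then f x else 0) = 0" if "y \<in> mcar (cob (stalk M) n)" for n y
  proof (cases "n = 0")
    case True
    then have "y \<in> f ` mcar N" using f(2) that by (simp add: bij_betw_def stalk_def)
    then show ?thesis using True C(3) by auto
  next
    case False
    then show ?thesis using that C(4)[OF False] by (simp add: stalk_def)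
  qed
  moreover have "x = 0" if "x \<in> mcar (cob C n)" "(if n = 0 then f x else 0) = 0" for n x
    using that inj C(3) C(4)[of n] by (cases "n = 0") auto
  ultimately show ?thesis unfolding quasi_iso_def coboundaries_no_differential[OF d b] coboundaries_no_differential[OF C(2,1)]
    using chain by auto
qed

text \<open>
  The \<open>j\<close>-th coordinate of the image is the \<open>q\<close>-th power of the coordinate at the vertex \<open>\<iota>\<^sup>-\<^sup>1(v j)\<close>.  The \<open>q\<close>-th power
  compensates for the Frobenius on the scalars in the twisted action.
\<close>

lemma simples_frob:
  fixes Q :: "('v, 'e) pre_digraph"
  assumes a: "quiver_automorphism Q \<iota>\<^sub>v \<iota>\<^sub>e" and v: "bij_betw v {..<n} (verts Q)"
  defines "M \<equiv> simples v n :: ('v, 'e, 'f::{field,finite} alg_closure) kqmod"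
  shows "\<exists>f. module_hom Q (twist_module (frob_alg \<iota>\<^sub>v \<iota>\<^sub>e) M) M f \<and> bij_betw f (mcar M) (mcar M)"
proof -
  define q where "q = card (UNIV :: 'f set)"
  note [simp] = q_pos[OF q_def]
  let ?F = "frob_alg \<iota>\<^sub>v \<iota>\<^sub>e :: ('v, 'e, 'f alg_closure) pathfun \<Rightarrow> _"
  note aut = frob_alg_automorphism[OF a, where 'f='f]
  have pv: "\<iota>\<^sub>v permutes verts Q" using a by (simp add: quiver_automorphism_def)
  define \<pi> where "\<pi> j = inv_into {..<n} v (inv_into UNIV \<iota>\<^sub>v (v j))" for j
  define \<rho> where "\<rho> j = inv_into {..<n} v (\<iota>\<^sub>v (v j))" for j
  have vj: "v j \<in> verts Q" if "j < n" for j using v that by (auto simp: bij_betw_def)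
  have \<pi>: "\<pi> j < n" "v (\<pi> j) = inv_into UNIV \<iota>\<^sub>v (v j)" if "j < n" for j
  proof -
    have "inv_into UNIV \<iota>\<^sub>v (v j) \<in> v ` {..<n}"
      using v vj[OF that] permutes_in_image[OF permutes_inv[OF pv]] by (auto simp: bij_betw_def)
    then show "\<pi> j < n" "v (\<pi> j) = inv_into UNIV \<iota>\<^sub>v (v j)"
      unfolding \<pi>_def using inv_into_into[of _ v "{..<n}"] f_inv_into_f[of _ v "{..<n}"] by auto
  qed
  have \<rho>: "\<rho> j < n" "v (\<rho> j) = \<iota>\<^sub>v (v j)" if "j < n" for j
  proof -
    have "\<iota>\<^sub>v (v j) \<in> v ` {..<n}"
      using v vj[OF that] permutes_in_image[OF pv] by (auto simp: bij_betw_def)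
    then show "\<rho> j < n" "v (\<rho> j) = \<iota>\<^sub>v (v j)"
      unfolding \<rho>_def using inv_into_into[of _ v "{..<n}"] f_inv_into_f[of _ v "{..<n}"] by auto
  qed
  have vinj: "i = j" if "i < n" "j < n" "v i = v j" for i j using v that by (auto simp: bij_betw_def inj_on_def)
  have \<pi>\<rho>: "\<pi> (\<rho> j) = j" "\<rho> (\<pi> j) = j" if "j < n" for j
    using that \<pi> \<rho> permutes_inverses[OF pv] by (auto intro!: vinj)
  define f where "f x = (\<lambda>j. if j < n then (x (\<pi> j) :: 'f alg_closure) ^ q else 0)" for x
  have "module_hom Q (twist_module ?F M) M f"
    unfolding module_hom_def
  proof (intro conjI ballI)
    fix x y assume "x \<in> mcar (twist_module ?F M)"
    show "f x \<in> mcar M" by (simp add: f_def M_def simples_def)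
    show "f (x + y) = f x + f y" by (rule ext) (simp add: f_def frob_add[OF q_def])
    fix c :: "('v, 'e, 'f alg_closure) pathfun" assume "c \<in> path_algebra Q"
    have F: "?F (inv_into UNIV ?F c) (u, []) = (inv_into UNIV ?F c (inv_into UNIV \<iota>\<^sub>v u, [])) ^ q" for u
      by (simp add: frob_alg_def q_def)
    have c: "(inv_into UNIV ?F c (inv_into UNIV \<iota>\<^sub>v u, [])) ^ q = c (u, [])" for u
      unfolding F[symmetric] aut_inv(2)[OF aut] ..
    show "f (mact (twist_module ?F M) c x) = mact M c (f x)"
      by (rule ext) (simp add: f_def M_def simples_def twist_module_def \<pi> c power_mult_distrib)
  qed
  moreover have "bij_betw f (mcar M) (mcar M)"
    unfolding bij_betw_def
  proof (intro conjI inj_onI equalityI subsetI)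
    fix x y assume x: "x \<in> mcar M" and y: "y \<in> mcar M" and eq: "f x = f y"
    show "x = y"
    proof (rule ext)
      fix j
      show "x j = y j"
      proof (cases "j < n")
        case True
        then show ?thesis using fun_cong[OF eq, of "\<rho> j"] \<rho> \<pi>\<rho> by (simp add: f_def frob_inj[OF q_def])
      next
        case False
        then show ?thesis using x y by (simp add: M_def simples_def)
      qed
    qed
  next
    fix y assume "y \<in> f ` mcar M"
    then show "y \<in> mcar M" by (auto simp: f_def M_def simples_def)
  next
    fix y assume y: "y \<in> mcar M"
    obtain r where r: "\<And>z. (r z :: 'f alg_closure) ^ q = z" using frob_surj[OF q_def] by metis
    define x where "x j = (if j < n then r (y (\<rho> j)) else 0)" for j
    have "f x = y" by (rule ext) (use y in \<open>simp add: f_def x_def \<pi> \<pi>\<rho> r M_def simples_def\<close>)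
    moreover have "x \<in> mcar M" by (simp add: x_def M_def simples_def)
    ultimately show "y \<in> f ` mcar M" by blast
  qed
  ultimately show ?thesis by blast
qed

section \<open>Gepner type and invariant stability conditions\<close>

theorem proposition6p1:
  fixes Q :: "('v, 'e) pre_digraph"
    and \<iota>\<^sub>v :: "'v \<Rightarrow> 'v" and \<iota>\<^sub>e :: "'e \<Rightarrow> 'e"
    and D :: "(('v, 'e, 'f::{field,finite} alg_closure) cpx,
                ('v, 'e, 'f alg_closure) roof set) tricat"
    and F :: "(('v, 'e, 'f alg_closure) cpx, ('v, 'e, 'f alg_closure) roof set) endofunctor"
  assumes "fin_digraph Q" and "acyclic_quiver Q"
    and "admissible_automorphism Q \<iota>\<^sub>v \<iota>\<^sub>e"
    and "D = derived_category Q"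
    and "F = frobenius_functor \<iota>\<^sub>v \<iota>\<^sub>e"
  shows "(\<forall>\<sigma>\<in>FStab D F. gepner_type D F 0 \<sigma>) \<and>
         (\<forall>\<sigma>\<in>Stab D. (\<exists>s. gepner_type D F s \<sigma>) \<longrightarrow> \<sigma> \<in> FStab D F)"
proof -
  have fin: "finite (verts Q)" using assms(1) by (rule fin_digraph.finite_verts)
  have a: "quiver_automorphism Q \<iota>\<^sub>v \<iota>\<^sub>e" using assms(3) by (simp add: admissible_automorphism_def)
  let ?\<phi> = "frob_alg \<iota>\<^sub>v \<iota>\<^sub>e :: ('v, 'e, 'f alg_closure) pathfun \<Rightarrow> _"
  have aut: "algebra_automorphism Q ?\<phi>" by (rule frob_alg_automorphism[OF a])
  interpret twisted_derived Q D ?\<phi> by unfold_locales (rule fin assms(4) aut)+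
  have F: "F = twist_functor" using assms(5) by (simp add: frobenius_functor_def twist_functor_def)
  have "\<sigma> \<in> FStab D F" if S: "\<sigma> \<in> Stab D" and g: "gepner_type D F s \<sigma>" for \<sigma> s
  proof (cases "verts Q = {}")
    case True
    have "zero_obj D X" if "X \<in> Ob D" for X
    proof (rule zero_obj_if_trivial)
      show X: "bounded_complex Q X" using that by simp
      show "mcar (cob X n) \<subseteq> {0}" for n
      proof
        fix x assume x: "x \<in> mcar (cob X n)"
        let ?one = "path_one Q :: ('v, 'e, 'f alg_closure) pathfun"
        \<comment> \<open>without vertices the unit is zero, hence acts as zero\<close>
        have one: "?one + ?one = ?one" using True by (intro ext) (auto simp: path_one_def)
        have "path_scalar Q (1 :: 'f alg_closure) = ?one" by (simp add: path_scalar_def)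
        moreover have "path_scalar Q (1 :: 'f alg_closure) \<in> path_algebra Q" by (rule path_scalar_in[OF fin])
        ultimately have PA: "?one \<in> path_algebra Q" by metis
        have m: "fd_module Q (cob X n)" by (rule cpx_fd[OF X])
        have "x = mact (cob X n) ?one x" using m x by (simp add: fd_module_def)
        moreover have "mact (cob X n) (?one + ?one) x = mact (cob X n) ?one x + mact (cob X n) ?one x"
          using m x PA unfolding fd_module_def by blast
        ultimately have "x = x + x" unfolding one by simp
        then show "x \<in> {0}" by simp
      qed
    qed
    then show ?thesis unfolding F by (rule trivial_FStab[OF S])
  next
    case False
    define n where "n = card (verts Q)"
    obtain v where v: "bij_betw v {..<n} (verts Q)" using ex_bij_betw_nat_finite[OF fin] by (auto simp: n_def atLeast0LessThan)
    define M :: "('v, 'e, 'f alg_closure) kqmod" where "M = simples v n"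
    have M: "fd_module Q M" unfolding M_def using v by (intro fd_simples) (auto simp: bij_betw_def)
    have n: "0 < n" using False fin by (simp add: n_def card_gt_0_iff)
    define x :: "nat \<Rightarrow> 'f alg_closure" where "x = (\<lambda>i. if i = 0 then 1 else 0)"
    have "x \<in> mcar M" using n by (simp add: x_def M_def simples_def)
    moreover have "x \<noteq> 0" by (auto simp: x_def fun_eq_iff)
    ultimately have nz: "\<not> zero_obj D (stalk M)" by (rule stalk_nonzero[OF M])
    obtain f where f: "module_hom Q (twist_module ?\<phi> M) M f" "bij_betw f (mcar M) (mcar M)"
      using simples_frob[OF a v] unfolding M_def by blast
    note b = bounded_stalk[OF M]
    have "quasi_iso Q (twist_cpx ?\<phi> (stalk M)) (stalk M) (\<lambda>n x. if n = 0 then f x else 0)"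
      by (rule stalk_iso[OF M fd_module_twist[OF aut M] bounded_twist[OF aut b] _ _ _ f(1)])
        (use f(2) in \<open>auto simp: stalk_def twist_cpx_def twist_module_def\<close>)
    then have "iso_obj D (fob F (stalk M)) (stalk M)"
      unfolding F using cat.is_iso_obj[OF qis_is_iso[OF bounded_twist[OF aut b] b]] by simp
    then show ?thesis using gepner_imp_FStab[of s \<sigma> "stalk M"] g nz b unfolding F by simp
  qed
  moreover have "gepner_type D F 0 \<sigma>" if "\<sigma> \<in> FStab D F" for \<sigma>
    using FStab_imp_gepner[of \<sigma>] that unfolding F by simp
  ultimately show ?thesis by blast
qed

end
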